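(* Let $A$ be a nonunital simple separable $C^*$-algebra with real rank zero, stable rank one and with $V(A)$ strictly unperforated. Assume also that $A$ is nonelementary. If the multiplier algebra $\mathcal{M}(A)$ has real rank zero, then $\mathcal{M}(A)$ is not extremally rich.
   Context: Nonelementary means not isomorphic to the algebra of compact operators on a Hilbert space. For a unital $C^*$-algebra $B$, $\mathcal{E}(B)$ is the set of extreme points of its closed unit ball; $B$ is extremally rich if $B^{-1}\mathcal{E}(B)B^{-1}$ is norm-dense in $B$. $V(A)$ is the abelian monoid of Murray-von Neumann equivalence classes of projections in $M_\infty(A)$, with $x\le y$ iff $y=x+z$ for some $z\in V(A)$, and $x<y$ iff $x\le y$ and $x\ne y$; it is cancellative when $A$ has stable rank one. A cancellative monoid is strictly unperforated if $nx<ny$ for some $n\in\mathbb{N}$ implies $x<y$. *)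

theory Defs
  imports "HOL-Analysis.Analysis"
begin

section \<open>C*-algebras\<close>

class star =
  fixes star :: "'a \<Rightarrow> 'a"

class scaleC =
  fixes scaleC :: "complex \<Rightarrow> 'a \<Rightarrow> 'a" (infixr "*\<^sub>C" 75)

text \<open>Not necessarily unital. The library has no class of complex algebras, so the complex scalar
  multiplication is added to \<open>real_normed_algebra\<close> and tied to the real one.\<close>

class cstar_algebra = real_normed_algebra + banach + star + scaleC +
  assumes scaleC_add_right: "c *\<^sub>C (x + y) = c *\<^sub>C x + c *\<^sub>C y"
    and scaleC_add_left: "(c + d) *\<^sub>C x = c *\<^sub>C x + d *\<^sub>C x"
    and scaleC_scaleC: "c *\<^sub>C d *\<^sub>C x = (c * d) *\<^sub>C x"
    and scaleC_of_real: "complex_of_real r *\<^sub>C x = r *\<^sub>R x"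
    and mult_scaleC_left: "(c *\<^sub>C x) * y = c *\<^sub>C (x * y)"
    and mult_scaleC_right: "x * (c *\<^sub>C y) = c *\<^sub>C (x * y)"
    and norm_scaleC: "norm (c *\<^sub>C x) = cmod c * norm x"
    and star_star: "star (star x) = x"
    and star_add: "star (x + y) = star x + star y"
    and star_scaleC: "star (c *\<^sub>C x) = cnj c *\<^sub>C star x"
    and star_mult: "star (x * y) = star y * star x"
    and cstar_identity: "norm (star x * x) = (norm x)\<^sup>2"

lemma scaleC_one:
  fixes x :: "'a::cstar_algebra"
  shows "1 *\<^sub>C x = x"
  using scaleC_of_real[of 1 x] by simp

lemma scaleC_zero_left:
  fixes x :: "'a::cstar_algebra"
  shows "0 *\<^sub>C x = 0"
  using scaleC_of_real[of 0 x] by simp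

lemma scaleC_zero_right:
  shows "c *\<^sub>C 0 = (0::'a::cstar_algebra)"
  using scaleC_add_right[of c "0::'a" 0] by simp

lemma scaleC_minus_right:
  fixes x :: "'a::cstar_algebra"
  shows "c *\<^sub>C (- x) = - (c *\<^sub>C x)"
  using scaleC_add_right[of c x "- x"] by (simp add: scaleC_zero_right minus_unique)

lemma scaleC_diff_right:
  fixes x y :: "'a::cstar_algebra"
  shows "c *\<^sub>C (x - y) = c *\<^sub>C x - c *\<^sub>C y"
  using scaleC_add_right[of c x "- y"] by (simp add: scaleC_minus_right)

lemma scaleC_scaleR:
  fixes x :: "'a::cstar_algebra"
  shows "c *\<^sub>C r *\<^sub>R x = r *\<^sub>R c *\<^sub>C x"
  by (simp add: scaleC_of_real[symmetric] scaleC_scaleC mult.commute)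

lemma star_zero:
  shows "star 0 = (0::'a::cstar_algebra)"
  using star_add[of "0::'a" 0] by simp

lemma star_minus:
  fixes x :: "'a::cstar_algebra"
  shows "star (- x) = - star x"
  using star_add[of x "- x"] by (simp add: star_zero minus_unique)

lemma star_diff:
  fixes x y :: "'a::cstar_algebra"
  shows "star (x - y) = star x - star y"
  using star_add[of x "- y"] by (simp add: star_minus)

lemma star_scaleR:
  fixes x :: "'a::cstar_algebra"
  shows "star (r *\<^sub>R x) = r *\<^sub>R star x"
  using star_scaleC[of "complex_of_real r" x] by (simp add: scaleC_of_real)

lemma norm_star:
  fixes x :: "'a::cstar_algebra"
  shows "norm (star x) = norm x"
proof -
  have le: "norm y \<le> norm (star y)" for y :: 'a
  proof (cases "norm y = 0")
    case False
    have "(norm y)\<^sup>2 \<le> norm (star y) * norm y"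
      using cstar_identity[of y] norm_mult_ineq[of "star y" y] by simp
    then show ?thesis
      using False by (simp add: power2_eq_square)
  qed simp
  show ?thesis
    using le[of x] le[of "star x"] by (simp add: star_star)
qed

lemma eq_zero_if_left_annihilates:
  fixes a :: "'a::cstar_algebra"
  assumes "\<And>b. a * b = 0"
  shows "a = 0"
proof -
  have "norm (star (star a) * star a) = 0"
    using assms by (simp add: star_star)
  then show ?thesis
    by (simp add: cstar_identity norm_star)
qed

lemma eq_zero_if_right_annihilates:
  fixes a :: "'a::cstar_algebra"
  assumes "\<And>b. b * a = 0"
  shows "a = 0"
  using cstar_identity[of a] assms by simp

lemma eq_if_mult_eq:
  fixes x y :: "'a::cstar_algebra"
  shows "(\<And>b. b * x = b * y) \<Longrightarrow> x = y"
  using eq_zero_if_right_annihilates[of "x - y"] by (simp add: right_diff_distrib)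

lemma eq_if_mult_eq':
  fixes x y :: "'a::cstar_algebra"
  shows "(\<And>b. x * b = y * b) \<Longrightarrow> x = y"
  using eq_zero_if_left_annihilates[of "x - y"] by (simp add: left_diff_distrib)

text \<open>In the sort \<open>{cstar_algebra, monoid_mult}\<close> of unital C*-algebras the zero algebra is allowed.\<close>

section \<open>The minimal unitization\<close>

text \<open>The underlying *-algebra is the direct sum of the algebra and the complex numbers.
  For a nonunital algebra the norm below is the usual operator norm
  of left multiplication by \<open>(a, \<lambda>)\<close> on the algebra (the term \<open>cmod \<lambda>\<close> is then redundant).
  In general the maximum is the unique C*-norm on this *-algebra.\<close>

datatype 'a unitization = Unitization (uz_alg: 'a) (uz_scalar: complex)

definition uz_act :: "'a::cstar_algebra unitization \<Rightarrow> 'a \<Rightarrow> 'a" where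
  "uz_act x b = uz_alg x * b + uz_scalar x *\<^sub>C b"

lemma bounded_linear_scaleC: "bounded_linear (\<lambda>b::'a::cstar_algebra. c *\<^sub>C b)"
  by (rule bounded_linear_intro[where K = "cmod c"])
     (auto simp: scaleC_add_right scaleC_scaleR norm_scaleC mult.commute)

lemma bounded_linear_star: "bounded_linear (star :: 'a::cstar_algebra \<Rightarrow> 'a)"
  by (rule bounded_linear_intro[where K = 1]) (auto simp: star_add star_scaleR norm_star)

lemma bounded_linear_uz_act: "bounded_linear (uz_act x)"
  unfolding uz_act_def
  by (intro bounded_linear_add bounded_linear_mult_right bounded_linear_scaleC)

lemma unitization_eqI: "uz_alg x = uz_alg y \<Longrightarrow> uz_scalar x = uz_scalar y \<Longrightarrow> x = y"
  by (cases x; cases y) simp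

instantiation unitization :: (cstar_algebra) "{real_normed_algebra, monoid_mult, star, scaleC}"
begin

definition "0 = Unitization 0 0"
definition "1 = Unitization 0 1"
definition "x + y = Unitization (uz_alg x + uz_alg y) (uz_scalar x + uz_scalar y)"
definition "x - y = Unitization (uz_alg x - uz_alg y) (uz_scalar x - uz_scalar y)"
definition "- x = Unitization (- uz_alg x) (- uz_scalar x)"
definition "r *\<^sub>R x = Unitization (r *\<^sub>R uz_alg x) (r *\<^sub>R uz_scalar x)"
definition "c *\<^sub>C x = Unitization (c *\<^sub>C uz_alg x) (c * uz_scalar x)"
definition "star x = Unitization (star (uz_alg x)) (cnj (uz_scalar x))"
definition "x * y = Unitization
  (uz_alg x * uz_alg y + uz_scalar x *\<^sub>C uz_alg y + uz_scalar y *\<^sub>C uz_alg x)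
  (uz_scalar x * uz_scalar y)"
definition "norm x = max (cmod (uz_scalar x)) (onorm (uz_act x))"
definition "dist x y = norm (x - y)" for x y :: "'a unitization"
definition "sgn x = inverse (norm x) *\<^sub>R x" for x :: "'a unitization"
definition "(uniformity :: ('a unitization \<times> 'a unitization) filter) =
  (INF e\<in>{0 <..}. principal {(x, y). dist x y < e})"
definition "open S = (\<forall>x\<in>S. \<forall>\<^sub>F (x', y) in uniformity. x' = x \<longrightarrow> y \<in> S)"
  for S :: "'a unitization set"

lemmas unitization_defs = zero_unitization_def one_unitization_def plus_unitization_def
  minus_unitization_def uminus_unitization_def scaleR_unitization_def scaleC_unitization_def
  star_unitization_def times_unitization_def

lemma onorm_uz_act_alg_le:
  "norm (uz_alg x) \<le> 2 * max (cmod (uz_scalar x)) (onorm (uz_act x))"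
    (is "_ \<le> 2 * ?m")
proof (cases "norm (uz_alg x) = 0")
  case True
  then show ?thesis
    using bounded_linear_uz_act[of x] by (simp add: onorm_pos_le max_def)
next
  case False
  let ?a = "uz_alg x"
  have "(norm ?a)\<^sup>2 = norm (?a * star ?a)"
    using cstar_identity[of "star ?a"] by (simp add: star_star norm_star)
  also have "\<dots> = norm (uz_act x (star ?a) - uz_scalar x *\<^sub>C star ?a)"
    by (simp add: uz_act_def)
  also have "\<dots> \<le> norm (uz_act x (star ?a)) + norm (uz_scalar x *\<^sub>C star ?a)"
    by (rule norm_triangle_ineq4)
  also have "\<dots> \<le> onorm (uz_act x) * norm ?a + cmod (uz_scalar x) * norm ?a"
    using onorm[OF bounded_linear_uz_act, of x "star ?a"] by (simp add: norm_scaleC norm_star)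
  also have "\<dots> \<le> ?m * norm ?a + ?m * norm ?a"
    by (intro add_mono mult_right_mono) auto
  finally show ?thesis
    using False by (simp add: power2_eq_square)
qed

lemma uz_act_mult: "uz_act (x * y) = uz_act x \<circ> uz_act y"
  by (auto simp: fun_eq_iff uz_act_def unitization_defs algebra_simps scaleC_add_right
      scaleC_scaleC mult_scaleC_left mult_scaleC_right)

lemma onorm_uz_act_cstar: "(onorm (uz_act x))\<^sup>2 \<le> onorm (uz_act (star x * x))"
proof -
  let ?K = "onorm (uz_act (star x * x))"
  have K: "0 \<le> ?K" by (simp add: onorm_pos_le bounded_linear_uz_act)
  have "norm (uz_act x b) \<le> sqrt ?K * norm b" for b
  proof -
    have "(norm (uz_act x b))\<^sup>2 = norm (star (uz_act x b) * uz_act x b)"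
      by (simp add: cstar_identity)
    also have "star (uz_act x b) * uz_act x b = star b * uz_act (star x * x) b"
      by (simp add: uz_act_def unitization_defs algebra_simps scaleC_add_right star_add star_mult
          star_scaleC scaleC_scaleC mult_scaleC_left mult_scaleC_right)
    also have "norm \<dots> \<le> norm b * (?K * norm b)"
      using norm_mult_ineq[of "star b" "uz_act (star x * x) b"]
        mult_left_mono[OF onorm[OF bounded_linear_uz_act, of "star x * x" b] norm_ge_zero[of b]]
      by (simp add: norm_star)
    also have "\<dots> = (sqrt ?K * norm b)\<^sup>2"
      using K by (simp add: power2_eq_square)
    finally show ?thesis
      by (rule power2_le_imp_le) (use K in simp)
  qed
  then have "onorm (uz_act x) \<le> sqrt ?K"
    by (intro onorm_bound) (use K in auto)
  then have "(onorm (uz_act x))\<^sup>2 \<le> (sqrt ?K)\<^sup>2"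
    by (intro power_mono) (simp_all add: onorm_pos_le bounded_linear_uz_act)
  then show ?thesis using K by simp
qed

lemma onorm_uz_act_mult: "onorm (uz_act (x * y)) \<le> onorm (uz_act x) * onorm (uz_act y)"
  unfolding uz_act_mult by (rule onorm_compose[OF bounded_linear_uz_act bounded_linear_uz_act])

lemma onorm_uz_act_star_le: "onorm (uz_act x) \<le> onorm (uz_act (star x))"
proof (cases "onorm (uz_act x) = 0")
  case True
  then show ?thesis by (simp add: onorm_pos_le bounded_linear_uz_act)
next
  case False
  then have "0 < onorm (uz_act x)"
    using onorm_pos_le[OF bounded_linear_uz_act, of x] by simp
  moreover have "(onorm (uz_act x))\<^sup>2 \<le> onorm (uz_act (star x)) * onorm (uz_act x)"
    using onorm_uz_act_cstar[of x] onorm_uz_act_mult[of "star x" x] by linarith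
  ultimately show ?thesis by (simp add: power2_eq_square)
qed

lemma uz_act_add: "uz_act (x + y) = (\<lambda>b. uz_act x b + uz_act y b)"
  by (auto simp: fun_eq_iff uz_act_def unitization_defs algebra_simps scaleC_add_left)

lemma uz_act_scaleR: "uz_act (r *\<^sub>R x) = (\<lambda>b. r *\<^sub>R uz_act x b)"
  by (auto simp: fun_eq_iff uz_act_def unitization_defs scaleC_of_real[symmetric] scaleC_add_right
      scaleC_scaleC mult_scaleC_left scaleR_conv_of_real)

lemma uz_act_scaleC: "uz_act (c *\<^sub>C x) = (\<lambda>b. c *\<^sub>C uz_act x b)"
  by (auto simp: fun_eq_iff uz_act_def unitization_defs scaleC_add_right
      scaleC_scaleC mult_scaleC_left)

lemma onorm_uz_act_scaleC_le: "onorm (uz_act (c *\<^sub>C x)) \<le> cmod c * onorm (uz_act x)"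
proof (rule onorm_bound)
  show "norm (uz_act (c *\<^sub>C x) b) \<le> cmod c * onorm (uz_act x) * norm b" for b
    using onorm[OF bounded_linear_uz_act, of x b]
    by (simp add: uz_act_scaleC norm_scaleC mult.assoc mult_left_mono)
qed (simp add: onorm_pos_le bounded_linear_uz_act)

lemma onorm_uz_act_scaleC: "onorm (uz_act (c *\<^sub>C x)) = cmod c * onorm (uz_act x)"
proof (cases "c = 0")
  case True
  then have "uz_act (c *\<^sub>C x) = (\<lambda>b. 0)" by (simp add: uz_act_scaleC scaleC_zero_left)
  with True show ?thesis by (simp add: onorm_zero)
next
  case False
  have "inverse c *\<^sub>C c *\<^sub>C x = x"
    using False by (cases x) (simp add: unitization_defs scaleC_scaleC scaleC_one)
  with onorm_uz_act_scaleC_le[of "inverse c" "c *\<^sub>C x"]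
  have "onorm (uz_act x) \<le> inverse (cmod c) * onorm (uz_act (c *\<^sub>C x))"
    by (simp add: norm_inverse)
  then have "cmod c * onorm (uz_act x) \<le> onorm (uz_act (c *\<^sub>C x))"
    using False by (simp add: field_simps)
  with onorm_uz_act_scaleC_le[of c x] show ?thesis by simp
qed

lemma norm_unitization_le: "norm x \<le> norm (uz_alg x) + cmod (uz_scalar x)"
proof -
  have "onorm (uz_act x) \<le> norm (uz_alg x) + cmod (uz_scalar x)"
  proof (rule onorm_bound)
    show "norm (uz_act x b) \<le> (norm (uz_alg x) + cmod (uz_scalar x)) * norm b" for b
      unfolding uz_act_def
      using norm_triangle_ineq[of "uz_alg x * b" "uz_scalar x *\<^sub>C b"] norm_mult_ineq[of "uz_alg x" b]
      by (simp add: norm_scaleC distrib_right)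
  qed simp
  then show ?thesis by (simp add: norm_unitization_def)
qed

instance
proof
  fix x y z :: "'a unitization" and r s :: real and c d :: complex
  have nn: "0 \<le> onorm (uz_act x)" for x :: "'a unitization"
    by (simp add: onorm_pos_le bounded_linear_uz_act)
  show "dist x y = norm (x - y)" by (rule dist_unitization_def)
  show "x * y * z = x * (y * z)"
    by (auto intro!: unitization_eqI simp: unitization_defs algebra_simps scaleC_add_right
      scaleC_scaleC mult_scaleC_left mult_scaleC_right)
  show "1 * x = x" "x * 1 = x"
    by (auto intro!: unitization_eqI simp: unitization_defs scaleC_one scaleC_zero_right)
  show "x + y + z = x + (y + z)" "x + y = y + x" "0 + x = x" "- x + x = 0" "x - y = x + - y"
    by (auto intro!: unitization_eqI simp: unitization_defs)
  show "r *\<^sub>R (x + y) = r *\<^sub>R x + r *\<^sub>R y" "(r + s) *\<^sub>R x = r *\<^sub>R x + s *\<^sub>R x"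
    "r *\<^sub>R s *\<^sub>R x = (r * s) *\<^sub>R x" "1 *\<^sub>R x = x"
    by (auto intro!: unitization_eqI simp: unitization_defs scaleR_add_right scaleR_add_left)
  show "(x + y) * z = x * z + y * z" "x * (y + z) = x * y + x * z"
    by (auto intro!: unitization_eqI simp: unitization_defs algebra_simps scaleC_add_right scaleC_add_left)
  show "r *\<^sub>R x * y = r *\<^sub>R (x * y)" "x * r *\<^sub>R y = r *\<^sub>R (x * y)"
    by (auto intro!: unitization_eqI simp: unitization_defs scaleC_scaleR scaleR_add_right
        scaleC_of_real[symmetric] scaleC_scaleC scaleC_add_right scaleR_conv_of_real
        mult_scaleC_left mult_scaleC_right mult_ac)
  show "sgn x = inverse (norm x) *\<^sub>R x" by (rule sgn_unitization_def)
  show "(uniformity :: ('a unitization \<times> 'a unitization) filter) =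
      (INF e\<in>{0 <..}. principal {(x, y). dist x y < e})"
    by (rule uniformity_unitization_def)
  show "open S = (\<forall>x\<in>S. \<forall>\<^sub>F (x', y) in uniformity. x' = x \<longrightarrow> y \<in> S)" for S :: "'a unitization set"
    by (rule open_unitization_def)
  show "(norm x = 0) = (x = 0)"
  proof
    assume 0: "norm x = 0"
    then have "uz_scalar x = 0"
      by (metis max.cobounded1 norm_unitization_def norm_le_zero_iff)
    moreover have "norm (uz_alg x) \<le> 0"
      using onorm_uz_act_alg_le[of x] 0 by (simp add: norm_unitization_def)
    ultimately show "x = 0" by (simp add: unitization_eqI zero_unitization_def)
  next
    assume "x = 0"
    with norm_unitization_le[of x] nn[of x] show "norm x = 0"
      by (simp add: zero_unitization_def norm_unitization_def)
  qed
  show "norm (x + y) \<le> norm x + norm y"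
    using onorm_triangle[OF bounded_linear_uz_act bounded_linear_uz_act, of x y]
      norm_triangle_ineq[of "uz_scalar x" "uz_scalar y"]
    unfolding norm_unitization_def uz_act_add
    by (auto simp: plus_unitization_def)
  have ns: "norm (c *\<^sub>C x) = cmod c * norm x" for c and x :: "'a unitization"
    unfolding norm_unitization_def onorm_uz_act_scaleC
    by (simp add: scaleC_unitization_def norm_mult max_mult_distrib_left)
  have rc: "complex_of_real r *\<^sub>C x = r *\<^sub>R x" for r and x :: "'a unitization"
    by (auto intro!: unitization_eqI simp: unitization_defs scaleC_of_real scaleR_conv_of_real)
  show "norm (r *\<^sub>R x) = \<bar>r\<bar> * norm x"
    using ns[of "complex_of_real r" x] by (simp add: rc)
  show "norm (x * y) \<le> norm x * norm y"
  proof -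
    have "onorm (uz_act x) * onorm (uz_act y) \<le> norm x * norm y"
      by (intro mult_mono) (auto simp: norm_unitization_def nn le_max_iff_disj)
    moreover have "cmod (uz_scalar x) * cmod (uz_scalar y) \<le> norm x * norm y"
      by (intro mult_mono) (auto simp: norm_unitization_def nn le_max_iff_disj)
    ultimately show ?thesis
      using onorm_uz_act_mult[of x y] unfolding norm_unitization_def[of "x * y"]
      by (auto simp: times_unitization_def norm_mult)
  qed
qed

end

instance unitization :: (cstar_algebra) banach
proof
  fix X :: "nat \<Rightarrow> 'a unitization"
  assume "Cauchy X"
  have d: "dist (uz_alg x) (uz_alg y) \<le> 2 * dist x y" "dist (uz_scalar x) (uz_scalar y) \<le> dist x y"
    for x y :: "'a unitization"
    using onorm_uz_act_alg_le[of "x - y"]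
    by (simp_all add: dist_unitization_def dist_norm[of "uz_alg x"] dist_norm[of "uz_scalar x"]
        norm_unitization_def minus_unitization_def)
  have "Cauchy (\<lambda>n. uz_alg (X n))"
  proof (rule metric_CauchyI)
    fix e :: real assume "0 < e"
    then obtain M where "\<forall>m\<ge>M. \<forall>n\<ge>M. dist (X m) (X n) < e / 2"
      using \<open>Cauchy X\<close> metric_CauchyD half_gt_zero by blast
    then have "\<forall>m\<ge>M. \<forall>n\<ge>M. dist (uz_alg (X m)) (uz_alg (X n)) < e"
      using d(1) by (smt (verit, best) field_sum_of_halves)
    then show "\<exists>M. \<forall>m\<ge>M. \<forall>n\<ge>M. dist (uz_alg (X m)) (uz_alg (X n)) < e" ..
  qed
  then obtain a where a: "(\<lambda>n. uz_alg (X n)) \<longlonglongrightarrow> a"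
    using Cauchy_convergent_iff convergent_def by blast
  have "Cauchy (\<lambda>n. uz_scalar (X n))"
    using \<open>Cauchy X\<close> d(2) unfolding Cauchy_def by (meson le_less_trans)
  then obtain l where l: "(\<lambda>n. uz_scalar (X n)) \<longlonglongrightarrow> l"
    using Cauchy_convergent_iff convergent_def by blast
  let ?x = "Unitization a l"
  have "(\<lambda>n. norm (uz_alg (X n) - a) + cmod (uz_scalar (X n) - l)) \<longlonglongrightarrow> 0"
    using tendsto_add[OF tendsto_norm[OF LIM_zero[OF a]] tendsto_norm[OF LIM_zero[OF l]]] by simp
  then have lim: "(\<lambda>n. dist (X n) ?x) \<longlonglongrightarrow> 0"
  proof (rule Lim_null_comparison[rotated])
    show "\<forall>\<^sub>F n in sequentially.
        norm (dist (X n) ?x) \<le> norm (uz_alg (X n) - a) + cmod (uz_scalar (X n) - l)"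
    proof (rule always_eventually, rule allI)
      fix n
      show "norm (dist (X n) ?x) \<le> norm (uz_alg (X n) - a) + cmod (uz_scalar (X n) - l)"
        using norm_unitization_le[of "X n - ?x"]
        by (simp add: dist_norm minus_unitization_def)
    qed
  qed
  then show "convergent X"
    unfolding convergent_def using tendsto_dist_iff by blast
qed

instance unitization :: (cstar_algebra) cstar_algebra
proof
  fix x y z :: "'a unitization" and r s :: real and c d :: complex
  have nn: "0 \<le> onorm (uz_act x)" for x :: "'a unitization"
    by (simp add: onorm_pos_le bounded_linear_uz_act)
  show "c *\<^sub>C (x + y) = c *\<^sub>C x + c *\<^sub>C y" "(c + d) *\<^sub>C x = c *\<^sub>C x + d *\<^sub>C x"
    "c *\<^sub>C d *\<^sub>C x = (c * d) *\<^sub>C x"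
    by (auto intro!: unitization_eqI simp: unitization_defs algebra_simps scaleC_add_right
        scaleC_add_left scaleC_scaleC)
  show "(c *\<^sub>C x) * y = c *\<^sub>C (x * y)" "x * (c *\<^sub>C y) = c *\<^sub>C (x * y)"
    by (auto intro!: unitization_eqI simp: unitization_defs scaleC_add_right
        scaleC_scaleC mult_scaleC_left mult_scaleC_right mult_ac)
  show "star (star x) = x" "star (x + y) = star x + star y" "star (c *\<^sub>C x) = cnj c *\<^sub>C star x"
    by (auto intro!: unitization_eqI simp: unitization_defs star_star star_add star_scaleC)
  show "star (x * y) = star y * star x"
    by (auto intro!: unitization_eqI
        simp: unitization_defs star_star star_add star_scaleC star_mult add_ac)
  show "norm (star x * x) = (norm x)\<^sup>2"
  proof -
    have "onorm (uz_act (star x)) \<le> onorm (uz_act (star (star x)))"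
      by (rule onorm_uz_act_star_le)
    also have "star (star x) = x"
      by (auto intro!: unitization_eqI simp: unitization_defs star_star)
    finally have "onorm (uz_act (star x * x)) \<le> (onorm (uz_act x))\<^sup>2"
      using onorm_uz_act_mult[of "star x" x] nn[of x]
      by (metis mult_right_mono order_trans power2_eq_square)
    then have "onorm (uz_act (star x * x)) = (onorm (uz_act x))\<^sup>2"
      using onorm_uz_act_cstar[of x] by simp
    moreover have "cmod (uz_scalar (star x * x)) = (cmod (uz_scalar x))\<^sup>2"
      by (simp add: unitization_defs norm_mult power2_eq_square)
    moreover have "max (s\<^sup>2) (t\<^sup>2) = (max s t)\<^sup>2" if "0 \<le> s" "0 \<le> t" for s t :: real
      using that by (auto simp: max_def power2_le_iff_abs_le abs_le_square_iff[symmetric])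
    ultimately show ?thesis
      by (simp add: norm_unitization_def nn)
  qed
  show "norm (c *\<^sub>C x) = cmod c * norm x"
    unfolding norm_unitization_def onorm_uz_act_scaleC
    by (simp add: scaleC_unitization_def norm_mult max_mult_distrib_left)
  show "complex_of_real r *\<^sub>C x = r *\<^sub>R x"
    by (auto intro!: unitization_eqI simp: unitization_defs scaleC_of_real scaleR_conv_of_real)
qed

section \<open>The multiplier algebra\<close>

text \<open>Multipliers are double centralizers \<open>(L, R)\<close>. The components \<open>L\<close> and \<open>R\<close> have equal norms,
  see \<open>norm_mr\<close> below. Products are \<open>(L, R) (L', R') = (L L', R' R)\<close>, and the adjoint of \<open>(L, R)\<close>
  is \<open>(a \<mapsto> (R a*)*, a \<mapsto> (L a*)*)\<close>.\<close>

definition double_centralizer ::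
  "('a::cstar_algebra \<Rightarrow>\<^sub>L 'a) \<Rightarrow> ('a \<Rightarrow>\<^sub>L 'a) \<Rightarrow> bool" where
  "double_centralizer L R \<longleftrightarrow>
    (\<forall>c a. L (c *\<^sub>C a) = c *\<^sub>C L a \<and> R (c *\<^sub>C a) = c *\<^sub>C R a) \<and>
    (\<forall>a b. L (a * b) = L a * b \<and> R (a * b) = a * R b \<and> R a * b = a * L b)"

lemma double_centralizerI:
  fixes L R :: "'a::cstar_algebra \<Rightarrow>\<^sub>L 'a"
  assumes c: "\<And>a b. R a * b = a * L b"
  shows "double_centralizer L R"
  unfolding double_centralizer_def
proof (intro conjI allI)
  fix k and a b
  show "L (k *\<^sub>C a) = k *\<^sub>C L a"
    by (rule eq_if_mult_eq) (simp add: c[symmetric] mult_scaleC_right)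
  show "R (k *\<^sub>C a) = k *\<^sub>C R a"
    by (rule eq_if_mult_eq') (simp add: c mult_scaleC_left)
  show "L (a * b) = L a * b"
    by (rule eq_if_mult_eq) (simp add: c[symmetric] mult.assoc[symmetric])
  show "R (a * b) = a * R b"
    by (rule eq_if_mult_eq') (simp add: c mult.assoc)
  show "R a * b = a * L b" by (rule c)
qed

typedef (overloaded) 'a multiplier =
  "{(L, R :: 'a::cstar_algebra \<Rightarrow>\<^sub>L 'a). double_centralizer L R}"
  by (rule exI[of _ "(0, 0)"]) (simp add: double_centralizerI)

definition ml :: "'a::cstar_algebra multiplier \<Rightarrow> 'a \<Rightarrow>\<^sub>L 'a" where
  "ml m = fst (Rep_multiplier m)"

definition mr :: "'a::cstar_algebra multiplier \<Rightarrow> 'a \<Rightarrow>\<^sub>L 'a" where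
  "mr m = snd (Rep_multiplier m)"

definition mk_multiplier where "mk_multiplier L R = Abs_multiplier (L, R)"

lemma multiplier_centralizer: "mr m a * b = a * ml m b"
  using Rep_multiplier[of m] by (auto simp: ml_def mr_def double_centralizer_def)

lemma
  fixes L R :: "'a::cstar_algebra \<Rightarrow>\<^sub>L 'a"
  shows ml_mk: "(\<And>a b. R a * b = a * L b) \<Longrightarrow> ml (mk_multiplier L R) = L"
    and mr_mk: "(\<And>a b. R a * b = a * L b) \<Longrightarrow> mr (mk_multiplier L R) = R"
  by (simp_all add: ml_def mr_def mk_multiplier_def Abs_multiplier_inverse double_centralizerI)

lemma multiplier_eqI: "ml m = ml n \<Longrightarrow> mr m = mr n \<Longrightarrow> m = n"
  by (simp add: ml_def mr_def Rep_multiplier_inject[symmetric] prod_eq_iff)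

lift_definition star_conj :: "('a::cstar_algebra \<Rightarrow>\<^sub>L 'a) \<Rightarrow> 'a \<Rightarrow>\<^sub>L 'a" is
  "\<lambda>T a. star (T (star a))"
  by (rule bounded_linear_compose[OF bounded_linear_star bounded_linear_compose[OF _ bounded_linear_star]])

lift_definition scaleC_blinfun :: "complex \<Rightarrow> ('a::cstar_algebra \<Rightarrow>\<^sub>L 'a) \<Rightarrow> 'a \<Rightarrow>\<^sub>L 'a" is
  "\<lambda>c T a. c *\<^sub>C T a"
  by (rule bounded_linear_compose[OF bounded_linear_scaleC])

instantiation multiplier :: (cstar_algebra) "{real_normed_algebra, monoid_mult, star, scaleC}"
begin

definition "0 = mk_multiplier 0 0"
definition "1 = mk_multiplier id_blinfun id_blinfun"
definition "m + n = mk_multiplier (ml m + ml n) (mr m + mr n)"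
definition "m - n = mk_multiplier (ml m - ml n) (mr m - mr n)"
definition "- m = mk_multiplier (- ml m) (- mr m)"
definition "r *\<^sub>R m = mk_multiplier (r *\<^sub>R ml m) (r *\<^sub>R mr m)"
definition "c *\<^sub>C m = mk_multiplier (scaleC_blinfun c (ml m)) (scaleC_blinfun c (mr m))"
definition "m * n = mk_multiplier (ml m o\<^sub>L ml n) (mr n o\<^sub>L mr m)"
definition "star m = mk_multiplier (star_conj (mr m)) (star_conj (ml m))"
definition "norm m = norm (ml m)"
definition "dist m n = norm (m - n)" for m n :: "'a multiplier"
definition "sgn m = inverse (norm m) *\<^sub>R m" for m :: "'a multiplier"
definition "(uniformity :: ('a multiplier \<times> 'a multiplier) filter) =
  (INF e\<in>{0 <..}. principal {(x, y). dist x y < e})"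
definition "open S = (\<forall>x\<in>S. \<forall>\<^sub>F (x', y) in uniformity. x' = x \<longrightarrow> y \<in> S)"
  for S :: "'a multiplier set"

lemma ml_simps:
  "ml (0 :: 'a multiplier) = 0" "mr (0 :: 'a multiplier) = 0"
  "ml (1 :: 'a multiplier) = id_blinfun" "mr (1 :: 'a multiplier) = id_blinfun"
  "ml (m + n) = ml m + ml n" "mr (m + n) = mr m + mr n"
  "ml (m - n) = ml m - ml n" "mr (m - n) = mr m - mr n"
  "ml (- m) = - ml m" "mr (- m) = - mr m"
  "ml (r *\<^sub>R m) = r *\<^sub>R ml m" "mr (r *\<^sub>R m) = r *\<^sub>R mr m"
  "ml (c *\<^sub>C m) = scaleC_blinfun c (ml m)" "mr (c *\<^sub>C m) = scaleC_blinfun c (mr m)"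
  "ml (m * n) = ml m o\<^sub>L ml n" "mr (m * n) = mr n o\<^sub>L mr m"
  "ml (star m) = star_conj (mr m)" "mr (star m) = star_conj (ml m)"
proof -
  have st: "star (ml m (star a)) * b = a * star (mr m (star b))" for a b
    using arg_cong[OF multiplier_centralizer[of m "star b" "star a"], of star]
    by (simp add: star_mult star_star)
  note defs = zero_multiplier_def one_multiplier_def plus_multiplier_def minus_multiplier_def
    uminus_multiplier_def scaleR_multiplier_def scaleC_multiplier_def times_multiplier_def
    star_multiplier_def
  note simps = multiplier_centralizer blinfun.bilinear_simps scaleC_blinfun.rep_eq
    star_conj.rep_eq mult_scaleC_left mult_scaleC_right algebra_simps st
  show
    "ml (0 :: 'a multiplier) = 0" "ml (1 :: 'a multiplier) = id_blinfun"
    "ml (m + n) = ml m + ml n" "ml (m - n) = ml m - ml n" "ml (- m) = - ml m"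
    "ml (r *\<^sub>R m) = r *\<^sub>R ml m" "ml (c *\<^sub>C m) = scaleC_blinfun c (ml m)"
    "ml (m * n) = ml m o\<^sub>L ml n" "ml (star m) = star_conj (mr m)"
    unfolding defs by (rule ml_mk; simp add: simps)+
  show
    "mr (0 :: 'a multiplier) = 0" "mr (1 :: 'a multiplier) = id_blinfun"
    "mr (m + n) = mr m + mr n" "mr (m - n) = mr m - mr n" "mr (- m) = - mr m"
    "mr (r *\<^sub>R m) = r *\<^sub>R mr m" "mr (c *\<^sub>C m) = scaleC_blinfun c (mr m)"
    "mr (m * n) = mr n o\<^sub>L mr m" "mr (star m) = star_conj (ml m)"
    unfolding defs by (rule mr_mk; simp add: simps)+
qed

lemma norm_mr: "norm (mr m) = norm (ml m)"
proof (rule antisym)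
  show "norm (mr m) \<le> norm (ml m)"
  proof (rule norm_blinfun_bound)
    fix a
    let ?y = "mr m a"
    have "(norm ?y)\<^sup>2 = norm (?y * star ?y)"
      using cstar_identity[of "star ?y"] by (simp add: star_star norm_star)
    also have "\<dots> = norm (a * ml m (star ?y))"
      by (simp add: multiplier_centralizer)
    also have "\<dots> \<le> norm a * (norm (ml m) * norm ?y)"
      using norm_mult_ineq[of a "ml m (star ?y)"]
        mult_left_mono[OF norm_blinfun[of "ml m" "star ?y"] norm_ge_zero[of a]]
      by (simp add: norm_star)
    finally show "norm ?y \<le> norm (ml m) * norm a"
      by (cases "norm ?y = 0") (auto simp: power2_eq_square mult_ac)
  qed simp
  show "norm (ml m) \<le> norm (mr m)"
  proof (rule norm_blinfun_bound)
    fix a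
    let ?y = "ml m a"
    have "(norm ?y)\<^sup>2 = norm (star ?y * ?y)"
      by (simp add: cstar_identity)
    also have "\<dots> = norm (mr m (star ?y) * a)"
      by (simp add: multiplier_centralizer)
    also have "\<dots> \<le> (norm (mr m) * norm ?y) * norm a"
      using norm_mult_ineq[of "mr m (star ?y)" a]
        mult_right_mono[OF norm_blinfun[of "mr m" "star ?y"] norm_ge_zero[of a]]
      by (simp add: norm_star)
    finally show "norm ?y \<le> norm (mr m) * norm a"
      by (cases "norm ?y = 0") (auto simp: power2_eq_square mult_ac)
  qed simp
qed

instance
proof
  fix x y z :: "'a multiplier" and r s :: real
  note eqI = multiplier_eqI blinfun_eqI
  note simps = ml_simps blinfun.bilinear_simps algebra_simps
  show "dist x y = norm (x - y)" by (rule dist_multiplier_def)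
  show "sgn x = inverse (norm x) *\<^sub>R x" by (rule sgn_multiplier_def)
  show "(uniformity :: ('a multiplier \<times> 'a multiplier) filter) =
      (INF e\<in>{0 <..}. principal {(x, y). dist x y < e})"
    by (rule uniformity_multiplier_def)
  show "open S = (\<forall>x\<in>S. \<forall>\<^sub>F (x', y) in uniformity. x' = x \<longrightarrow> y \<in> S)" for S :: "'a multiplier set"
    by (rule open_multiplier_def)
  show "x * y * z = x * (y * z)" "1 * x = x" "x * 1 = x"
    "x + y + z = x + (y + z)" "x + y = y + x" "0 + x = x" "- x + x = 0" "x - y = x + - y"
    "r *\<^sub>R (x + y) = r *\<^sub>R x + r *\<^sub>R y" "(r + s) *\<^sub>R x = r *\<^sub>R x + s *\<^sub>R x"
    "r *\<^sub>R s *\<^sub>R x = (r * s) *\<^sub>R x" "1 *\<^sub>R x = x"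
    "(x + y) * z = x * z + y * z" "x * (y + z) = x * y + x * z"
    "r *\<^sub>R x * y = r *\<^sub>R (x * y)" "x * r *\<^sub>R y = r *\<^sub>R (x * y)"
    by (rule eqI; rule eqI; simp add: simps)+
  show "(norm x = 0) = (x = 0)"
    using norm_mr[of x] by (auto intro: multiplier_eqI simp: norm_multiplier_def ml_simps)
  show "norm (x + y) \<le> norm x + norm y"
    by (simp add: norm_multiplier_def ml_simps norm_triangle_ineq)
  show "norm (r *\<^sub>R x) = \<bar>r\<bar> * norm x"
    by (simp add: norm_multiplier_def ml_simps)
  show "norm (x * y) \<le> norm x * norm y"
    by (simp add: norm_multiplier_def ml_simps norm_blinfun_compose)
qed

end

instance multiplier :: (cstar_algebra) banach
proof
  fix X :: "nat \<Rightarrow> 'a multiplier"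
  assume C: "Cauchy X"
  have "dist (ml m) (ml n) = dist m n" "dist (mr m) (mr n) = dist m n" for m n :: "'a multiplier"
    using norm_mr[of "m - n"] by (simp_all add: dist_norm norm_multiplier_def ml_simps)
  note d = this
  from C have "Cauchy (\<lambda>n. ml (X n))" "Cauchy (\<lambda>n. mr (X n))"
    by (simp_all add: Cauchy_def d)
  then obtain L R where L: "(\<lambda>n. ml (X n)) \<longlonglongrightarrow> L" and R: "(\<lambda>n. mr (X n)) \<longlonglongrightarrow> R"
    unfolding Cauchy_convergent_iff convergent_def by blast
  have "blinfun_apply R a * b = a * blinfun_apply L b" for a b
  proof (rule LIMSEQ_unique)
    show "(\<lambda>n. mr (X n) a * b) \<longlonglongrightarrow> R a * b"
      by (intro tendsto_intros R)
    show "(\<lambda>n. mr (X n) a * b) \<longlonglongrightarrow> a * L b"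
      unfolding multiplier_centralizer by (intro tendsto_intros L)
  qed
  then have "ml (mk_multiplier L R) = L" by (rule ml_mk)
  then have "(\<lambda>n. dist (X n) (mk_multiplier L R)) \<longlonglongrightarrow> 0"
    using iffD1[OF tendsto_dist_iff L] by (simp add: d(1)[symmetric])
  then have "X \<longlonglongrightarrow> mk_multiplier L R"
    by (rule iffD2[OF tendsto_dist_iff])
  then show "convergent X" by (auto simp: convergent_def)
qed

lemma norm_star_conj: "norm (star_conj T) = norm T"
proof -
  have le: "norm (star_conj T) \<le> norm T" for T :: "'a \<Rightarrow>\<^sub>L 'a"
  proof (rule norm_blinfun_bound)
    show "norm (star_conj T a) \<le> norm T * norm a" for a
      using norm_blinfun[of T "star a"] by (simp add: star_conj.rep_eq norm_star)
  qed simp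
  have "star_conj (star_conj T) = T"
    by (rule blinfun_eqI) (simp add: star_conj.rep_eq star_star)
  with le[of T] le[of "star_conj T"] show ?thesis by simp
qed

instance multiplier :: (cstar_algebra) cstar_algebra
proof
  fix x y z :: "'a multiplier" and c d :: complex and r :: real
  note eqI = multiplier_eqI blinfun_eqI
  have dc: "double_centralizer (ml x) (mr x)" for x :: "'a multiplier"
    using Rep_multiplier[of x] by (auto simp: ml_def mr_def)
  then have C: "ml x (c *\<^sub>C a) = c *\<^sub>C ml x a" "mr x (c *\<^sub>C a) = c *\<^sub>C mr x a"
    for x :: "'a multiplier" and c a
    by (simp_all add: double_centralizer_def)
  note simps = ml_simps blinfun.bilinear_simps scaleC_blinfun.rep_eq star_conj.rep_eq C
    scaleC_add_right scaleC_add_left scaleC_scaleC scaleC_of_real star_star star_add star_scaleC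
  show "c *\<^sub>C (x + y) = c *\<^sub>C x + c *\<^sub>C y" "(c + d) *\<^sub>C x = c *\<^sub>C x + d *\<^sub>C x"
    "c *\<^sub>C d *\<^sub>C x = (c * d) *\<^sub>C x" "complex_of_real r *\<^sub>C x = r *\<^sub>R x"
    "(c *\<^sub>C x) * y = c *\<^sub>C (x * y)" "x * (c *\<^sub>C y) = c *\<^sub>C (x * y)"
    "star (star x) = x" "star (x + y) = star x + star y" "star (c *\<^sub>C x) = cnj c *\<^sub>C star x"
    "star (x * y) = star y * star x"
    by (rule eqI; rule eqI; simp add: simps)+
  show "norm (c *\<^sub>C x) = cmod c * norm x"
  proof -
    have le: "norm (scaleC_blinfun c T) \<le> cmod c * norm T" for c and T :: "'a \<Rightarrow>\<^sub>L 'a"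
    proof (rule norm_blinfun_bound)
      show "norm (scaleC_blinfun c T a) \<le> cmod c * norm T * norm a" for a
        using norm_blinfun[of T a]
        by (simp add: scaleC_blinfun.rep_eq norm_scaleC mult.assoc mult_left_mono)
    qed simp
    have "cmod c * norm (ml x) \<le> norm (scaleC_blinfun c (ml x))"
    proof (cases "c = 0")
      case False
      have "scaleC_blinfun (inverse c) (scaleC_blinfun c (ml x)) = ml x"
        using False by (intro blinfun_eqI) (simp add: scaleC_blinfun.rep_eq scaleC_scaleC scaleC_one)
      with le[of "inverse c" "scaleC_blinfun c (ml x)"]
      have "norm (ml x) \<le> inverse (cmod c) * norm (scaleC_blinfun c (ml x))"
        by (simp add: norm_inverse)
      with False show ?thesis by (simp add: field_simps)
    qed simp
    with le[of c "ml x"] show ?thesis by (simp add: norm_multiplier_def ml_simps)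
  qed
  show "norm (star x * x) = (norm x)\<^sup>2"
  proof (rule antisym)
    have "norm (star x) = norm x"
      by (simp add: norm_multiplier_def ml_simps norm_star_conj norm_mr)
    then show "norm (star x * x) \<le> (norm x)\<^sup>2"
      using norm_mult_ineq[of "star x" x] by (simp add: power2_eq_square)
    let ?K = "norm (ml (star x * x))"
    have "norm (ml x) \<le> sqrt ?K"
    proof (rule norm_blinfun_bound)
      fix b
      have "star (ml x b) * ml x b = mr (star x) (star b) * ml x b"
        by (simp add: ml_simps star_conj.rep_eq star_star)
      also have "\<dots> = star b * ml (star x * x) b"
        by (simp add: multiplier_centralizer) (simp add: ml_simps)
      finally have "(norm (ml x b))\<^sup>2 = norm (star b * ml (star x * x) b)"
        by (simp add: cstar_identity[symmetric])
      also have "\<dots> \<le> norm b * (?K * norm b)"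
        using norm_mult_ineq[of "star b" "ml (star x * x) b"]
          mult_left_mono[OF norm_blinfun[of "ml (star x * x)" b] norm_ge_zero[of b]]
        by (simp add: norm_star)
      also have "\<dots> = (sqrt ?K * norm b)\<^sup>2"
        by (simp add: power_mult_distrib) (simp add: power2_eq_square)
      finally show "norm (ml x b) \<le> sqrt ?K * norm b"
        by (rule power2_le_imp_le) simp
    qed simp
    then have "(norm (ml x))\<^sup>2 \<le> (sqrt ?K)\<^sup>2"
      by (intro power_mono) simp_all
    then show "(norm x)\<^sup>2 \<le> norm (star x * x)"
      by (simp add: norm_multiplier_def)
  qed
qed

section \<open>Murray-von Neumann equivalence and the monoid \<open>V(A)\<close>\<close>

text \<open>\<open>'a minf\<close> is the *-algebra of infinite matrices with finitely many nonzero entries,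
  that is, the union of the matrix algebras under the upper left corner embeddings.\<close>

typedef (overloaded) 'a minf =
  "{X :: nat \<Rightarrow> nat \<Rightarrow> 'a::cstar_algebra. \<exists>n. \<forall>i j. i \<ge> n \<or> j \<ge> n \<longrightarrow> X i j = 0}"
  morphisms mentry Abs_minf
  by (rule exI[of _ "\<lambda>i j. 0"]) simp

setup_lifting type_definition_minf

lemma row_support:
  fixes X :: "nat \<Rightarrow> nat \<Rightarrow> 'a::cstar_algebra"
  assumes "\<And>i j. i \<ge> n \<or> j \<ge> n \<Longrightarrow> X i j = 0"
  shows "{k. X i k \<noteq> 0} \<subseteq> {..<n}"
  by (rule subsetI, rule ccontr) (use assms in auto)

lemma finite_row:
  fixes X :: "nat \<Rightarrow> nat \<Rightarrow> 'a::cstar_algebra"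
  assumes "\<exists>n. \<forall>i j. i \<ge> n \<or> j \<ge> n \<longrightarrow> X i j = 0"
  shows "finite {k. X i k \<noteq> 0}"
proof -
  from assms obtain n where "\<And>i j. i \<ge> n \<or> j \<ge> n \<Longrightarrow> X i j = 0" by blast
  then have "{k. X i k \<noteq> 0} \<subseteq> {..<n}" using row_support[of n X i] by blast
  then show ?thesis by (rule finite_subset) simp
qed

lemma row_sum_superset:
  fixes f :: "nat \<Rightarrow> 'a::cstar_algebra"
  assumes "finite K" "{k. X i k \<noteq> 0} \<subseteq> K"
  shows "(\<Sum>k | X i k \<noteq> 0. X i k * f k) = (\<Sum>k\<in>K. X i k * f k)"
  using assms by (intro sum.mono_neutral_left) auto

lemma row_sum_bound:
  fixes f :: "nat \<Rightarrow> 'a::cstar_algebra"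
  assumes "\<And>i j. i \<ge> n \<or> j \<ge> n \<Longrightarrow> X i j = 0"
  shows "(\<Sum>k | X i k \<noteq> 0. X i k * f k) = (\<Sum>k<n. X i k * f k)"
  by (rule row_sum_superset[OF _ row_support]) (use assms in auto)

instantiation minf :: (cstar_algebra) "{ring, star}"
begin

lift_definition zero_minf :: "'a minf" is "\<lambda>i j. 0" by simp

lift_definition plus_minf :: "'a minf \<Rightarrow> 'a minf \<Rightarrow> 'a minf" is "\<lambda>X Y i j. X i j + Y i j"
  by (elim exE, rule_tac x = "max n na" in exI) simp

lift_definition uminus_minf :: "'a minf \<Rightarrow> 'a minf" is "\<lambda>X i j. - X i j"
  by simp

lift_definition minus_minf :: "'a minf \<Rightarrow> 'a minf \<Rightarrow> 'a minf" is "\<lambda>X Y i j. X i j - Y i j"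
  by (elim exE, rule_tac x = "max n na" in exI) simp

lift_definition times_minf :: "'a minf \<Rightarrow> 'a minf \<Rightarrow> 'a minf" is
  "\<lambda>X Y i j. \<Sum>k | X i k \<noteq> 0. X i k * Y k j"
proof -
  fix X Y :: "nat \<Rightarrow> nat \<Rightarrow> 'a"
  assume "\<exists>n. \<forall>i j. i \<ge> n \<or> j \<ge> n \<longrightarrow> X i j = 0" "\<exists>n. \<forall>i j. i \<ge> n \<or> j \<ge> n \<longrightarrow> Y i j = 0"
  then obtain n m where "\<forall>i j. i \<ge> n \<or> j \<ge> n \<longrightarrow> X i j = 0" "\<forall>i j. i \<ge> m \<or> j \<ge> m \<longrightarrow> Y i j = 0"
    by blast
  then show "\<exists>n. \<forall>i j. i \<ge> n \<or> j \<ge> n \<longrightarrow> (\<Sum>k | X i k \<noteq> 0. X i k * Y k j) = 0"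
    by (intro exI[of _ "max n m"]) auto
qed

lift_definition star_minf :: "'a minf \<Rightarrow> 'a minf" is "\<lambda>X i j. star (X j i)"
  by (elim exE, rule_tac x = n in exI) (simp add: star_zero)

instance
proof
  fix X Y Z :: "'a minf"
  show "X + Y + Z = X + (Y + Z)" "X + Y = Y + X" "0 + X = X" "- X + X = 0" "X - Y = X + - Y"
    by (transfer; simp add: algebra_simps)+
  show "X * Y * Z = X * (Y * Z)"
  proof transfer
    fix X Y Z :: "nat \<Rightarrow> nat \<Rightarrow> 'a"
    assume "\<exists>n. \<forall>i j. i \<ge> n \<or> j \<ge> n \<longrightarrow> X i j = 0" "\<exists>n. \<forall>i j. i \<ge> n \<or> j \<ge> n \<longrightarrow> Y i j = 0"
    then obtain n m where n: "\<And>i j. i \<ge> n \<or> j \<ge> n \<Longrightarrow> X i j = 0"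
      and m: "\<And>i j. i \<ge> m \<or> j \<ge> m \<Longrightarrow> Y i j = 0"
      by blast
    let ?XY = "\<lambda>i j. \<Sum>k<n. X i k * Y k j"
    have "(\<Sum>k | ?XY i k \<noteq> 0. ?XY i k * Z k j) = (\<Sum>k<n. X i k * (\<Sum>l<m. Y k l * Z l j))" for i j
    proof -
      have "(\<Sum>k | ?XY i k \<noteq> 0. ?XY i k * Z k j) = (\<Sum>l<m. ?XY i l * Z l j)"
        by (rule row_sum_superset[of _ ?XY], simp, rule subsetI, rule ccontr) (simp add: m)
      also have "\<dots> = (\<Sum>l<m. \<Sum>k<n. X i k * (Y k l * Z l j))"
        by (simp add: sum_distrib_right mult.assoc)
      also have "\<dots> = (\<Sum>k<n. X i k * (\<Sum>l<m. Y k l * Z l j))"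
        by (subst sum.swap) (simp add: sum_distrib_left)
      finally show ?thesis .
    qed
    then show "(\<lambda>i j. \<Sum>k | (\<Sum>l | X i l \<noteq> 0. X i l * Y l k) \<noteq> 0.
        (\<Sum>l | X i l \<noteq> 0. X i l * Y l k) * Z k j) =
      (\<lambda>i j. \<Sum>k | X i k \<noteq> 0. X i k * (\<Sum>l | Y k l \<noteq> 0. Y k l * Z l j))"
      by (simp add: row_sum_bound[of n X, OF n] row_sum_bound[of m Y, OF m])
  qed
  show "(X + Y) * Z = X * Z + Y * Z"
  proof transfer
    fix X Y Z :: "nat \<Rightarrow> nat \<Rightarrow> 'a"
    assume fin: "\<exists>n. \<forall>i j. i \<ge> n \<or> j \<ge> n \<longrightarrow> X i j = 0" "\<exists>n. \<forall>i j. i \<ge> n \<or> j \<ge> n \<longrightarrow> Y i j = 0"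
    let ?K = "\<lambda>i. {k. X i k \<noteq> 0} \<union> {k. Y i k \<noteq> 0}"
    have K: "finite (?K i)" for i using fin by (simp add: finite_row)
    have "(\<Sum>k | X i k + Y i k \<noteq> 0. (X i k + Y i k) * Z k j) =
      (\<Sum>k | X i k \<noteq> 0. X i k * Z k j) + (\<Sum>k | Y i k \<noteq> 0. Y i k * Z k j)" for i j
    proof -
      have "(\<Sum>k | X i k + Y i k \<noteq> 0. (X i k + Y i k) * Z k j) = (\<Sum>k\<in>?K i. (X i k + Y i k) * Z k j)"
        by (rule row_sum_superset[of _ "\<lambda>i j. X i j + Y i j", OF K]) auto
      moreover have "(\<Sum>k | X i k \<noteq> 0. X i k * Z k j) = (\<Sum>k\<in>?K i. X i k * Z k j)"
        by (rule row_sum_superset[OF K]) auto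
      moreover have "(\<Sum>k | Y i k \<noteq> 0. Y i k * Z k j) = (\<Sum>k\<in>?K i. Y i k * Z k j)"
        by (rule row_sum_superset[OF K]) auto
      ultimately show ?thesis by (simp add: distrib_right sum.distrib)
    qed
    then show "(\<lambda>i j. \<Sum>k | X i k + Y i k \<noteq> 0. (X i k + Y i k) * Z k j) =
      (\<lambda>i j. (\<Sum>k | X i k \<noteq> 0. X i k * Z k j) + (\<Sum>k | Y i k \<noteq> 0. Y i k * Z k j))"
      by simp
  qed
  show "X * (Y + Z) = X * Y + X * Z"
    by transfer (simp add: distrib_left sum.distrib)
qed

end

lemma star_star_minf: "star (star X) = (X :: 'a::cstar_algebra minf)"
  by transfer (simp add: star_star)

lemma star_add_minf: "star (X + Y) = star X + (star Y :: 'a::cstar_algebra minf)"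
  by transfer (simp add: star_add)

lemma star_sum: "star (sum f K) = (\<Sum>k\<in>K. star (f k :: 'a::cstar_algebra))"
  by (induction K rule: infinite_finite_induct) (simp_all add: star_zero star_add)

lemma star_mult_minf: "star (X * Y) = star Y * (star X :: 'a::cstar_algebra minf)"
proof transfer
  fix X Y :: "nat \<Rightarrow> nat \<Rightarrow> 'a"
  assume "\<exists>n. \<forall>i j. i \<ge> n \<or> j \<ge> n \<longrightarrow> X i j = 0" "\<exists>n. \<forall>i j. i \<ge> n \<or> j \<ge> n \<longrightarrow> Y i j = 0"
  then obtain n m where n: "\<And>i j. i \<ge> n \<or> j \<ge> n \<Longrightarrow> X i j = 0"
    and m: "\<And>i j. i \<ge> m \<or> j \<ge> m \<Longrightarrow> Y i j = 0"
    by blast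
  have X: "(\<Sum>k | X j k \<noteq> 0. X j k * Y k i) = (\<Sum>k<max n m. X j k * Y k i)" for i j
    by (rule row_sum_bound) (use n in auto)
  have Y: "(\<Sum>k | star (Y k i) \<noteq> 0. star (Y k i) * star (X j k)) =
      (\<Sum>k<max n m. star (Y k i) * star (X j k))" for i j
    by (rule row_sum_bound[of _ "\<lambda>i k. star (Y k i)"])
       (use m in \<open>auto simp: star_zero\<close>)
  show "(\<lambda>i j. star (\<Sum>k | X j k \<noteq> 0. X j k * Y k i)) =
      (\<lambda>i j. \<Sum>k | star (Y k i) \<noteq> 0. star (Y k i) * star (X j k))"
    unfolding X Y by (simp add: star_sum star_mult)
qed

lemma star_zero_minf: "star 0 = (0 :: 'a::cstar_algebra minf)"
  by transfer (simp add: star_zero)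

definition projection :: "'a::{times, star} \<Rightarrow> bool" where
  "projection p \<longleftrightarrow> p * p = p \<and> star p = p"

definition murray_von_neumann :: "'a::{times, star} \<Rightarrow> 'a \<Rightarrow> bool" where
  "murray_von_neumann p q \<longleftrightarrow> (\<exists>v. star v * v = p \<and> v * star v = q)"

text \<open>\<open>msize X\<close> is the least \<open>n\<close> such that \<open>X\<close> lies in the \<open>n \<times> n\<close> corner, and \<open>mdiag X Y\<close> is the
  block diagonal matrix with \<open>X\<close>, regarded as a matrix of that size, in the upper left
  corner, followed by \<open>Y\<close>.\<close>

lift_definition msize :: "'a::cstar_algebra minf \<Rightarrow> nat" is
  "\<lambda>X. LEAST n. \<forall>i j. i \<ge> n \<or> j \<ge> n \<longrightarrow> X i j = 0" .

lift_definition mdiag_at :: "nat \<Rightarrow> 'a::cstar_algebra minf \<Rightarrow> 'a minf \<Rightarrow> 'a minf" is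
  "\<lambda>n X Y i j. if i < n \<and> j < n then X i j
    else if n \<le> i \<and> n \<le> j then Y (i - n) (j - n) else 0"
proof -
  fix n and X Y :: "nat \<Rightarrow> nat \<Rightarrow> 'a"
  assume "\<exists>m. \<forall>i j. i \<ge> m \<or> j \<ge> m \<longrightarrow> Y i j = 0"
  then obtain m where "\<forall>i j. i \<ge> m \<or> j \<ge> m \<longrightarrow> Y i j = 0" by blast
  then show "\<exists>m. \<forall>i j. i \<ge> m \<or> j \<ge> m \<longrightarrow> (if i < n \<and> j < n then X i j
    else if n \<le> i \<and> n \<le> j then Y (i - n) (j - n) else 0) = 0"
    by (intro exI[of _ "n + m"]) auto
qed

definition mdiag :: "'a::cstar_algebra minf \<Rightarrow> 'a minf \<Rightarrow> 'a minf" where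
  "mdiag X Y = mdiag_at (msize X) X Y"

definition mvn :: "'a::cstar_algebra minf \<Rightarrow> 'a minf \<Rightarrow> bool" where
  "mvn p q \<longleftrightarrow> projection p \<and> projection q \<and> murray_von_neumann p q"

lemma projection_zero_minf: "projection (0 :: 'a::cstar_algebra minf)"
  by (simp add: projection_def star_zero_minf)

lemma mvn_refl: "projection p \<Longrightarrow> mvn p p"
  unfolding mvn_def murray_von_neumann_def projection_def by (auto intro: exI[of _ p])

lemma mvn_sym: "mvn p q \<Longrightarrow> mvn q p"
  unfolding mvn_def murray_von_neumann_def by (metis star_star_minf)

text \<open>A partial isometry implementing an equivalence may be cut down to the two projections.\<close>

lemma mvnE:
  assumes "mvn p q"
  obtains v where "star v * v = p" "v * star v = q" "v * p = v" "q * v = v"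
    "p * star v = star v" "star v * q = star v"
proof -
  from assms obtain v where v: "star v * v = p" "v * star v = q"
    and pp: "p * p = p" "q * q = q" and st: "star p = p" "star q = q"
    by (auto simp: mvn_def murray_von_neumann_def projection_def)
  have qv: "q * v = v * p" by (simp add: v[symmetric] mult.assoc)
  have pv: "p * star v = star v * q" by (simp add: v[symmetric] mult.assoc)
  have av: "star v * (v * x) = p * x" and va: "v * (star v * x) = q * x" for x
    by (simp_all add: v mult.assoc[symmetric])
  let ?w = "q * v"
  have sw: "star ?w = p * star v" by (simp add: star_mult_minf st pv)
  have 1: "star ?w * ?w = p"
    unfolding sw by (simp add: qv mult.assoc av pp)
  have 2: "?w * star ?w = q"
    unfolding sw by (simp add: pv mult.assoc va pp)
  show thesis
  proof (rule that[of ?w])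
    show "?w * p = ?w" by (simp add: qv mult.assoc pp)
    show "q * ?w = ?w" by (simp add: mult.assoc[symmetric] pp)
    show "p * star ?w = star ?w" unfolding sw by (simp add: mult.assoc[symmetric] pp)
    show "star ?w * q = star ?w" unfolding sw by (simp add: pv mult.assoc pp)
  qed (fact 1 2)+
qed

lemma mvnI: "projection p \<Longrightarrow> projection q \<Longrightarrow> star v * v = p \<Longrightarrow> v * star v = q \<Longrightarrow> mvn p q"
  by (auto simp: mvn_def murray_von_neumann_def)

lemma mvn_projection: "mvn p q \<Longrightarrow> projection p" "mvn p q \<Longrightarrow> projection q"
  by (simp_all add: mvn_def)

lemma mvn_trans:
  assumes "mvn p q" "mvn q r"
  shows "mvn p r"
proof -
  obtain v where v: "star v * v = p" "v * star v = q" "q * v = v"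
    using assms(1) by (rule mvnE)
  obtain w where w: "star w * w = q" "w * star w = r" "q * star w = star w"
    using assms(2) by (rule mvnE)
  have 1: "star w * (w * v) = v"
    by (simp add: mult.assoc[symmetric] w(1) v(3))
  have 2: "v * (star v * star w) = star w"
    by (simp add: mult.assoc[symmetric] v(2) w(3))
  show ?thesis
  proof (rule mvnI[of _ _ "w * v"])
    show "star (w * v) * (w * v) = p"
      by (simp add: star_mult_minf mult.assoc 1 v(1))
    show "(w * v) * star (w * v) = r"
      by (simp add: star_mult_minf mult.assoc 2 w(2))
  qed (use assms in \<open>simp_all add: mvn_def\<close>)
qed

lemma projection_add:
  fixes p q :: "'a::cstar_algebra minf"
  assumes "projection p" "projection q" "p * q = 0"
  shows "projection (p + q)"
proof -
  have "q * p = star (p * q)"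
    using assms(1,2) by (simp add: star_mult_minf projection_def)
  with assms show ?thesis
    by (simp add: projection_def star_zero_minf distrib_left distrib_right star_add_minf)
qed

lemma mvn_add:
  fixes p q :: "'a::cstar_algebra minf"
  assumes "mvn p p'" "mvn q q'" "p * q = 0" "p' * q' = 0"
  shows "mvn (p + q) (p' + q')"
proof -
  obtain v where v: "star v * v = p" "v * star v = p'" "v * p = v" "p' * v = v"
    "p * star v = star v" "star v * p' = star v"
    using assms(1) by (rule mvnE)
  obtain w where w: "star w * w = q" "w * star w = q'" "w * q = w" "q' * w = w"
    "q * star w = star w" "star w * q' = star w"
    using assms(2) by (rule mvnE)
  have "star v * w = (star v * p') * (q' * w)" by (simp only: v(6) w(4))
  also have "\<dots> = star v * (p' * q') * w" by (simp only: mult.assoc)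
  finally have 1: "star v * w = 0" by (simp add: assms(4))
  have "v * star w = (v * p) * (q * star w)" by (simp only: v(3) w(5))
  also have "\<dots> = v * (p * q) * star w" by (simp only: mult.assoc)
  finally have 2: "v * star w = 0" by (simp add: assms(3))
  have 3: "star w * v = 0" "w * star v = 0"
    using arg_cong[OF 1, of star] arg_cong[OF 2, of star]
    by (simp_all add: star_mult_minf star_star_minf star_zero_minf)
  show ?thesis
  proof (rule mvnI[of _ _ "v + w"])
    show "star (v + w) * (v + w) = p + q" "(v + w) * star (v + w) = p' + q'"
      by (simp_all add: star_add_minf distrib_left distrib_right v(1,2) w(1,2) 1 2 3)
  qed (use assms in \<open>auto intro: projection_add simp: mvn_def\<close>)
qed

text \<open>Relocation of the entry \<open>(i, j)\<close> to \<open>(s i, t j)\<close>.\<close>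

lift_definition memb ::
  "(nat \<Rightarrow> nat) \<Rightarrow> (nat \<Rightarrow> nat) \<Rightarrow> 'a::cstar_algebra minf \<Rightarrow> 'a minf" is
  "\<lambda>s t X a b. if a \<in> range s \<and> b \<in> range t then X (inv s a) (inv t b) else 0"
proof -
  fix s t :: "nat \<Rightarrow> nat" and X :: "nat \<Rightarrow> nat \<Rightarrow> 'a"
  assume "\<exists>n. \<forall>i j. i \<ge> n \<or> j \<ge> n \<longrightarrow> X i j = 0"
  then obtain n where n: "\<And>i j. i \<ge> n \<or> j \<ge> n \<Longrightarrow> X i j = 0" by blast
  have "finite (s ` {..<n} \<union> t ` {..<n})" by simp
  then obtain m where "\<forall>a \<in> s ` {..<n} \<union> t ` {..<n}. a < m"
    using finite_nat_set_iff_bounded by blast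
  then have m: "i < n \<Longrightarrow> s i < m" "i < n \<Longrightarrow> t i < m" for i by auto
  show "\<exists>n. \<forall>a b. a \<ge> n \<or> b \<ge> n \<longrightarrow>
      (if a \<in> range s \<and> b \<in> range t then X (inv s a) (inv t b) else 0) = 0"
  proof (intro exI[of _ m] allI impI)
    fix a b assume ab: "m \<le> a \<or> m \<le> b"
    show "(if a \<in> range s \<and> b \<in> range t then X (inv s a) (inv t b) else 0) = 0"
    proof (cases "a \<in> range s \<and> b \<in> range t")
      case True
      then have "s (inv s a) = a" "t (inv t b) = b" by (simp_all add: f_inv_into_f)
      then have "n \<le> inv s a \<or> n \<le> inv t b"
        using ab m by (metis not_le)
      with n show ?thesis by auto
    qed auto
  qed
qed

lemma star_memb: "star (memb s t X) = memb t s (star X)"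
  by transfer (auto simp: fun_eq_iff star_zero)

lemma memb_mult:
  assumes t: "inj t"
  shows "memb s t X * memb t r Y = memb s r (X * Y)"
proof (transfer fixing: s t r)
  fix X Y :: "nat \<Rightarrow> nat \<Rightarrow> 'a"
  let ?X = "\<lambda>a b. if a \<in> range s \<and> b \<in> range t then X (inv s a) (inv t b) else 0"
  let ?Y = "\<lambda>a b. if a \<in> range t \<and> b \<in> range r then Y (inv t a) (inv r b) else 0"
  have "(\<Sum>k | ?X a k \<noteq> 0. ?X a k * ?Y k b) =
    (if a \<in> range s \<and> b \<in> range r
      then \<Sum>k | X (inv s a) k \<noteq> 0. X (inv s a) k * Y k (inv r b) else 0)" for a b
  proof (cases "a \<in> range s \<and> b \<in> range r")
    case True
    have "{k. ?X a k \<noteq> 0} = t ` {l. X (inv s a) l \<noteq> 0}"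
      using True by (auto simp: image_iff inv_f_f[OF t] inj_eq[OF t])
    then have "(\<Sum>k | ?X a k \<noteq> 0. ?X a k * ?Y k b) =
        (\<Sum>k \<in> t ` {l. X (inv s a) l \<noteq> 0}. ?X a k * ?Y k b)"
      by (rule arg_cong)
    also have "\<dots> = (\<Sum>l | X (inv s a) l \<noteq> 0. ?X a (t l) * ?Y (t l) b)"
      using t by (subst sum.reindex) (auto intro: inj_on_subset)
    also have "\<dots> = (\<Sum>l | X (inv s a) l \<noteq> 0. X (inv s a) l * Y l (inv r b))"
      using True t by simp
    finally show ?thesis using True by simp
  qed auto
  then show "(\<lambda>a b. \<Sum>k | ?X a k \<noteq> 0. ?X a k * ?Y k b) =
    (\<lambda>a b. if a \<in> range s \<and> b \<in> range r
      then \<Sum>k | X (inv s a) k \<noteq> 0. X (inv s a) k * Y k (inv r b) else 0)"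
    by simp
qed

lemma mult_eq_zeroI:
  assumes "\<And>i k j. mentry X i k = 0 \<or> mentry Y k j = 0"
  shows "X * Y = 0"
proof -
  have "mentry (X * Y) i j = mentry 0 i j" for i j
    unfolding times_minf.rep_eq zero_minf.rep_eq
  proof (rule sum.neutral, rule ballI)
    show "mentry X i k * mentry Y k j = 0" for k
      using assms[of i k j] by (elim disjE) simp_all
  qed
  then show ?thesis by (simp add: mentry_inject[symmetric] fun_eq_iff)
qed

lemma mvn_memb:
  assumes "projection p" "inj s"
  shows "mvn p (memb s s p)"
proof -
  have id: "memb id id X = X" for X :: "'a minf" by transfer simp
  show ?thesis
    using assms
    by (intro mvnI[of _ _ "memb s id p"])
       (auto simp: projection_def star_memb memb_mult id)
qed

lemma mentry_bound: "i \<ge> msize X \<or> j \<ge> msize X \<Longrightarrow> mentry X i j = 0"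
proof transfer
  fix X :: "nat \<Rightarrow> nat \<Rightarrow> 'a" and i j
  assume "\<exists>n. \<forall>i j. i \<ge> n \<or> j \<ge> n \<longrightarrow> X i j = 0"
  then have "\<forall>i j. i \<ge> (LEAST n. \<forall>i j. i \<ge> n \<or> j \<ge> n \<longrightarrow> X i j = 0) \<or>
      j \<ge> (LEAST n. \<forall>i j. i \<ge> n \<or> j \<ge> n \<longrightarrow> X i j = 0) \<longrightarrow> X i j = 0"
    by (rule LeastI_ex)
  then show "i \<ge> (LEAST n. \<forall>i j. i \<ge> n \<or> j \<ge> n \<longrightarrow> X i j = 0) \<or>
      j \<ge> (LEAST n. \<forall>i j. i \<ge> n \<or> j \<ge> n \<longrightarrow> X i j = 0) \<Longrightarrow> X i j = 0"
    by blast
qed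

abbreviation mshift :: "nat \<Rightarrow> 'a::cstar_algebra minf \<Rightarrow> 'a minf" where
  "mshift n \<equiv> memb (\<lambda>i. i + n) (\<lambda>i. i + n)"

lemma mentry_mshift:
  "mentry (mshift n Y) i j = (if n \<le> i \<and> n \<le> j then mentry Y (i - n) (j - n) else 0)"
proof -
  have "i \<in> range (\<lambda>i. i + n) \<longleftrightarrow> n \<le> i" for i
    by (auto simp: image_iff intro: exI[of _ "i - n"])
  moreover have "inv (\<lambda>i. i + n) i = i - n" if "n \<le> i" for i
    using that by (intro inv_f_eq) (auto simp: inj_def)
  ultimately show ?thesis by (simp add: memb.rep_eq)
qed

lemma mdiag_eq: "mdiag p q = p + mshift (msize p) q"
proof -
  have "mentry (mdiag_at (msize p) p q) i j = mentry (p + mshift (msize p) q) i j" for i j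
    using mentry_bound[of p i j] by (auto simp: mdiag_at.rep_eq plus_minf.rep_eq mentry_mshift)
  then show ?thesis
    by (simp add: mdiag_def mentry_inject[symmetric] fun_eq_iff)
qed

lemma mult_mshift_zero: "p * mshift (msize p) q = 0"
  by (rule mult_eq_zeroI) (metis mentry_mshift mentry_bound linorder_not_le nat_le_linear)

lemma mvn_mshift: "projection q \<Longrightarrow> mvn q (mshift n q)"
  by (rule mvn_memb) (simp_all add: inj_def)

lemma mvn_mdiag:
  assumes "mvn p p'" "mvn q q'" "p' * q' = 0"
  shows "mvn (mdiag p q) (p' + q')"
  unfolding mdiag_eq
proof (rule mvn_add[OF assms(1) _ mult_mshift_zero assms(3)])
  show "mvn (mshift (msize p) q) q'"
    using mvn_mshift mvn_sym mvn_trans mvn_projection assms(2) by blast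
qed

lemma mvn_mdiag_cong:
  assumes "mvn p p'" "mvn q q'"
  shows "mvn (mdiag p q) (mdiag p' q')"
  unfolding mdiag_eq[of p']
  using assms mvn_mshift mvn_trans mvn_projection mult_mshift_zero by (intro mvn_mdiag) blast+

lemma mdiag_orthogonal: "projection p \<Longrightarrow> projection q \<Longrightarrow> p * q = 0 \<Longrightarrow> mvn (mdiag p q) (p + q)"
  by (intro mvn_mdiag mvn_refl)

lemma orthogonal_sym:
  fixes p q :: "'a::cstar_algebra minf"
  assumes "projection p" "projection q" "p * q = 0"
  shows "q * p = 0"
  using arg_cong[OF assms(3), of star] assms(1,2)
  by (simp add: star_mult_minf star_zero_minf projection_def)

lemma mvn_mdiag_commute:
  assumes "projection p" "projection q"
  shows "mvn (mdiag p q) (mdiag q p)"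
proof -
  let ?q = "mshift (msize p) q"
  have q: "mvn q ?q" by (rule mvn_mshift[OF assms(2)])
  have "mvn (mdiag q p) (?q + p)"
    using q mvn_refl[OF assms(1)] orthogonal_sym[OF assms(1) mvn_projection(2)[OF q] mult_mshift_zero]
    by (rule mvn_mdiag)
  then have "mvn (mdiag q p) (mdiag p q)" by (simp add: mdiag_eq[of p q] add.commute)
  then show ?thesis by (rule mvn_sym)
qed

lemma mvn_mdiag_assoc:
  assumes p: "projection p" and q: "projection q" and r: "projection r"
  shows "mvn (mdiag (mdiag p q) r) (mdiag p (mdiag q r))"
proof -
  let ?q = "mshift (msize p) q" and ?r = "mshift (msize (mdiag p q)) r"
  have q': "mvn q ?q" and r': "mvn r ?r" using q r by (auto intro: mvn_mshift)
  have pq: "p * ?q = 0" by (rule mult_mshift_zero)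
  have z: "(p + ?q) * ?r = 0"
    using mult_mshift_zero[of "mdiag p q" r] by (simp add: mdiag_eq[of p q])
  have "p * ((p + ?q) * ?r) = p * ?r"
    using p pq by (simp add: mult.assoc[symmetric] distrib_left projection_def)
  with z have pr: "p * ?r = 0" by simp
  with z have qr: "?q * ?r = 0" by (simp add: distrib_right)
  have "mvn (mdiag q r) (?q + ?r)"
    using q' r' qr by (rule mvn_mdiag)
  then have "mvn (mdiag p (mdiag q r)) (p + (?q + ?r))"
    by (rule mvn_mdiag[OF mvn_refl[OF p]]) (simp add: distrib_left pq pr)
  moreover have "mdiag (mdiag p q) r = p + (?q + ?r)"
    by (rule trans[OF trans[OF mdiag_eq arg_cong2[where f = "(+)", OF mdiag_eq refl]] add.assoc])
  ultimately show ?thesis by (simp add: mvn_sym)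
qed

lemma mdiag_zero_left: "mdiag 0 p = p"
proof -
  have "msize (0 :: 'a minf) = 0" by transfer (simp add: Least_eq_0)
  moreover have "memb id id X = X" for X :: "'a minf" by transfer simp
  ultimately show ?thesis by (simp add: mdiag_eq id_def)
qed

text \<open>\<open>'a V\<close> is the monoid of equivalence classes of projections in \<open>'a minf\<close>,
  with addition \<open>[p] + [q] = [diag(p, q)]\<close>.\<close>

quotient_type (overloaded) 'a V = "'a::cstar_algebra minf" / partial: mvn
proof (rule part_equivpI)
  show "\<exists>x. mvn x x" using mvn_refl projection_zero_minf by blast
  show "symp mvn" by (rule sympI) (rule mvn_sym)
  show "transp mvn" by (rule transpI) (rule mvn_trans)
qed

instantiation V :: (cstar_algebra) comm_monoid_add
begin

lift_definition zero_V :: "'a V" is 0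
  by (rule mvn_refl[OF projection_zero_minf])

lift_definition plus_V :: "'a V \<Rightarrow> 'a V \<Rightarrow> 'a V" is mdiag
  by (rule mvn_mdiag_cong)

instance
proof
  fix x y z :: "'a V"
  show "x + y + z = x + (y + z)"
    by transfer (rule mvn_mdiag_assoc; erule mvn_projection)
  show "x + y = y + x"
    by transfer (rule mvn_mdiag_commute; erule mvn_projection)
  show "0 + x = x"
    by transfer (simp add: mdiag_zero_left)
qed

end

text \<open>The algebraic preorder and its strict version; \<open>\<Sum>_<n. x\<close> below is the multiple \<open>n x\<close>.\<close>

definition alg_le :: "'m::comm_monoid_add \<Rightarrow> 'm \<Rightarrow> bool" where
  "alg_le x y \<longleftrightarrow> (\<exists>z. y = x + z)"

definition alg_less :: "'m::comm_monoid_add \<Rightarrow> 'm \<Rightarrow> bool" where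
  "alg_less x y \<longleftrightarrow> alg_le x y \<and> x \<noteq> y"

text \<open>Strict unperforation is usually considered for cancellative monoids. Cancellation is not
  included here; for \<open>V(A)\<close> it follows from stable rank one.\<close>

definition strictly_unperforated :: "'m::comm_monoid_add itself \<Rightarrow> bool" where
  "strictly_unperforated _ \<longleftrightarrow>
    (\<forall>(x::'m) y. (\<exists>n::nat. alg_less (\<Sum>_<n. x) (\<Sum>_<n. y)) \<longrightarrow> alg_less x y)"

section \<open>Properties of C*-algebras\<close>

definition nonunital :: "'a::cstar_algebra itself \<Rightarrow> bool" where
  "nonunital _ \<longleftrightarrow> \<not> (\<exists>e::'a. \<forall>x. e * x = x \<and> x * e = x)"

definition two_sided_ideal :: "'a::cstar_algebra set \<Rightarrow> bool" where
  "two_sided_ideal I \<longleftrightarrow> 0 \<in> I \<and> (\<forall>x\<in>I. \<forall>y\<in>I. x + y \<in> I) \<and> (\<forall>c. \<forall>x\<in>I. c *\<^sub>C x \<in> I) \<and>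
    (\<forall>a. \<forall>x\<in>I. a * x \<in> I \<and> x * a \<in> I)"

definition simple :: "'a::cstar_algebra itself \<Rightarrow> bool" where
  "simple _ \<longleftrightarrow> (\<forall>I::'a set. two_sided_ideal I \<and> closed I \<longrightarrow> I = {0} \<or> I = UNIV)"

definition invertible_elements :: "'a::monoid_mult set" where
  "invertible_elements = {x. \<exists>y. x * y = 1 \<and> y * x = 1}"

definition self_adjoint_elements :: "'a::star set" where
  "self_adjoint_elements = {x. star x = x}"

text \<open>Real rank zero and stable rank one of a unital algebra;
  for a nonunital algebra these notions refer to its minimal unitization.\<close>

definition real_rank_zero :: "'a::{cstar_algebra, monoid_mult} itself \<Rightarrow> bool" where
  "real_rank_zero _ \<longleftrightarrow>
    (self_adjoint_elements :: 'a set) \<subseteq> closure (self_adjoint_elements \<inter> invertible_elements)"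

definition stable_rank_one :: "'a::{cstar_algebra, monoid_mult} itself \<Rightarrow> bool" where
  "stable_rank_one _ \<longleftrightarrow> closure (invertible_elements :: 'a set) = UNIV"

definition nonunital_real_rank_zero :: "'a::cstar_algebra itself \<Rightarrow> bool" where
  "nonunital_real_rank_zero _ \<longleftrightarrow> real_rank_zero TYPE('a unitization)"

definition nonunital_stable_rank_one :: "'a::cstar_algebra itself \<Rightarrow> bool" where
  "nonunital_stable_rank_one _ \<longleftrightarrow> stable_rank_one TYPE('a unitization)"

definition extreme_points :: "'a::{cstar_algebra, monoid_mult} set" where
  "extreme_points = {v. v extreme_point_of cball 0 1}"

definition extremally_rich :: "'a::{cstar_algebra, monoid_mult} itself \<Rightarrow> bool" where
  "extremally_rich _ \<longleftrightarrow>
    closure {a * v * b | a v b :: 'a.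
      a \<in> invertible_elements \<and> v \<in> extreme_points \<and> b \<in> invertible_elements} = UNIV"

section \<open>Compact operators and elementary algebras\<close>

text \<open>Complex Hilbert spaces on a carrier set, with explicit operations. The inner product
  is linear in the first variable.\<close>

record 'h hilbert =
  hcarrier :: "'h set"
  hzero :: 'h
  hadd :: "'h \<Rightarrow> 'h \<Rightarrow> 'h"
  hscale :: "complex \<Rightarrow> 'h \<Rightarrow> 'h"
  hinner :: "'h \<Rightarrow> 'h \<Rightarrow> complex"

definition hnorm :: "'h hilbert \<Rightarrow> 'h \<Rightarrow> real" where
  "hnorm H x = sqrt (Re (hinner H x x))"

text \<open>The value outside the carrier makes \<open>hdist\<close> fit the locale \<open>Metric_space\<close>.\<close>

definition hdist :: "'h hilbert \<Rightarrow> 'h \<Rightarrow> 'h \<Rightarrow> real" where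
  "hdist H x y = (if x \<in> hcarrier H \<and> y \<in> hcarrier H
    then hnorm H (hadd H x (hscale H (-1) y)) else 0)"

locale pre_hilbert_space =
  fixes H :: "'h hilbert" 
  assumes zero_closed: "hzero H \<in> hcarrier H"
    and add_closed: "x \<in> hcarrier H \<Longrightarrow> y \<in> hcarrier H \<Longrightarrow> hadd H x y \<in> hcarrier H"
    and scale_closed: "x \<in> hcarrier H \<Longrightarrow> hscale H c x \<in> hcarrier H"
    and add_assoc: "x \<in> hcarrier H \<Longrightarrow> y \<in> hcarrier H \<Longrightarrow> z \<in> hcarrier H \<Longrightarrow>
      hadd H (hadd H x y) z = hadd H x (hadd H y z)"
    and add_commute: "x \<in> hcarrier H \<Longrightarrow> y \<in> hcarrier H \<Longrightarrow> hadd H x y = hadd H y x"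
    and add_zero: "x \<in> hcarrier H \<Longrightarrow> hadd H x (hzero H) = x"
    and add_neg: "x \<in> hcarrier H \<Longrightarrow> hadd H x (hscale H (-1) x) = hzero H"
    and scale_add_right: "x \<in> hcarrier H \<Longrightarrow> y \<in> hcarrier H \<Longrightarrow>
      hscale H c (hadd H x y) = hadd H (hscale H c x) (hscale H c y)"
    and scale_add_left: "x \<in> hcarrier H \<Longrightarrow>
      hscale H (c + d) x = hadd H (hscale H c x) (hscale H d x)"
    and scale_scale: "x \<in> hcarrier H \<Longrightarrow> hscale H c (hscale H d x) = hscale H (c * d) x"
    and scale_one: "x \<in> hcarrier H \<Longrightarrow> hscale H 1 x = x"
    and inner_add_left: "x \<in> hcarrier H \<Longrightarrow> y \<in> hcarrier H \<Longrightarrow> z \<in> hcarrier H \<Longrightarrow>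
      hinner H (hadd H x y) z = hinner H x z + hinner H y z"
    and inner_scale_left: "x \<in> hcarrier H \<Longrightarrow> y \<in> hcarrier H \<Longrightarrow>
      hinner H (hscale H c x) y = c * hinner H x y"
    and inner_commute: "x \<in> hcarrier H \<Longrightarrow> y \<in> hcarrier H \<Longrightarrow>
      hinner H x y = cnj (hinner H y x)"
    and inner_pos: "x \<in> hcarrier H \<Longrightarrow> x \<noteq> hzero H \<Longrightarrow> 0 < Re (hinner H x x)"
begin

lemmas closed = zero_closed add_closed scale_closed

lemma inner_zero_left: "y \<in> hcarrier H \<Longrightarrow> hinner H (hzero H) y = 0"
  using add_neg[of y] inner_add_left[of y "hscale H (-1) y" y] inner_scale_left[of y y "-1"]
  by (simp add: closed)

lemma inner_add_right: "x \<in> hcarrier H \<Longrightarrow> y \<in> hcarrier H \<Longrightarrow> z \<in> hcarrier H \<Longrightarrow>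
    hinner H z (hadd H x y) = hinner H z x + hinner H z y"
  by (subst (1 2 3) inner_commute) (simp_all add: closed inner_add_left)

lemma inner_scale_right: "x \<in> hcarrier H \<Longrightarrow> y \<in> hcarrier H \<Longrightarrow>
    hinner H x (hscale H c y) = cnj c * hinner H x y"
  by (subst (1 2) inner_commute) (simp_all add: closed inner_scale_left)

lemma inner_nonneg: "x \<in> hcarrier H \<Longrightarrow> 0 \<le> Re (hinner H x x)"
  using inner_pos[of x] inner_zero_left[of x] by (cases "x = hzero H") auto

lemma Re_inner_commute: "x \<in> hcarrier H \<Longrightarrow> y \<in> hcarrier H \<Longrightarrow>
    Re (hinner H x y) = Re (hinner H y x)"
  by (subst inner_commute) simp_all

lemma hnorm_nonneg: "x \<in> hcarrier H \<Longrightarrow> 0 \<le> hnorm H x"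
  by (simp add: hnorm_def inner_nonneg)

lemma Re_inner_le:
  assumes x: "x \<in> hcarrier H" and y: "y \<in> hcarrier H"
  shows "Re (hinner H x y) \<le> hnorm H x * hnorm H y"
proof (cases "y = hzero H")
  case True
  then show ?thesis
    using Re_inner_commute[OF x y] inner_zero_left[OF x] hnorm_nonneg[OF x] hnorm_nonneg[OF y]
    by simp
next
  case False
  let ?r = "Re (hinner H x y)" and ?a = "Re (hinner H x x)" and ?b = "Re (hinner H y y)"
  have b: "0 < ?b" using inner_pos y False by simp
  define t where "t = - ?r / ?b"
  let ?z = "hadd H x (hscale H (complex_of_real t) y)"
  have "0 \<le> Re (hinner H ?z ?z)" by (simp add: inner_nonneg closed x y)
  also have "\<dots> = ?a + 2 * t * ?r + t * t * ?b"
    using Re_inner_commute[OF x y]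
    by (simp add: inner_add_left inner_add_right inner_scale_left inner_scale_right closed x y
        distrib_left)
  also have "\<dots> = ?a - ?r\<^sup>2 / ?b"
    using b by (simp add: t_def field_simps power2_eq_square)
  finally have "?r\<^sup>2 \<le> ?a * ?b" using b by (simp add: field_simps)
  then have "\<bar>?r\<bar> \<le> sqrt (?a * ?b)" by (simp add: real_le_rsqrt)
  then show ?thesis by (simp add: hnorm_def real_sqrt_mult)
qed

lemma hnorm_triangle:
  assumes x: "x \<in> hcarrier H" and y: "y \<in> hcarrier H"
  shows "hnorm H (hadd H x y) \<le> hnorm H x + hnorm H y"
proof (rule power2_le_imp_le)
  have sq: "(hnorm H z)\<^sup>2 = Re (hinner H z z)" if "z \<in> hcarrier H" for z
    using that by (simp add: hnorm_def inner_nonneg)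
  show "(hnorm H (hadd H x y))\<^sup>2 \<le> (hnorm H x + hnorm H y)\<^sup>2"
    using Re_inner_commute[OF x y] Re_inner_le[OF x y]
    by (simp add: sq closed x y power2_sum inner_add_left inner_add_right)
qed (simp add: hnorm_nonneg x y)

lemma Metric_space_hdist: "Metric_space (hcarrier H) (hdist H)"
proof
  fix x y z
  show "0 \<le> hdist H x y"
    by (simp add: hdist_def hnorm_nonneg closed)
  show "hdist H x y = hdist H y x"
    by (auto simp: hdist_def hnorm_def inner_add_left inner_add_right inner_scale_left
        inner_scale_right closed)
  assume x: "x \<in> hcarrier H" and y: "y \<in> hcarrier H"
  let ?m = "\<lambda>x. hscale H (-1) x"
  have ny: "hadd H (?m y) y = hzero H" if "y \<in> hcarrier H" for y
    using that add_neg add_commute closed by metis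
  have zl: "hadd H (hzero H) y = y" if "y \<in> hcarrier H" for y
    using that add_zero add_commute closed by metis
  show "hdist H x y = 0 \<longleftrightarrow> x = y"
  proof
    assume "hdist H x y = 0"
    then have "Re (hinner H (hadd H x (?m y)) (hadd H x (?m y))) = 0"
      using x y by (simp add: hdist_def hnorm_def)
    then have "hadd H x (?m y) = hzero H"
      using inner_pos[of "hadd H x (?m y)"] x y by (auto simp: closed)
    then have "hadd H (hadd H x (?m y)) y = y" by (simp add: zl y)
    then show "x = y" by (simp add: add_assoc closed x y ny add_zero)
  next
    assume "x = y"
    then show "hdist H x y = 0"
      by (simp add: hdist_def hnorm_def add_neg y inner_zero_left closed)
  qed
  assume z: "z \<in> hcarrier H"
  have "hadd H (hadd H x (?m y)) (hadd H y (?m z)) =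
      hadd H x (hadd H (hadd H (?m y) y) (?m z))"
    by (simp add: add_assoc closed x y z)
  also have "\<dots> = hadd H x (?m z)" by (simp add: ny zl closed y z)
  finally show "hdist H x z \<le> hdist H x y + hdist H y z"
    using hnorm_triangle[of "hadd H x (?m y)" "hadd H y (?m z)"]
    by (simp add: hdist_def x y z closed)
qed

end

locale hilbert_space = pre_hilbert_space +
  assumes complete: "Metric_space.mcomplete (hcarrier H) (hdist H)"

text \<open>Linear operators taking the closed unit ball to a relatively compact set.
  Outside the carrier they are normalized by \<open>extensional\<close>.\<close>

definition compact_operators :: "'h hilbert \<Rightarrow> ('h \<Rightarrow> 'h) set" where
  "compact_operators H = {T \<in> hcarrier H \<rightarrow>\<^sub>E hcarrier H.
    (\<forall>x\<in>hcarrier H. \<forall>y\<in>hcarrier H. T (hadd H x y) = hadd H (T x) (T y)) \<and>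
    (\<forall>c. \<forall>x\<in>hcarrier H. T (hscale H c x) = hscale H c (T x)) \<and>
    (let \<tau> = Metric_space.mtopology (hcarrier H) (hdist H) in
      compactin \<tau> (\<tau> closure_of (T ` {x \<in> hcarrier H. hnorm H x \<le> 1})))}"

definition iso_compact_operators :: "('a::cstar_algebra \<Rightarrow> 'h \<Rightarrow> 'h) \<Rightarrow> 'h hilbert \<Rightarrow> bool" where
  "iso_compact_operators \<phi> H \<longleftrightarrow> bij_betw \<phi> UNIV (compact_operators H) \<and>
    (\<forall>a b. \<forall>x\<in>hcarrier H. \<phi> (a + b) x = hadd H (\<phi> a x) (\<phi> b x)) \<and>
    (\<forall>c a. \<forall>x\<in>hcarrier H. \<phi> (c *\<^sub>C a) x = hscale H c (\<phi> a x)) \<and>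
    (\<forall>a b. \<forall>x\<in>hcarrier H. \<phi> (a * b) x = \<phi> a (\<phi> b x)) \<and>
    (\<forall>a. \<forall>x\<in>hcarrier H. \<forall>y\<in>hcarrier H. hinner H (\<phi> a x) y = hinner H x (\<phi> (star a) y))"

text \<open>Elementary means *-isomorphic to the compact operators on some Hilbert space.
  Taking the carrier inside the type \<open>'a\<close> is no restriction. If \<open>\<xi>\<close> is a unit vector of \<open>H\<close>, then
  \<open>x \<mapsto> \<langle>\<cdot>, \<xi>\<rangle> x\<close> injects \<open>H\<close> into the compact operators on \<open>H\<close>, so a Hilbert space \<open>H\<close> whose
  algebra of compact operators is isomorphic to \<open>'a\<close> has a copy on a subset of \<open>'a\<close>.\<close>

definition elementary :: "'a::cstar_algebra itself \<Rightarrow> bool" where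
  "elementary _ \<longleftrightarrow>
    (\<exists>(H :: 'a hilbert) (\<phi> :: 'a \<Rightarrow> 'a \<Rightarrow> 'a). hilbert_space H \<and> iso_compact_operators \<phi> H)"

end

theory Submission
  imports Defs
begin

text \<open>Let \<open>e\<close> be a nonzero projection of the approximate unit of \<open>A\<close>. As \<open>A\<close> has no minimal projections,
  arbitrarily small pieces can be exchanged between \<open>e\<close> and the increments of the approximate unit. A strictly
  convergent sum of such exchanges is a partial isometry \<open>w\<close> of \<open>M(A)\<close> with \<open>w\<^sup>*w = 1 - e\<close> and
  \<open>ww\<^sup>* = 1 - f\<close>, where \<open>f = \<Sum>f\<^sub>n\<close> has infinitely many nonzero terms but every partial sum is equivalent to
  a proper subprojection of \<open>e\<close>. Then \<open>f\<close> is not subequivalent to \<open>e\<close>, since \<open>f \<notin> A\<close>, and \<open>e\<close> is not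
  subequivalent to \<open>f\<close>, since otherwise it would be equivalent to a proper subprojection of itself, contradicting
  stable rank one. On the other hand \<open>M(A)\<close> is prime, so the extreme points of its unit ball are isometries or
  coisometries and extremal richness would make \<open>w\<close> a limit of one-sided invertible elements, which
  forces \<open>1 - w\<^sup>*w\<close> and \<open>1 - ww\<^sup>*\<close> to be comparable.\<close>

section \<open>Unital C*-algebras\<close>

text \<open>The limit \<open>f\<close> lies outside A, while stable rank one and real rank zero
  speak about A. Both comparisons are brought back to A: in a factorization of \<open>e\<close>
  through \<open>f\<close>, or of \<open>f\<close> through \<open>e\<close>, the factor fixed by
  \<open>e\<close> lies in the ideal A. There an approximate unit replaces \<open>f\<close> by a
  partial sum of the \<open>f n\<close> in the one case, and cannot reach the later
  \<open>f n\<close> in the other. The exchange behind \<open>w\<close> is a shift along an infinite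
  chain: \<open>d (Suc n)\<close>, a piece of the n-th increment, moves into \<open>d n\<close>, and
  the gap that it leaves is filled from the next increment. Starting at \<open>d 0 = e\<close> makes
  \<open>e\<close> the defect on one side; moving into a proper subprojection each time leaves the
  remainders \<open>f n\<close> on the other. Composing the moves carries the remainders back into
  \<open>e\<close> as a telescoping sum. Nonelementarity supplies the proper subprojections: a
  projection without any has a scalar corner, and A then acts on the left ideal that it generates as
  the algebra of all compact operators. Spectral projections are available only up to a tolerance,
  from invertible self-adjoint approximants and their signs.\<close>

class unital_cstar_algebra = cstar_algebra + monoid_mult

instance multiplier :: (cstar_algebra) unital_cstar_algebra ..

definition self_adjoint :: "'a::cstar_algebra \<Rightarrow> bool" where
  "self_adjoint x \<longleftrightarrow> star x = x"

definition invertible_el :: "'b::monoid_mult \<Rightarrow> bool" where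
  "invertible_el x \<longleftrightarrow> (\<exists>y. x * y = 1 \<and> y * x = 1)"

lemma star_one: "star 1 = (1::'b::unital_cstar_algebra)"
  by (metis mult_1_left mult_1_right star_mult star_star)

text \<open>Only an inequality because the zero algebra counts as unital; there the norm of 1 is
  0.\<close>

lemma norm_one_le: "norm (1::'b::unital_cstar_algebra) \<le> 1"
proof -
  have "(norm (1::'b))\<^sup>2 = norm (1::'b)"
    using cstar_identity[of "1::'b"] by (simp add: star_one)
  then have "norm (1::'b) = 0 \<or> norm (1::'b) = 1" by (simp add: power2_eq_square)
  then show ?thesis by linarith
qed

lemma norm_scaleR_one_le: "norm (r *\<^sub>R (1::'b::unital_cstar_algebra)) \<le> \<bar>r\<bar>"
  using mult_left_mono[OF norm_one_le, of "\<bar>r\<bar>"] by simp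

lemma norm_power_le: "norm (x ^ n) \<le> norm (x::'b::unital_cstar_algebra) ^ n"
proof (induction n)
  case 0 then show ?case by (simp add: norm_one_le)
next
  case (Suc n)
  have "norm (x ^ Suc n) \<le> norm x * norm (x ^ n)" by (simp add: norm_mult_ineq)
  also have "\<dots> \<le> norm x ^ Suc n" using Suc by (simp add: mult_left_mono)
  finally show ?case .
qed

lemma sa_intros:
  fixes x y :: "'b::cstar_algebra"
  shows "self_adjoint x \<Longrightarrow> self_adjoint y \<Longrightarrow> self_adjoint (x + y)" "self_adjoint x \<Longrightarrow> self_adjoint y \<Longrightarrow> self_adjoint (x - y)" "self_adjoint x \<Longrightarrow> self_adjoint (- x)"
    "self_adjoint x \<Longrightarrow> self_adjoint (r *\<^sub>R x)" "self_adjoint (0::'b)"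
  by (auto simp: self_adjoint_def star_add star_diff star_minus star_scaleR star_zero)

lemma
  fixes x y :: "'b::cstar_algebra"
  shows sa_star_mult: "self_adjoint (star z * z)" and sa_mult_star: "self_adjoint (z * star z)"
    and sa_star_conj: "self_adjoint x \<Longrightarrow> self_adjoint (star z * x * z)" and sa_conj: "self_adjoint x \<Longrightarrow> self_adjoint y \<Longrightarrow> self_adjoint (y * x * y)"
    and sa_square: "self_adjoint x \<Longrightarrow> self_adjoint (x * x)"
    and sa_mult: "self_adjoint x \<Longrightarrow> self_adjoint y \<Longrightarrow> x * y = y * x \<Longrightarrow> self_adjoint (x * y)"
  by (auto simp: self_adjoint_def star_mult star_star mult.assoc)

lemma sa_one: "self_adjoint (1::'b::unital_cstar_algebra)" by (simp add: self_adjoint_def star_one)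

lemma norm_sa_square: "self_adjoint x \<Longrightarrow> norm (x * x) = (norm x)\<^sup>2"
  using cstar_identity[of x] by (simp add: self_adjoint_def)

lemma inverse_unique_monoid:
  fixes x :: "'b::monoid_mult"
  assumes "y * x = 1" "x * z = 1" shows "y = z"
  using assms by (metis mult.assoc mult_1_left mult_1_right)

lemma inverse_commutes:
  fixes m :: "'b::monoid_mult"
  assumes "m * k = 1" "k * m = 1" "m * y = y * m"
  shows "k * y = y * k"
proof -
  have "k * y = k * (y * m) * k" by (simp add: mult.assoc assms(1))
  also have "\<dots> = (k * m) * y * k" by (simp only: assms(3)[symmetric] mult.assoc)
  finally show ?thesis by (simp add: assms(2))
qed

lemma invertible_elI: "x * y = 1 \<Longrightarrow> y * x = 1 \<Longrightarrow> invertible_el x"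
  by (auto simp: invertible_el_def)

lemma invertible_el_mult: "invertible_el x \<Longrightarrow> invertible_el y \<Longrightarrow> invertible_el (x * y)"
proof -
  assume "invertible_el x" "invertible_el y"
  then obtain x' y' where "x * x' = 1" "x' * x = 1" "y * y' = 1" "y' * y = 1"
    by (auto simp: invertible_el_def)
  then have "x * (y * (y' * x')) = 1" "y' * (x' * (x * y)) = 1"
    by (metis mult.assoc mult_1_left)+
  then show ?thesis by (intro invertible_elI[of _ "y' * x'"]) (simp_all add: mult.assoc)
qed

lemma invertible_near_one:
  fixes x :: "'b::unital_cstar_algebra"
  assumes "norm (1 - x) < 1"
  shows "invertible_el x"
proof -
  define y where "y = 1 - x"
  have y: "norm y < 1" using assms by (simp add: y_def)
  have "summable (\<lambda>n. norm (y ^ n))"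
    by (rule summable_comparison_test'[where g="\<lambda>n. norm y ^ n" and N=0])
       (use y in \<open>auto simp: norm_power_le summable_geometric\<close>)
  then have s: "summable (\<lambda>n. y ^ n)" by (rule summable_norm_cancel)
  let ?S = "suminf (\<lambda>n. y ^ n)"
  have split: "?S = 1 + (\<Sum>n. y ^ Suc n)"
    using suminf_split_head[OF s] by simp
  have "(\<Sum>n. y ^ Suc n) = y * ?S"
    using suminf_mult[OF s, of y] by simp
  with split have 1: "x * ?S = 1" by (simp add: y_def left_diff_distrib)
  have "(\<Sum>n. y ^ Suc n) = ?S * y"
    using suminf_mult2[OF s, of y] by (simp add: power_commutes)
  with split have 2: "?S * x = 1" by (simp add: y_def right_diff_distrib)
  show ?thesis using 1 2 by (rule invertible_elI)
qed

lemma invertible_near: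
  fixes x :: "'b::unital_cstar_algebra"
  assumes "norm (s *\<^sub>R 1 - x) < s"
  shows "invertible_el x"
proof -
  have s: "s > 0" using assms by (smt (verit) norm_ge_zero)
  have "1 - inverse s *\<^sub>R x = inverse s *\<^sub>R (s *\<^sub>R 1 - x)"
    using s by (simp add: scaleR_diff_right)
  then have "norm (1 - inverse s *\<^sub>R x) = norm (s *\<^sub>R 1 - x) / s"
    using s by (simp only: norm_scaleR) (simp add: divide_inverse_commute)
  then have "norm (1 - inverse s *\<^sub>R x) < 1" using assms s by simp
  then obtain y where "inverse s *\<^sub>R x * y = 1" "y * inverse s *\<^sub>R x = 1"
    using invertible_near_one invertible_el_def by blast
  then show ?thesis by (intro invertible_elI[of _ "inverse s *\<^sub>R y"]) simp_all
qed

section \<open>Square roots and positive elements\<close>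

text \<open>Taylor coefficients of sqrt(1 - x) at 0.\<close>

definition sqrt_coeff :: "nat \<Rightarrow> real" where
  "sqrt_coeff k = ((1/2) gchoose k) * (-1) ^ k"

lemma sqrt_coeff_0: "sqrt_coeff 0 = 1" by (simp add: sqrt_coeff_def)

lemma sqrt_coeff_Suc_le: "sqrt_coeff (Suc k) \<le> 0"
proof -
  have "sqrt_coeff (Suc k) = pochhammer (-1/2) (Suc k) / fact (Suc k)"
    by (simp add: sqrt_coeff_def gbinomial_pochhammer power_mult_distrib[symmetric])
  also have "\<dots> = - (1/2) * pochhammer (1/2) k / fact (Suc k)"
    by (simp add: pochhammer_rec)
  also have "\<dots> \<le> 0" by (simp add: pochhammer_nonneg)
  finally show ?thesis .
qed

lemma sqrt_coeff_partial: "(\<Sum>k\<le>n. sqrt_coeff k) \<ge> 0"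
proof -
  have "(\<Sum>k\<le>n. sqrt_coeff k) = (- 1) ^ n * ((1/2 - 1) gchoose n)"
    unfolding sqrt_coeff_def by (rule gbinomial_sum_lower_neg)
  also have "\<dots> = pochhammer (1/2) n / fact n"
    by (simp add: gbinomial_pochhammer power_mult_distrib[symmetric])
  also have "\<dots> \<ge> 0" by (simp add: pochhammer_nonneg)
  finally show ?thesis .
qed

text \<open>After the constant term all coefficients are nonpositive, so the nonnegative partial
  sums at x = 1 control their absolute values. This makes the series converge absolutely on the
  closed unit ball, boundary included.\<close>

lemma sqrt_coeff_abs_partial: "(\<Sum>k<n. \<bar>sqrt_coeff (Suc k)\<bar>) \<le> 1"
proof -
  have "(\<Sum>k\<le>n. sqrt_coeff k) = 1 - (\<Sum>k<n. \<bar>sqrt_coeff (Suc k)\<bar>)"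
    using sqrt_coeff_Suc_le
    by (subst sum.atMost_shift) (simp add: sqrt_coeff_0 abs_of_nonpos sum_negf)
  then show ?thesis using sqrt_coeff_partial[of n] by simp
qed

lemma summable_abs_sqrt_coeff_Suc: "summable (\<lambda>k. \<bar>sqrt_coeff (Suc k)\<bar>)"
  by (rule bounded_imp_summable[where B=1])
     (use sqrt_coeff_abs_partial[of "Suc _"] in \<open>auto simp: lessThan_Suc_atMost\<close>)

lemma suminf_abs_sqrt_coeff_Suc: "(\<Sum>k. \<bar>sqrt_coeff (Suc k)\<bar>) \<le> 1"
  by (rule suminf_le_const[OF summable_abs_sqrt_coeff_Suc sqrt_coeff_abs_partial])

text \<open>Vandermonde's identity for 1/2 + 1/2 = 1: the Cauchy square of the series is 1 -
  x.\<close>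

lemma sqrt_coeff_convolution:
  "(\<Sum>i\<le>n. sqrt_coeff i * sqrt_coeff (n - i)) = (if n = 0 then 1 else if n = 1 then -1 else 0)"
proof -
  have "(\<Sum>i\<le>n. sqrt_coeff i * sqrt_coeff (n - i)) =
      (\<Sum>i\<le>n. (-1) ^ n * (((1/2) gchoose i) * ((1/2) gchoose (n - i))))"
    by (rule sum.cong) (auto simp: sqrt_coeff_def power_add[symmetric])
  also have "\<dots> = (-1) ^ n * (1 gchoose n)"
    using gbinomial_Vandermonde[of "1/2::real" "1/2" n]
    by (simp add: sum_distrib_left[symmetric] atMost_atLeast0)
  also have "(1::real) gchoose n = of_nat (1 choose n)"
    by (simp add: binomial_gbinomial)
  finally show ?thesis by (cases n rule: nat.exhaust; cases "n - 1") (auto simp: binomial_eq_0)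
qed

text \<open>All square roots below come from this series. The clause
  \<open>norm (1 - b) \<le> 1\<close> is kept because it later certifies that the root is itself
  positive; the last clause reflects that \<open>b\<close> is a limit of polynomials in
  \<open>x\<close>.\<close>

lemma ex_sqrt_one_minus:
  fixes x :: "'b::unital_cstar_algebra"
  assumes x: "self_adjoint x" "norm x \<le> 1"
  shows "\<exists>b. self_adjoint b \<and> b * b = 1 - x \<and> norm (1 - b) \<le> 1 \<and> (\<forall>y. x * y = y * x \<longrightarrow> b * y = y * b)"
proof -
  let ?f = "\<lambda>k. sqrt_coeff k *\<^sub>R x ^ k"
  have le: "norm (?f k) \<le> \<bar>sqrt_coeff k\<bar>" for k
    using norm_power_le[of x k] power_mono[OF x(2), of k]
    by (simp add: mult_left_le)
  have sc: "summable (\<lambda>k. \<bar>sqrt_coeff k\<bar>)"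
    using summable_abs_sqrt_coeff_Suc summable_Suc_iff by blast
  have sn: "summable (\<lambda>k. norm (?f k))"
    by (rule summable_comparison_test'[OF sc, where N=0]) (use le in auto)
  then have s: "summable ?f" by (rule summable_norm_cancel)
  define b where "b = suminf ?f"
  have "star (x ^ k) = x ^ k" for k
    using x(1) by (induction k) (simp_all add: star_one star_mult self_adjoint_def power_commutes)
  then have fs: "star (?f k) = ?f k" for k by (simp add: star_scaleR)
  have "star b = (\<Sum>k. star (?f k))"
    unfolding b_def by (rule bounded_linear.suminf[OF bounded_linear_star s])
  then have 1: "self_adjoint b" by (simp only: fs b_def self_adjoint_def)
  have "b * b = (\<Sum>k. \<Sum>i\<le>k. ?f i * ?f (k - i))"
    unfolding b_def by (rule Cauchy_product[OF sn sn])
  also have "(\<lambda>k. \<Sum>i\<le>k. ?f i * ?f (k - i)) = (\<lambda>k. (if k = 0 then 1 else if k = 1 then -1 else 0) *\<^sub>R x ^ k)"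
  proof
    fix k
    have "(\<Sum>i\<le>k. ?f i * ?f (k - i)) = (\<Sum>i\<le>k. (sqrt_coeff i * sqrt_coeff (k - i)) *\<^sub>R x ^ k)"
      by (rule sum.cong) (auto simp: power_add[symmetric])
    then show "(\<Sum>i\<le>k. ?f i * ?f (k - i)) = (if k = 0 then 1 else if k = 1 then -1 else 0) *\<^sub>R x ^ k"
      by (simp only: sqrt_coeff_convolution scaleR_sum_left[symmetric])
  qed
  also have "(\<Sum>k. (if k = 0 then 1 else if k = 1 then -1 else 0) *\<^sub>R x ^ k) =
     (\<Sum>k\<in>{0,1}. (if k = 0 then 1 else if k = 1 then -1 else 0) *\<^sub>R x ^ k)"
    by (rule suminf_finite) auto
  finally have 2: "b * b = 1 - x" by simp
  have "b = 1 + (\<Sum>k. ?f (Suc k))"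
    using suminf_split_head[OF s] by (simp add: b_def sqrt_coeff_0)
  then have "norm (1 - b) = norm (\<Sum>k. ?f (Suc k))" by simp
  also have "\<dots> \<le> (\<Sum>k. norm (?f (Suc k)))"
    by (rule summable_norm) (use sn in \<open>subst summable_Suc_iff\<close>)
  also have "\<dots> \<le> (\<Sum>k. \<bar>sqrt_coeff (Suc k)\<bar>)"
    by (rule suminf_le[OF le]) (use sn summable_abs_sqrt_coeff_Suc in \<open>simp_all only: summable_Suc_iff[of "\<lambda>k. norm (?f k)"]\<close>)
  also have "\<dots> \<le> 1" by (rule suminf_abs_sqrt_coeff_Suc)
  finally have 3: "norm (1 - b) \<le> 1" .
  have 4: "b * y = y * b" if "x * y = y * x" for y
  proof -
    have "x ^ k * y = y * x ^ k" for k
    proof (induction k)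
      case (Suc k)
      have "x ^ Suc k * y = x * (x ^ k * y)" by (simp add: mult.assoc)
      also have "\<dots> = x * y * x ^ k" by (simp add: Suc mult.assoc)
      also have "\<dots> = y * x ^ Suc k" using that by (simp add: mult.assoc)
      finally show ?case .
    qed simp
    then have "(\<lambda>k. ?f k * y) = (\<lambda>k. y * ?f k)" by simp
    then show ?thesis
      using suminf_mult[OF s, of y] suminf_mult2[OF s, of y] by (simp add: b_def)
  qed
  show ?thesis using 1 2 3 4 by blast
qed

section \<open>The positive cone\<close>

definition positive :: "'b::unital_cstar_algebra \<Rightarrow> bool" where
  "positive x \<longleftrightarrow> (\<exists>b. self_adjoint b \<and> x = b * b)"

lemma scaleC_minus_left: "(- c) *\<^sub>C x = - (c *\<^sub>C (x::'b::cstar_algebra))"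
proof -
  have "(- c) *\<^sub>C x + c *\<^sub>C x = 0"
    by (simp add: scaleC_add_left[symmetric] scaleC_zero_left)
  then show ?thesis by (simp add: eq_neg_iff_add_eq_0)
qed

text \<open>A substitute for saying that \<open>b\<close> is a function of \<open>x\<close>; it is
  what lets roots, inverses and sign projections of commuting elements commute.\<close>

definition bicommutes :: "'b::times \<Rightarrow> 'b \<Rightarrow> bool" where
  "bicommutes x b \<longleftrightarrow> (\<forall>y. x * y = y * x \<longrightarrow> b * y = y * b)"

lemma bicommutesD: "bicommutes x b \<Longrightarrow> x * y = y * x \<Longrightarrow> b * y = y * b"
  by (simp add: bicommutes_def)

lemma pos_square: "self_adjoint b \<Longrightarrow> positive (b * b)" by (auto simp: positive_def)

lemma pos_sa: "positive x \<Longrightarrow> self_adjoint x" by (auto simp: positive_def sa_square)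

lemma pos_scaleR: assumes "positive x" "r \<ge> 0" shows "positive (r *\<^sub>R x)"
proof -
  obtain b where "self_adjoint b" "x = b * b" using assms by (auto simp: positive_def)
  then show ?thesis using assms(2)
    by (intro positive_def[THEN iffD2] exI[of _ "sqrt r *\<^sub>R b"]) (simp add: sa_intros)
qed

lemma pos_one: "positive 1" using pos_square[OF sa_one] by simp

text \<open>The element u = b + ic satisfies \<open>star u * u = s *\<^sub>R 1\<close>, so its norm
  is at most sqrt s, and \<open>b\<close> is its real part.\<close>

lemma norm_le_if_square_sum:
  fixes b c :: "'b::unital_cstar_algebra"
  assumes "self_adjoint b" "self_adjoint c" "b * c = c * b" "b * b + c * c = s *\<^sub>R 1" "s \<ge> 0"
  shows "(norm b)\<^sup>2 \<le> s"
proof -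
  let ?u = "b + \<i> *\<^sub>C c"
  have st: "star ?u = b - \<i> *\<^sub>C c"
    using assms(1,2) by (simp add: star_add star_scaleC self_adjoint_def scaleC_minus_left)
  have "star ?u * ?u = b * b + c * c"
    unfolding st using assms(3)
    by (simp add: algebra_simps mult_scaleC_left mult_scaleC_right scaleC_scaleC scaleC_add_right
        scaleC_diff_right scaleC_minus_left scaleC_one)
  then have "(norm ?u)\<^sup>2 = norm (s *\<^sub>R (1::'b))"
    using assms(4) cstar_identity[of ?u] by simp
  also have "\<dots> \<le> s" using norm_scaleR_one_le[of s] assms(5) by simp
  finally have u: "(norm ?u)\<^sup>2 \<le> s" .
  have "2 *\<^sub>R b = ?u + star ?u" unfolding st by (simp add: scaleR_2)
  then have "norm (2 *\<^sub>R b) \<le> norm ?u + norm (star ?u)"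
    by (metis norm_triangle_ineq)
  then have "norm b \<le> norm ?u" by (simp add: norm_star)
  then have "(norm b)\<^sup>2 \<le> (norm ?u)\<^sup>2" by (intro power_mono) auto
  then show ?thesis using u by (rule order_trans)
qed

text \<open>For \<open>t\<close> at least the squared norm of \<open>b\<close>, the series yields a
  root \<open>d\<close> of t - b^2 that commutes with \<open>b\<close>. The squares of
  \<open>d\<close> and \<open>b\<close> sum to \<open>t\<close>, so the preceding bound applies with
  \<open>d\<close> in the place of \<open>b\<close>.\<close>

lemma norm_diff_square_le:
  fixes b :: "'b::unital_cstar_algebra"
  assumes "self_adjoint b" "(norm b)\<^sup>2 \<le> t"
  shows "norm (t *\<^sub>R 1 - b * b) \<le> t"
proof (cases "t = 0")
  case True then show ?thesis using assms by simp
next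
  case False
  then have t: "t > 0" using assms(2) by (smt (verit) zero_le_power2)
  let ?x = "inverse t *\<^sub>R (b * b)"
  have "norm ?x \<le> 1" using t assms by (simp add: norm_sa_square field_simps)
  moreover have "self_adjoint ?x" using assms by (intro sa_intros sa_square)
  ultimately obtain c where c: "self_adjoint c" "c * c = 1 - ?x" "\<And>y. ?x * y = y * ?x \<Longrightarrow> c * y = y * c"
    and "norm (1 - c) \<le> 1"
    using ex_sqrt_one_minus by blast
  let ?d = "sqrt t *\<^sub>R c"
  have "?d * ?d = t *\<^sub>R (c * c)" using t by simp
  also have "\<dots> = t *\<^sub>R 1 - b * b" using t by (simp add: c(2) scaleR_diff_right)
  finally have dd: "?d * ?d = t *\<^sub>R 1 - b * b" .
  have "c * b = b * c" by (rule c(3)) (simp add: mult.assoc)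
  then have db: "?d * b = b * ?d" by simp
  have "?d * ?d + b * b = t *\<^sub>R 1" unfolding dd by simp
  then have "(norm ?d)\<^sup>2 \<le> t"
    using norm_le_if_square_sum[OF sa_intros(4)[OF c(1)] assms(1) db] t by simp
  moreover have "norm (?d * ?d) = (norm ?d)\<^sup>2" by (rule norm_sa_square) (intro sa_intros c(1))
  ultimately show ?thesis by (simp only: dd)
qed

lemma ex_sqrt_norm:
  fixes x :: "'b::unital_cstar_algebra"
  assumes "self_adjoint x" "norm (t *\<^sub>R 1 - x) \<le> t"
  shows "\<exists>b. self_adjoint b \<and> b * b = x \<and> (\<exists>r. norm (r *\<^sub>R 1 - b) \<le> r) \<and> (\<forall>y. x * y = y * x \<longrightarrow> b * y = y * b)"
proof (cases "t = 0")
  case True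
  then have "x = 0" using assms by simp
  then show ?thesis by (intro exI[of _ 0]) (auto simp: sa_intros intro: exI[of _ 0])
next
  case False
  then have t: "t > 0" using assms(2) by (smt (verit) norm_ge_zero)
  let ?y = "1 - inverse t *\<^sub>R x"
  have "?y = inverse t *\<^sub>R (t *\<^sub>R 1 - x)" using t by (simp add: scaleR_diff_right)
  then have "norm ?y = norm (t *\<^sub>R 1 - x) / t"
    using t by (simp only: norm_scaleR) (simp add: divide_inverse_commute)
  then have "norm ?y \<le> 1" using t assms by simp
  moreover have "self_adjoint ?y" using assms by (intro sa_intros sa_one)
  ultimately obtain c where c: "self_adjoint c" "c * c = 1 - ?y" "norm (1 - c) \<le> 1"
      "\<And>z. ?y * z = z * ?y \<Longrightarrow> c * z = z * c"
    using ex_sqrt_one_minus by blast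
  have "sqrt t *\<^sub>R 1 - sqrt t *\<^sub>R c = sqrt t *\<^sub>R (1 - c)"
    by (simp add: scaleR_diff_right)
  then have nb: "norm (sqrt t *\<^sub>R 1 - sqrt t *\<^sub>R c) \<le> sqrt t"
    using t c(3) by (simp add: mult_left_le)
  have cz: "c * z = z * c" if "x * z = z * x" for z
    by (rule c(4)) (simp add: left_diff_distrib right_diff_distrib that)
  moreover have "sqrt t *\<^sub>R c * z = z * sqrt t *\<^sub>R c" if "x * z = z * x" for z
    using cz[OF that] by simp
  moreover have "sqrt t *\<^sub>R c * sqrt t *\<^sub>R c = x"
  proof -
    have "sqrt t *\<^sub>R c * sqrt t *\<^sub>R c = t *\<^sub>R (c * c)" using t by simp
    then show ?thesis using t unfolding c(2) by simp
  qed
  moreover have "self_adjoint (sqrt t *\<^sub>R c)" by (intro sa_intros c(1))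
  moreover have "\<exists>r. norm (r *\<^sub>R 1 - sqrt t *\<^sub>R c) \<le> r" using nb ..
  ultimately show ?thesis by (intro exI[of _ "sqrt t *\<^sub>R c"] conjI allI impI) assumption+
qed

text \<open>With the converse \<open>norm_diff_pos_le\<close>, positivity becomes a norm inequality;
  closure under sums is then the triangle inequality.\<close>

lemma pos_if_norm: assumes "self_adjoint x" "norm (t *\<^sub>R 1 - x) \<le> t" shows "positive x"
proof -
  obtain b where "self_adjoint b" "b * b = x" using ex_sqrt_norm[OF assms] by blast
  then show ?thesis using pos_square[of b] by simp
qed

lemma norm_diff_pos_le: assumes "positive x" "norm x \<le> t" shows "norm (t *\<^sub>R 1 - x) \<le> t"
proof -
  obtain b where "self_adjoint b" "x = b * b" using assms(1) unfolding positive_def by blast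
  then show ?thesis using assms(2) norm_diff_square_le[of b t] by (simp add: norm_sa_square)
qed

lemma pos_sqrtE:
  assumes "positive x"
  obtains b where "self_adjoint b" "b * b = x" "bicommutes x b" "positive b"
proof -
  have "norm (norm x *\<^sub>R 1 - x) \<le> norm x" using norm_diff_pos_le[OF assms] by simp
  from ex_sqrt_norm[OF pos_sa[OF assms] this] obtain b r where b: "self_adjoint b" "b * b = x"
    "norm (r *\<^sub>R 1 - b) \<le> r" and c: "\<forall>y. x * y = y * x \<longrightarrow> b * y = y * b" by blast
  show ?thesis
    by (rule that[OF b(1,2) _ pos_if_norm[OF b(1,3)]]) (simp add: c bicommutes_def)
qed

lemma pos_add: assumes "positive x" "positive y" shows "positive (x + y)"
proof (rule pos_if_norm[of _ "norm x + norm y"])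
  show "self_adjoint (x + y)" using assms by (intro sa_intros pos_sa)
  have eq: "(norm x + norm y) *\<^sub>R 1 - (x + y) = (norm x *\<^sub>R 1 - x) + (norm y *\<^sub>R 1 - y)"
    by (simp add: scaleR_add_left)
  show "norm ((norm x + norm y) *\<^sub>R 1 - (x + y)) \<le> norm x + norm y"
    unfolding eq
    using norm_diff_pos_le[OF assms(1) order_refl] norm_diff_pos_le[OF assms(2) order_refl]
      norm_triangle_ineq[of "norm x *\<^sub>R 1 - x" "norm y *\<^sub>R 1 - y"] by linarith
qed

lemma pos_norm_minus: "self_adjoint x \<Longrightarrow> norm x \<le> s \<Longrightarrow> positive (s *\<^sub>R 1 - x)"
  by (rule pos_if_norm[of _ s]) (auto intro: sa_intros sa_one)

lemma pos_norm_plus: "self_adjoint x \<Longrightarrow> norm x \<le> s \<Longrightarrow> positive (s *\<^sub>R 1 + x)"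
  using pos_norm_minus[of "- x" s] by (simp add: sa_intros)

text \<open>Commuting roots of \<open>x\<close> and of s - x have squares that sum to
  \<open>s\<close>.\<close>

lemma norm_le_if_pos:
  assumes "positive x" "positive (s *\<^sub>R 1 - x)" "s \<ge> 0"
  shows "norm x \<le> s"
proof -
  obtain b where b: "self_adjoint b" "b * b = x" "bicommutes x b" "positive b"
    by (rule pos_sqrtE[OF assms(1)])
  obtain c where c: "self_adjoint c" "c * c = s *\<^sub>R 1 - x"
    "bicommutes (s *\<^sub>R 1 - x) c" "positive c"
    by (rule pos_sqrtE[OF assms(2)])
  have "c * x = x * c"
    by (rule bicommutesD[OF c(3)]) (simp add: left_diff_distrib right_diff_distrib)
  then have "b * c = c * b" by (intro bicommutesD[OF b(3)]) simp
  then have "(norm b)\<^sup>2 \<le> s" using b c assms(3)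
    by (intro norm_le_if_square_sum[of b c]) auto
  then show ?thesis using norm_sa_square[OF b(1)] b(2) by simp
qed

lemma pos_antisym: assumes "positive x" "positive (- x)" shows "x = 0"
proof -
  have "positive (0 *\<^sub>R 1 - x)" using assms(2) by simp
  from norm_le_if_pos[OF assms(1) this] show ?thesis by simp
qed

lemma pos_mult_commute:
  assumes "positive x" "positive y" "x * y = y * x"
  shows "positive (x * y)"
proof -
  obtain a where a: "self_adjoint a" "a * a = x" "bicommutes x a" "positive a"
    by (rule pos_sqrtE[OF assms(1)])
  obtain b where b: "self_adjoint b" "b * b = y" "bicommutes y b" "positive b"
    by (rule pos_sqrtE[OF assms(2)])
  have "a * y = y * a" by (rule bicommutesD[OF a(3) assms(3)])
  then have ab: "b * a = a * b" by (intro bicommutesD[OF b(3)]) simp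
  have "(a * b) * (a * b) = a * (b * a) * b" by (simp only: mult.assoc)
  also have "\<dots> = (a * a) * (b * b)" by (simp only: ab mult.assoc)
  finally have "(a * b) * (a * b) = x * y" by (simp only: a(2) b(2))
  then show ?thesis using pos_square[OF sa_mult[OF a(1) b(1)]] ab by simp
qed

section \<open>Invertibility and the positivity of \<open>star y * y\<close>\<close>

lemma invertible_el_sides:
  fixes x :: "'b::monoid_mult"
  assumes "x * y = 1" "z * x = 1" shows "invertible_el x"
  using assms inverse_unique_monoid[OF assms(2,1)] by (auto simp: invertible_el_def)

lemma sa_inverse:
  assumes "self_adjoint x" "x * w = 1" "w * x = 1"
  shows "self_adjoint (w::'b::unital_cstar_algebra)"
proof -
  have "star w * x = 1"
    using arg_cong[OF assms(2), of star] assms(1) by (simp add: star_mult star_one self_adjoint_def)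
  from inverse_unique_monoid[OF this assms(2)] show ?thesis by (simp add: self_adjoint_def)
qed

text \<open>With \<open>w\<close> the inverse of \<open>g\<close> and \<open>M\<close> above its
  norm, \<open>g\<close> times M - w is a product of commuting positive elements, and it equals Mg -
  1. The summand 1/t in \<open>M\<close> serves only to get \<open>d \<le> t\<close>.\<close>

lemma pos_invertible_bound:
  assumes g: "positive g" "invertible_el g" "t > 0"
  shows "\<exists>d>0. d \<le> t \<and> positive (g - d *\<^sub>R 1)"
proof -
  obtain w where w: "g * w = 1" "w * g = 1" using g(2) by (auto simp: invertible_el_def)
  have sw: "self_adjoint w"
    by (rule sa_inverse[OF pos_sa[OF g(1)] w])
  define M where "M = norm w + 1 + 1 / t"
  have M: "M > 0" "1 / M \<le> t"
  proof -
    have "0 < 1 / t" using g(3) by simp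
    then show "M > 0" using norm_ge_zero[of w] unfolding M_def by linarith
    have "1 / t \<le> M" using norm_ge_zero[of w] unfolding M_def by linarith
    then show "1 / M \<le> t" using g(3) \<open>M > 0\<close> by (simp add: field_simps)
  qed
  have "positive (M *\<^sub>R 1 - w)"
    by (rule pos_norm_minus[OF sw]) (use g(3) in \<open>simp add: M_def\<close>)
  then have "positive (g * (M *\<^sub>R 1 - w))"
    using g(1) by (intro pos_mult_commute) (simp_all add: left_diff_distrib right_diff_distrib w)
  then have "positive ((1 / M) *\<^sub>R (g * (M *\<^sub>R 1 - w)))"
    using M by (intro pos_scaleR) auto
  also have "(1 / M) *\<^sub>R (g * (M *\<^sub>R 1 - w)) = g - (1 / M) *\<^sub>R 1"
    using M by (simp add: right_diff_distrib w scaleR_diff_right)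
  finally have "positive (g - (1 / M) *\<^sub>R 1)" .
  moreover have "1 / M > 0" using M by simp
  ultimately show ?thesis using M(2) by blast
qed

lemma pos_plus_invertible:
  assumes "positive (g - d *\<^sub>R 1)" "d > 0"
  shows "invertible_el g"
proof -
  let ?n = "norm (g - d *\<^sub>R 1)"
  have "norm (?n *\<^sub>R 1 - (g - d *\<^sub>R 1)) \<le> ?n"
    by (rule norm_diff_pos_le[OF assms(1)]) simp
  moreover have "?n *\<^sub>R 1 - (g - d *\<^sub>R 1) = (?n + d) *\<^sub>R 1 - g"
    by (simp add: scaleR_add_left)
  ultimately show ?thesis using assms(2) by (intro invertible_near[of "?n + d"]) simp
qed

text \<open>Since \<open>y\<^sup>*y\<close> and \<open>yy\<^sup>*\<close> have the same nonzero spectrum and \<open>yy\<^sup>*\<close> turns out to be positive,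
  \<open>r - h\<^sup>2\<close> is invertible for every \<open>r > 0\<close>, in particular for \<open>r = \<parallel>h\<^sup>2\<parallel>\<close>.\<close>

lemma negative_star_square_zero:
  fixes y :: "'b::unital_cstar_algebra"
  assumes h: "self_adjoint h" and y: "star y * y = - (h * h)"
  shows "y = 0"
proof (rule ccontr)
  assume "y \<noteq> 0"
  define t where "t = norm (h * h)"
  have "norm (h * h) = (norm y)\<^sup>2" using y cstar_identity[of y] by simp
  then have t: "t > 0" using \<open>y \<noteq> 0\<close> by (simp add: t_def)
  \<comment> \<open>\<open>?a\<close> is twice the real part of \<open>y\<close> and
    \<open>?b\<close> is minus twice its imaginary part. Their squares sum to twice
    \<open>y * star y + star y * y\<close>, so \<open>y * star y\<close> is positive because
    \<open>star y * y\<close> is minus a square.\<close>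
  let ?a = "y + star y" and ?b = "\<i> *\<^sub>C (y - star y)"
  have a: "self_adjoint ?a" by (simp add: self_adjoint_def star_add star_star)
  have b: "self_adjoint ?b"
    by (simp add: self_adjoint_def star_diff star_star star_scaleC scaleC_minus_left scaleC_diff_right)
  have bb: "?b * ?b = - ((y - star y) * (y - star y))"
    by (simp add: mult_scaleC_left mult_scaleC_right scaleC_scaleC scaleC_minus_left scaleC_one)
  have "2 *\<^sub>R (y * star y + star y * y) = ?a * ?a + ?b * ?b"
    unfolding bb by (simp add: algebra_simps scaleR_2)
  then have "2 *\<^sub>R (y * star y) = ?a * ?a + ?b * ?b + 2 *\<^sub>R (h * h)"
    by (simp add: y scaleR_add_right algebra_simps)
  then have "positive (2 *\<^sub>R (y * star y))"
    using a b h by (auto intro!: pos_add pos_square pos_scaleR)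
  from pos_scaleR[OF this, of "1/2"] have "positive (y * star y)" by simp
  then have "invertible_el (y * star y + t *\<^sub>R 1)"
    using t by (intro pos_plus_invertible[of _ t]) simp_all
  then obtain z where z: "(y * star y + t *\<^sub>R 1) * z = 1" "z * (y * star y + t *\<^sub>R 1) = 1"
    by (auto simp: invertible_el_def)
  have z': "y * (star y * (z * x)) = x - t *\<^sub>R (z * x)" "z * (y * (star y * x)) = x - t *\<^sub>R (z * x)" for x
    using arg_cong[OF z(1), of "\<lambda>u. u * x"] arg_cong[OF z(2), of "\<lambda>u. u * x"]
    by (simp_all add: distrib_left distrib_right mult.assoc eq_diff_eq)
  \<comment> \<open>The standard passage between the resolvents of \<open>y * star y\<close> and of
    \<open>star y * y\<close>.\<close>
  let ?g = "t *\<^sub>R 1 - h * h" and ?w = "inverse t *\<^sub>R (1 - star y * (z * y))"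
  have g: "?g = t *\<^sub>R 1 + star y * y" using y by simp
  have "?g * ?w = 1" "?w * ?g = 1"
    unfolding g using t
    by (simp_all add: distrib_left distrib_right left_diff_distrib right_diff_distrib
        mult.assoc scaleR_diff_right scaleR_add_right z' )
  then have "invertible_el ?g" by (rule invertible_elI)
  moreover have "positive ?g" by (rule pos_norm_minus) (simp_all add: t_def sa_square h)
  ultimately obtain d where d: "d > 0" "d \<le> t" "positive (?g - d *\<^sub>R 1)"
    using pos_invertible_bound t by blast
  have "norm (h * h) \<le> t - d"
    using d h by (intro norm_le_if_pos pos_square) (simp_all add: algebra_simps)
  then show False using d by (simp add: t_def)
qed

lemma ex_abs:
  assumes "self_adjoint a"
  obtains m where "self_adjoint m" "m * m = a * a" "bicommutes a m" "positive m"
proof -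
  obtain m where m: "self_adjoint m" "m * m = a * a" "bicommutes (a * a) m" "positive m"
    by (rule pos_sqrtE[OF pos_square[OF assms]])
  have "m * y = y * m" if "a * y = y * a" for y
    proof (rule bicommutesD[OF m(3)])
    have "a * a * y = a * (y * a)" by (simp only: mult.assoc that)
    also have "\<dots> = (a * y) * a" by (simp only: mult.assoc)
    also have "\<dots> = y * (a * a)" unfolding that by (simp only: mult.assoc)
    finally show "a * a * y = y * (a * a)" .
  qed
  then have "bicommutes a m" by (simp add: bicommutes_def)
  from m(1,2) this m(4) show ?thesis by (rule that)
qed

text \<open>With \<open>m\<close> the absolute value of \<open>a = star y * y\<close>, the element
  \<open>n = m - a\<close> is twice the negative part of \<open>a\<close>. Then
  \<open>star (y * n) * (y * n) = n * a * n\<close> is minus the square of a self-adjoint element,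
  so \<open>y * n\<close> vanishes by \<open>negative_star_square_zero\<close>; this kills the
  fourth power of \<open>n\<close> and hence \<open>n\<close>.\<close>

lemma pos_star_mult: "positive (star y * (y::'b::unital_cstar_algebra))"
proof -
  define a where "a = star y * y"
  have a: "self_adjoint a" by (simp add: a_def sa_star_mult)
  obtain m where m: "self_adjoint m" "m * m = a * a" and mc: "bicommutes a m"
    and mp: "positive m"
    by (rule ex_abs[OF a])
  have ma: "m * a = a * m" by (rule bicommutesD[OF mc]) simp
  obtain q where q: "self_adjoint q" "q * q = m" and qc: "bicommutes m q" and "positive q"
    by (rule pos_sqrtE[OF mp])
  define n where "n = m - a"
  have n: "self_adjoint n" using m a by (simp add: n_def sa_intros)
  have mn: "m * n = n * m" by (simp add: n_def algebra_simps ma)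
  have qn: "q * n = n * q" by (rule bicommutesD[OF qc mn])
  have an: "n * a = - (n * m)" by (simp add: n_def algebra_simps m(2) ma)
  have nn: "n * n = 2 *\<^sub>R (n * m)"
    by (simp add: n_def algebra_simps m(2) ma scaleR_2)
  have e: "n * a * n = - ((q * n) * (q * n))"
  proof -
    have "n * a * n = - (n * m * n)" by (simp add: an)
    also have "n * m * n = (n * q) * (q * n)" by (simp add: q(2)[symmetric] mult.assoc)
    finally show ?thesis by (simp add: qn)
  qed
  have "star (y * n) * (y * n) = n * a * n"
    using n by (simp add: a_def star_mult mult.assoc self_adjoint_def)
  then have "y * n = 0"
    using e negative_star_square_zero[OF sa_mult[OF q(1) n qn]] by simp
  then have "n * a * n = 0" by (simp add: a_def mult.assoc)
  then have "(n * n) * n = 0" by (simp add: nn an)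
  then have "(n * n) * (n * n) = 0" by (simp add: mult.assoc[symmetric])
  then have "norm ((n * n) * (n * n)) = 0" by simp
  then have "n = 0" using n by (simp add: norm_sa_square sa_square)
  then have "star y * y = m" by (simp add: n_def a_def)
  then show ?thesis using mp by simp
qed

lemma pos_mult_star: "positive (y * star (y::'b::unital_cstar_algebra))"
  using pos_star_mult[of "star y"] by (simp add: star_star)

lemma pos_conj: assumes "positive x" shows "positive (star y * x * y)"
proof -
  obtain b where "self_adjoint b" "x = b * b" using assms by (auto simp: positive_def)
  then have "star y * x * y = star (b * y) * (b * y)"
    by (simp add: star_mult self_adjoint_def mult.assoc)
  then show ?thesis by (simp add: pos_star_mult)
qed

lemma pos_conj_sa: "positive x \<Longrightarrow> self_adjoint y \<Longrightarrow> positive (y * x * y)"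
  using pos_conj[of x y] by (simp add: self_adjoint_def)

lemma norm_power2_le_if_pos:
  "positive (s *\<^sub>R 1 - star z * z) \<Longrightarrow> s \<ge> 0 \<Longrightarrow> (norm z)\<^sup>2 \<le> s"
  using norm_le_if_pos[OF pos_star_mult, of s z] by (simp add: cstar_identity)

lemma pos_norm_star_mult: "(norm z)\<^sup>2 \<le> s \<Longrightarrow> positive (s *\<^sub>R 1 - star z * z)"
  by (rule pos_norm_minus) (simp_all add: sa_star_mult cstar_identity)

lemma projection_pos: "projection (p::'b::unital_cstar_algebra) \<Longrightarrow> positive p"
  using pos_square[of p] by (simp add: projection_def self_adjoint_def)

text \<open>The spectral projection of \<open>b\<close> for the positive half-line: \<open>s\<close>
  is the sign of \<open>b\<close>, namely \<open>b\<close> times the inverse of its absolute value,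
  and \<open>p\<close> is (1 + s)/2. Invertibility keeps 0, where the sign jumps, out of the
  spectrum.\<close>

lemma sign_projection:
  assumes b: "self_adjoint b" "invertible_el b"
  obtains p where "projection p" "bicommutes b p" "positive (p * b)"
    "positive (- ((1 - p) * b))"
proof -
  obtain m where m: "self_adjoint m" "m * m = b * b" and mc: "bicommutes b m"
    and mp: "positive m"
    by (rule ex_abs[OF b(1)])
  obtain w where w: "b * w = 1" "w * b = 1" using b(2) by (auto simp: invertible_el_def)
  have mb: "m * b = b * m" by (rule bicommutesD[OF mc]) simp
  have 1: "m * (m * (w * w)) = 1" "w * w * m * m = 1"
  proof -
    have "m * (m * (w * w)) = b * (b * w) * w" by (simp only: mult.assoc[symmetric] m(2))
    also have "\<dots> = 1" by (simp add: w)
    finally show "m * (m * (w * w)) = 1" .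
    have "w * w * m * m = w * (w * b) * b" by (simp only: mult.assoc m(2))
    also have "\<dots> = 1" by (simp add: w)
    finally show "w * w * m * m = 1" .
  qed
  then have "invertible_el m" by (intro invertible_el_sides)
  then obtain k where k: "m * k = 1" "k * m = 1" by (auto simp: invertible_el_def)
  have inv_commute: "k * y = y * k" if "m * y = y * m" for y
    by (rule inverse_commutes[OF k that])
  have kb: "k * b = b * k" by (rule inv_commute[OF mb])
  have sk: "self_adjoint k" by (rule sa_inverse[OF m(1) k])
  define s where "s = b * k"
  have ss: "s * s = 1"
  proof -
    have "s * s = b * (k * b) * k" by (simp only: s_def mult.assoc)
    also have "\<dots> = (m * m) * k * k" by (simp only: kb m(2) mult.assoc)
    also have "\<dots> = 1" by (simp add: mult.assoc k)
    finally show ?thesis .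
  qed
  have ssa: "self_adjoint s" unfolding s_def using b sk kb by (intro sa_mult) auto
  have sc: "s * y = y * s" if "b * y = y * b" for y
    unfolding s_def using inv_commute[OF bicommutesD[OF mc that]]
    by (simp only: mult.assoc) (simp only: mult.assoc[symmetric] that)
  define p where "p = (1/2) *\<^sub>R (1 + s)"
  have pp: "p * p = p"
    by (simp add: p_def distrib_left distrib_right ss scaleR_add_right[symmetric])
       (simp add: scaleR_2[symmetric] add_ac)
  have psa: "self_adjoint p" unfolding p_def using ssa by (intro sa_intros sa_one)
  have proj: "projection p" using pp psa by (simp add: projection_def self_adjoint_def)
  have pc: "p * y = y * p" if "b * y = y * b" for y
    using sc[OF that] by (simp add: p_def distrib_left distrib_right)
  have sb: "s * b = m"
  proof -
    have "s * b = (b * b) * k" by (simp only: s_def mult.assoc kb)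
    also have "\<dots> = m * (m * k)" by (simp only: m(2)[symmetric] mult.assoc)
    finally show ?thesis by (simp add: k)
  qed
  have sm: "s * m = b" by (simp add: s_def mult.assoc k)
  have pb: "p * b = p * m" by (simp add: p_def distrib_right sb sm add.commute)
  have pm: "p * m = m * p" by (rule pc) (simp add: mb)
  have "p * m = p * m * p"
    by (simp only: mult.assoc pm[symmetric]) (simp only: mult.assoc[symmetric] pp)
  then have 2: "positive (p * b)" unfolding pb using pos_conj_sa[OF mp psa] by simp
  have "(1 - p) * b = - ((1 - p) * m)"
    by (simp add: left_diff_distrib p_def distrib_right sb sm algebra_simps flip: scaleR_2)
  moreover have "(1 - p) * m = (1 - p) * m * (1 - p)"
    by (simp add: left_diff_distrib right_diff_distrib pm mult.assoc pp)
  ultimately have 3: "positive (- ((1 - p) * b))"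
    using pos_conj_sa[OF mp, of "1 - p"] psa by (simp add: sa_intros sa_one)
  have "bicommutes b p" unfolding bicommutes_def using pc by blast
  then show ?thesis by (rule that[OF proj _ 2 3])
qed

section \<open>Projections, compressions and spectral projections in corners\<close>

lemma norm_projection_le: assumes "projection p" shows "norm (p::'b::cstar_algebra) \<le> 1"
proof -
  have "norm p = 0 \<or> norm p = 1"
    using cstar_identity[of p] assms by (simp add: projection_def power2_eq_square)
  then show ?thesis by linarith
qed

lemma norm_projection: "projection p \<Longrightarrow> p \<noteq> 0 \<Longrightarrow> norm (p::'b::cstar_algebra) = 1"
  using cstar_identity[of p] by (simp add: projection_def power2_eq_square)

lemma projection_sa: "projection p \<Longrightarrow> self_adjoint p"
  by (simp add: projection_def self_adjoint_def)

lemma projection_idem: "projection p \<Longrightarrow> p * p = p" by (simp add: projection_def)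

lemma projection_idem': "projection p \<Longrightarrow> p * (p * x) = p * (x::'b::{semigroup_mult,star})"
  by (simp add: projection_def mult.assoc[symmetric])

lemma projection_compl: "projection p \<Longrightarrow> projection (1 - p :: 'b::unital_cstar_algebra)"
  by (simp add: projection_def algebra_simps star_diff star_one)

lemma norm_mult_le: "norm x \<le> a \<Longrightarrow> norm y \<le> b \<Longrightarrow> norm (x * y :: 'b::real_normed_algebra) \<le> a * b"
  using norm_mult_ineq[of x y] mult_mono[of "norm x" a "norm y" b] norm_ge_zero[of x] norm_ge_zero[of y]
  by linarith

lemma norm_compress_le:
  assumes "projection p" "projection q" shows "norm (p * x * q) \<le> norm (x::'b::cstar_algebra)"
  using norm_mult_le[OF norm_mult_le[OF norm_projection_le[OF assms(1)] order_refl[of "norm x"]] norm_projection_le[OF assms(2)]]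
  by simp

text \<open>\<open>k\<close> is the inverse square root of \<open>r * h * r\<close> inside the
  corner of \<open>r\<close>. Filling the complementary corner with \<open>c\<close> makes the
  element invertible in the whole algebra, so root and inverse can be taken there and cut down by
  \<open>r\<close> afterwards.\<close>

lemma corner_inverse_sqrt:
  fixes h r :: "'b::unital_cstar_algebra"
  assumes r: "projection r" and h: "self_adjoint h" and positive: "positive (r * h * r - c *\<^sub>R r)" "c > 0"
  obtains k where "self_adjoint k" "k * r = k" "r * k = k" "k * (r * h * r) * k = r"
proof -
  let ?g = "r * h * r + c *\<^sub>R (1 - r)"
  have gc: "?g - c *\<^sub>R 1 = r * h * r - c *\<^sub>R r" by (simp add: scaleR_diff_right)
  have "invertible_el ?g" by (rule pos_plus_invertible[of _ c]) (simp_all only: gc positive)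
  then obtain w where w: "?g * w = 1" "w * ?g = 1" by (auto simp: invertible_el_def)
  have "positive (?g - c *\<^sub>R 1 + c *\<^sub>R 1)"
    by (rule pos_add) (simp_all only: gc positive pos_scaleR[OF pos_one] less_imp_le)
  then have "positive ?g" by simp
  then obtain m where m: "self_adjoint m" "m * m = ?g" "bicommutes ?g m" "positive m"
    by (rule pos_sqrtE)
  have "m * (m * w) = 1" "(w * m) * m = 1" using w unfolding m(2)[symmetric]
    by (simp_all only: mult.assoc)
  then have "invertible_el m" by (rule invertible_el_sides)
  then obtain n where n: "m * n = 1" "n * m = 1" by (auto simp: invertible_el_def)
  note rr = projection_idem[OF r] projection_idem'[OF r]
  have "?g * r = r * ?g" by (simp add: algebra_simps rr)
  then have "m * r = r * m" by (rule bicommutesD[OF m(3)])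
  then have nr: "n * r = r * n" by (rule inverse_commutes[OF n])
  have nr': "n * (r * x) = r * (n * x)" for x by (simp only: mult.assoc[symmetric] nr)
  have mr: "m * r = r * m" by fact
  have mr': "m * (r * x) = r * (m * x)" for x by (simp only: mult.assoc[symmetric] mr)
  have nm': "n * (m * x) = x" "m * (n * x) = x" for x by (simp_all add: n mult.assoc[symmetric])
  have sn: "self_adjoint n" by (rule sa_inverse[OF m(1) n])
  have gr: "r * h * r = ?g * r" by (simp add: algebra_simps rr)
  show ?thesis
  proof
    show "self_adjoint (n * r)" by (rule sa_mult[OF sn projection_sa[OF r] nr])
    show "n * r * r = n * r" "r * (n * r) = n * r" by (simp_all add: mult.assoc rr nr)
    have "n * r * (r * h * r) * (n * r) = n * r * (m * m * r) * (n * r)"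
      by (subst gr) (simp only: m(2))
    also have "\<dots> = r" by (simp add: mult.assoc nr nr' mr mr' n nm' rr)
    finally show "n * r * (r * h * r) * (n * r) = r" .
  qed
qed

text \<open>Brown and Pedersen's argument that real rank zero passes to corners: approximate
  \<open>z - (1 - p)\<close> by an invertible \<open>b\<close> and replace \<open>b\<close> by its Schur complement in the corner.\<close>

lemma schur_complement:
  fixes z p :: "'b::unital_cstar_algebra"
  assumes p: "projection p" and z: "self_adjoint z" "p * z = z" "z * p = z"
    and b: "self_adjoint b" "invertible_el b" "norm (z - (1 - p) - b) \<le> \<eta>" and \<eta>: "\<eta> \<le> 1/2"
  shows "\<exists>c. self_adjoint c \<and> p * c = c \<and> c * p = c \<and> invertible_el (c - (1 - p)) \<and> norm (z - c) \<le> 2 * \<eta>"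
proof -
  define q where "q = 1 - p"
  have q: "projection q" unfolding q_def by (rule projection_compl[OF p])
  note pp = projection_idem[OF p] projection_idem'[OF p]
  note qq = projection_idem[OF q] projection_idem'[OF q]
  have pq: "p * q = 0" "q * p = 0" by (simp_all add: q_def algebra_simps pp)
  have pq': "p * (q * x) = 0" "q * (p * x) = 0" for x by (simp_all add: pq mult.assoc[symmetric])
  have p1: "p = 1 - q" by (simp add: q_def)
  have qz: "q * z = 0" "z * q = 0" by (simp_all add: q_def algebra_simps z)
  have qz': "q * (z * x) = 0" for x by (simp add: qz mult.assoc[symmetric])
  define d where "d = z - q - b"
  have d: "norm d \<le> \<eta>" using b by (simp add: d_def q_def)
  have b_eq: "b = z - q - d" by (simp add: d_def)
  \<comment> \<open>The q-block of \<open>b\<close> is close to -q, because \<open>z\<close> lives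
    in the corner of \<open>p\<close>. Changing its sign and putting \<open>p\<close> into the other
    corner gives an element near 1; \<open>N\<close> below is the inverse of
    \<open>q * b * q\<close> within the corner of \<open>q\<close>.\<close>
  define X where "X = p - q * b * q"
  have "X = 1 + q * d * q"
    by (simp add: X_def b_eq p1 algebra_simps qq qz qz')
  then have X1: "norm (1 - X) \<le> 1/2"
    using norm_compress_le[OF q q, of d] d \<eta> by simp
  then have "invertible_el X" by (intro invertible_near_one) simp
  then obtain Y where Y: "X * Y = 1" "Y * X = 1" by (auto simp: invertible_el_def)
  have sX: "self_adjoint X" unfolding X_def by (intro sa_intros sa_conj projection_sa p q b)
  have sY: "self_adjoint Y" by (rule sa_inverse[OF sX Y])
  have Xq: "X * q = q * X" by (simp add: X_def algebra_simps pq qq pq')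
  have Yq: "Y * q = q * Y" by (rule inverse_commutes[OF Y Xq])
  have nY: "norm Y \<le> 2"
  proof -
    have "Y = 1 + (1 - X) * Y" by (simp add: left_diff_distrib Y)
    then have "norm Y \<le> norm (1::'b) + norm ((1 - X) * Y)" by (metis norm_triangle_ineq)
    also have "\<dots> \<le> 1 + (1/2) * norm Y"
      by (intro add_mono norm_one_le norm_mult_le X1) simp
    finally show ?thesis by simp
  qed
  define N where "N = - (Y * q)"
  have sN: "self_adjoint N" unfolding N_def by (intro sa_intros sa_mult sY projection_sa q Yq)
  have qN: "q * N = N" "N * q = N" by (simp_all add: N_def mult.assoc Yq qq)
  have qN': "q * (N * x) = N * x" "N * (q * x) = N * x" for x
    by (simp_all add: qN mult.assoc[symmetric])
  have pN: "p * N = 0" "N * p = 0" by (simp_all add: p1 algebra_simps qN)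
  have pN': "p * (N * x) = 0" "N * (p * x) = 0" for x by (simp_all add: pN mult.assoc[symmetric])
  have nN: "norm N \<le> 2"
    using norm_mult_le[OF nY norm_projection_le[OF q]] by (simp add: N_def)
  have "q * b * q = - (X * q)" "q * b * q = - (q * X)"
    by (simp_all add: X_def algebra_simps pq qq pq')
  then have Nb: "N * b * q = q" "q * b * N = q"
  proof -
    assume a: "q * b * q = - (X * q)" and b: "q * b * q = - (q * X)"
    have "N * b * q = - (Y * (q * b * q))" by (simp add: N_def mult.assoc)
    also have "\<dots> = (Y * X) * q" unfolding a by (simp add: mult.assoc)
    finally show "N * b * q = q" by (simp add: Y)
    have "q * b * N = - ((q * b * q) * Y)" by (simp add: N_def mult.assoc Yq)
    also have "\<dots> = q * (X * Y)" unfolding b by (simp add: mult.assoc)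
    finally show "q * b * N = q" by (simp add: Y)
  qed
  have Nbq': "N * (b * (q * x)) = q * x" for x
    using arg_cong[OF Nb(1), of "\<lambda>u. u * x"] by (simp only: mult.assoc)
  have qbN': "q * (b * (N * x)) = q * x" for x
    using arg_cong[OF Nb(2), of "\<lambda>u. u * x"] by (simp only: mult.assoc)
  have NbN: "N * (b * (N * x)) = N * x" for x
    using qbN'[of x] Nbq'[of "N * x"] by (simp add: qN')
  define c where "c = p * b * p - p * b * N * b * p"
  have sc: "self_adjoint c"
  proof -
    have "p * b * N * b * p = star (b * p) * N * (b * p)"
      using b(1) p by (simp add: star_mult self_adjoint_def projection_def mult.assoc)
    then have "self_adjoint (p * b * N * b * p)" by (simp only: sa_star_conj[OF sN])
    then show ?thesis using sa_conj[OF b(1) projection_sa[OF p]] by (simp add: c_def sa_intros)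
  qed
  have pc: "p * c = c" "c * p = c" by (simp_all add: c_def algebra_simps pp)
  have cN: "c * N = 0" by (simp add: c_def algebra_simps pN)
  have unip: "invertible_el (1 - n)" if "n * n = 0" for n :: 'b
    by (rule invertible_elI[of _ "1 + n"]) (simp_all add: algebra_simps that)
  \<comment> \<open>Block elimination: the two outer factors are unipotent and remove the
    off-diagonal blocks of \<open>b\<close>, leaving the Schur complement \<open>c\<close> and the
    block \<open>q * b * q\<close>.\<close>
  have "invertible_el ((1 - p * b * N) * b * (1 - N * b * p))"
    by (intro invertible_el_mult unip b) (simp_all add: mult.assoc pN' pN)
  also have "(1 - p * b * N) * b * (1 - N * b * p) = b - p * b * N * b - b * N * b * p + p * b * N * b * p"
    by (simp add: algebra_simps NbN)
  also have "\<dots> = c + q * b * q"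
  proof -
    let ?t = "b - p * b * N * b - b * N * b * p + p * b * N * b * p"
    have "?t = p * ?t * p + p * ?t * q + q * ?t * p + q * ?t * q"
      unfolding p1 by (simp add: algebra_simps)
    moreover have "p * ?t * p = c" by (simp add: c_def algebra_simps pp)
    moreover have "p * ?t * q = 0"
      using Nbq'[of 1] by (simp add: algebra_simps pp pq)
    moreover have "q * ?t * p = 0" by (simp add: algebra_simps pp pq pq' qbN')
    moreover have "q * ?t * q = q * b * q" by (simp add: algebra_simps pp pq pq')
    ultimately show ?thesis by simp
  qed
  finally have G: "invertible_el (c + q * b * q)" .
  have "invertible_el (p - N)"
  proof (rule invertible_elI)
    show "(p - N) * (p - q * b * q) = 1" using Nb(1) Nbq'[of 1]
      by (simp add: algebra_simps pp pq' pN qN' ) (simp add: p1)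
    show "(p - q * b * q) * (p - N) = 1" using Nb(2) qbN'[of 1]
      by (simp add: algebra_simps pp pq pN qN mult.assoc) (simp add: p1)
  qed
  with G have "invertible_el ((c + q * b * q) * (p - N))" by (rule invertible_el_mult)
  also have "(c + q * b * q) * (p - N) = c - q"
    using qbN'[of 1] by (simp add: algebra_simps pc cN pq qN)
  finally have inv: "invertible_el (c - q)" .
  \<comment> \<open>The first term has norm at most \<eta>; the second is a product of two
    off-diagonal blocks, each of norm at most \<eta>, with \<open>N\<close> between them. As \<eta>
    is at most 1/2, the sum \<eta> + 2\<eta>^2 is at most 2\<eta>.\<close>
  have "z - c = p * d * p + (p * b * q) * N * (q * b * p)"
    by (simp add: c_def b_eq algebra_simps z pq pp qN qN' pq' pN' pN)
  also have "p * b * q = - (p * d * q)" by (simp add: b_eq algebra_simps pq qz)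
  also have "q * b * p = - (q * d * p)" by (simp add: b_eq algebra_simps pq qz z)
  finally have "z - c = p * d * p + (p * d * q) * N * (q * d * p)" by simp
  then have "norm (z - c) \<le> norm (p * d * p) + norm ((p * d * q) * N * (q * d * p))"
    by (metis norm_triangle_ineq)
  also have "\<dots> \<le> \<eta> + (\<eta> * 2) * \<eta>"
    by (intro add_mono norm_mult_le nN order_trans[OF norm_compress_le d] p q)
  also have "\<dots> \<le> 2 * \<eta>"
  proof -
    have "0 \<le> \<eta>" using d norm_ge_zero[of d] by linarith
    then have "(\<eta> * 2) * \<eta> \<le> 1 * \<eta>" using \<eta> by (intro mult_right_mono) auto
    then show ?thesis by simp
  qed
  finally show ?thesis using sc pc inv unfolding q_def by blast
qed

text \<open>An approximate spectral projection of \<open>z\<close> for the positive half-line, taken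
  in the corner of \<open>p\<close>. The element approximated is z - (1 - p), so that the complement
  counts as negative and the sign projection falls inside the corner. The tolerance \<epsilon> pays
  for replacing \<open>z\<close> by an invertible approximant.\<close>

lemma corner_spectral_projection:
  fixes z p :: "'b::unital_cstar_algebra"
  assumes p: "projection p" and z: "self_adjoint z" "p * z = z" "z * p = z"
    and approx: "\<And>\<eta>. \<eta> > 0 \<Longrightarrow> \<exists>b. self_adjoint b \<and> invertible_el b \<and> norm (z - (1 - p) - b) \<le> \<eta>"
    and \<epsilon>: "\<epsilon> > 0"
  obtains r where "projection r" "p * r = r" "r * p = r" "positive (r * z * r + \<epsilon> *\<^sub>R r)"
    "positive (\<epsilon> *\<^sub>R (p - r) - (p - r) * z * (p - r))"
proof -
  let ?\<eta> = "min (\<epsilon> / 2) (1 / 2)"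
  obtain b where b: "self_adjoint b" "invertible_el b" "norm (z - (1 - p) - b) \<le> ?\<eta>"
    using approx[of ?\<eta>] \<epsilon> by auto
  obtain c where c: "self_adjoint c" "p * c = c" "c * p = c" "invertible_el (c - (1 - p))" and
    zc: "norm (z - c) \<le> 2 * ?\<eta>"
    using schur_complement[OF p z b min.cobounded2] by blast
  have zc: "norm (z - c) \<le> \<epsilon>" using zc by linarith
  define q where "q = 1 - p"
  have q: "projection q" unfolding q_def by (rule projection_compl[OF p])
  note pp = projection_idem[OF p] projection_idem'[OF p]
  note qq = projection_idem[OF q] projection_idem'[OF q]
  have qc: "q * c = 0" "c * q = 0" by (simp_all add: q_def algebra_simps c)
  have inv: "invertible_el (c - q)" and sc: "self_adjoint (c - q)"
    using c q by (simp_all add: q_def sa_intros projection_sa)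
  obtain r where r: "projection r" "bicommutes (c - q) r" "positive (r * (c - q))"
    "positive (- ((1 - r) * (c - q)))"
    by (rule sign_projection[OF sc inv])
  note rr = projection_idem[OF r(1)] projection_idem'[OF r(1)]
  have rq: "r * q = q * r" by (rule bicommutesD[OF r(2)]) (simp add: algebra_simps qc)
  have rcq: "r * (c - q) = (c - q) * r" by (rule bicommutesD[OF r(2)]) simp
  \<comment> \<open>Compressing the positive element \<open>r * (c - q)\<close> by \<open>q\<close>
    gives -qrq, so \<open>q * r * q\<close> is both positive and negative, and \<open>r\<close> lies
    under \<open>p\<close>.\<close>
  have "positive (q * r * q)" by (rule pos_conj_sa[OF projection_pos[OF r(1)] projection_sa[OF q]])
  moreover have "positive (q * (r * (c - q)) * q)"
    by (rule pos_conj_sa[OF r(3) projection_sa[OF q]])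
  then have "positive (- (q * r * q))" by (simp add: algebra_simps qc qq)
  ultimately have "q * r * q = 0" by (rule pos_antisym)
  then have rq0: "r * q = 0" "q * r = 0" using rq by (simp_all add: mult.assoc qq)
  have pr: "p * r = r" "r * p = r"
  proof -
    have "p = 1 - q" by (simp add: q_def)
    then show "p * r = r" "r * p = r"
      using rq0 by (simp_all only: left_diff_distrib right_diff_distrib mult_1_left mult_1_right diff_zero)
  qed
  have szc: "self_adjoint (z - c)" by (intro sa_intros z c)
  have p1: "positive (r * (\<epsilon> *\<^sub>R 1 + (z - c)) * r)"
    by (intro pos_conj_sa pos_norm_plus szc zc projection_sa r)
  have "r * (c - q) = r * c" by (simp add: algebra_simps rq0)
  moreover have "(c - q) * r = c * r" by (simp add: algebra_simps rq0)
  ultimately have "r * c = c * r" using rcq by simp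
  then have "r * c * r = r * (c - q)" by (simp add: algebra_simps rq0 mult.assoc rr)
  then have "positive (r * c * r)" using r(3) by simp
  from pos_add[OF p1 this] have 1: "positive (r * z * r + \<epsilon> *\<^sub>R r)"
    by (simp add: algebra_simps rr)
  let ?s = "p - r"
  have ss: "self_adjoint ?s" by (intro sa_intros projection_sa p r)
  have s2: "?s * ?s = ?s" by (simp add: algebra_simps pp pr rr)
  have "?s * (- ((1 - r) * (c - q))) * ?s = - (?s * c * ?s)"
  proof -
    have "?s * (1 - r) = ?s" by (simp add: algebra_simps pr rr)
    moreover have "(c - q) * ?s = c * ?s"
    proof -
      have "q * p = 0" by (simp add: q_def algebra_simps pp)
      then show ?thesis by (simp add: algebra_simps rq0)
    qed
    ultimately show ?thesis by (simp only: mult.assoc[symmetric] mult_minus_left mult_minus_right) (simp only: mult.assoc)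
  qed
  then have p3: "positive (- (?s * c * ?s))" using pos_conj_sa[OF r(4) ss] by simp
  have p2: "positive (?s * (\<epsilon> *\<^sub>R 1 - (z - c)) * ?s)"
    by (intro pos_conj_sa pos_norm_minus szc zc ss)
  have "?s * (\<epsilon> *\<^sub>R 1 - (z - c)) * ?s + - (?s * c * ?s) = \<epsilon> *\<^sub>R (?s * ?s) - ?s * z * ?s"
    by (simp add: left_diff_distrib right_diff_distrib scaleR_diff_right del: s2)
  then have 2: "positive (\<epsilon> *\<^sub>R ?s - ?s * z * ?s)" using pos_add[OF p2 p3]
    by (simp only: s2)
  show ?thesis by (rule that[OF r(1) pr 1 2])
qed

section \<open>The algebra inside its multiplier algebra\<close>

definition emb :: "'a::cstar_algebra \<Rightarrow> 'a multiplier" where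
  "emb a = mk_multiplier (Blinfun (\<lambda>b. a * b)) (Blinfun (\<lambda>b. b * a))"

lemma ml_emb: "ml (emb a) b = a * b" and mr_emb: "mr (emb a) b = b * a"
proof -
  have L: "blinfun_apply (Blinfun (\<lambda>b. a * b)) b = a * b" for b
    by (simp add: bounded_linear_Blinfun_apply bounded_linear_mult_right)
  have R: "blinfun_apply (Blinfun (\<lambda>b. b * a)) b = b * a" for b
    by (simp add: bounded_linear_Blinfun_apply bounded_linear_mult_left)
  have c: "blinfun_apply (Blinfun (\<lambda>b. b * a)) x * y = x * blinfun_apply (Blinfun (\<lambda>b. a * b)) y" for x y
    by (simp add: L R mult.assoc)
  show "ml (emb a) b = a * b" "mr (emb a) b = b * a"
    by (simp_all add: emb_def ml_mk[OF c] mr_mk[OF c] L R)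
qed

lemma ml_hom:
  "ml (0 :: 'a::cstar_algebra multiplier) a = 0" "ml (1 :: 'a multiplier) a = a"
  "ml (m + n) a = ml m a + ml n a" "ml (m - n) a = ml m a - ml n a"
  "ml (- m) a = - ml m a" "ml (r *\<^sub>R m) a = r *\<^sub>R ml m a" "ml (c *\<^sub>C m) a = c *\<^sub>C ml m a"
  "ml (m * n) a = ml m (ml n a)" "ml (star m) a = star (mr m (star a))"
  by (simp_all add: ml_simps blinfun.bilinear_simps scaleC_blinfun.rep_eq star_conj.rep_eq)

lemma multiplier_eq_if_ml:
  assumes "\<And>a. ml m a = ml n a" shows "m = n"
proof (rule multiplier_eqI)
  show "ml m = ml n" by (rule blinfun_eqI) (rule assms)
  show "mr m = mr n"
    by (rule blinfun_eqI, rule eq_if_mult_eq') (simp add: multiplier_centralizer assms)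
qed

lemma emb_hom:
  "emb 0 = 0" "emb (a + b) = emb a + emb b" "emb (a - b) = emb a - emb b" "emb (- a) = - emb a"
  "emb (r *\<^sub>R a) = r *\<^sub>R emb a" "emb (c *\<^sub>C a) = c *\<^sub>C emb a" "emb (a * b) = emb a * emb b"
  "emb (star a) = star (emb a)"
  by (rule multiplier_eq_if_ml,
      simp add: ml_emb mr_emb ml_hom algebra_simps mult_scaleC_left star_mult star_star)+

text \<open>Together with \<open>emb_mult\<close>, this makes the image of A an ideal. Hence a
  multiplier that is fixed on one side by an element of A lies in A, which is how projections and
  factors found among the multipliers are brought back to A.\<close>

lemma mult_emb: "m * emb a = emb (ml m a)"
proof (rule multiplier_eq_if_ml)
  fix b
  have "ml m (a * b) = ml m a * b"
    by (rule eq_if_mult_eq) (simp add: multiplier_centralizer[symmetric] mult.assoc[symmetric])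
  then show "ml (m * emb a) b = ml (emb (ml m a)) b" by (simp add: ml_emb ml_hom)
qed

lemma emb_mult: "emb a * m = emb (mr m a)"
  by (rule multiplier_eq_if_ml) (simp add: ml_emb ml_hom multiplier_centralizer)

lemma norm_emb: "norm (emb a) = norm a"
proof (rule antisym)
  show "norm (emb a) \<le> norm a"
    unfolding norm_multiplier_def
    by (rule norm_blinfun_bound) (simp_all add: ml_emb norm_mult_ineq)
  have "(norm a)\<^sup>2 = norm (ml (emb a) (star a))"
    using cstar_identity[of "star a"] by (simp add: ml_emb star_star norm_star)
  also have "\<dots> \<le> norm (emb a) * norm a"
    using norm_blinfun[of "ml (emb a)" "star a"] by (simp add: norm_multiplier_def norm_star)
  finally show "norm a \<le> norm (emb a)"
    by (cases "a = 0") (simp_all add: power2_eq_square)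
qed

lemma emb_inject: "emb a = emb b \<longleftrightarrow> a = b"
proof -
  have "norm (emb a - emb b) = norm (a - b)" by (simp only: emb_hom(3)[symmetric] norm_emb)
  then show ?thesis by auto
qed

lemma projection_emb: "projection (emb p) \<longleftrightarrow> projection p"
  by (simp add: projection_def emb_hom(7,8)[symmetric] emb_inject)

lemma sa_emb: "self_adjoint (emb p) \<longleftrightarrow> self_adjoint p"
  by (simp add: self_adjoint_def emb_hom(8)[symmetric] emb_inject)

section \<open>From the unitization to the multiplier algebra\<close>

lemma scaleC_diff_left: "(c - d) *\<^sub>C x = c *\<^sub>C x - d *\<^sub>C (x::'a::cstar_algebra)"
  using scaleC_add_left[of c "- d" x] by (simp add: scaleC_minus_left)

text \<open>A contractive unital homomorphism. It turns real rank zero and stable rank one, which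
  concern the unitization, into approximation statements among multipliers.\<close>

definition uz_mult :: "'a::cstar_algebra unitization \<Rightarrow> 'a multiplier" where
  "uz_mult x = emb (uz_alg x) + uz_scalar x *\<^sub>C 1"

lemma ml_uz_mult: "ml (uz_mult x) b = uz_act x b"
  by (simp add: uz_mult_def ml_hom ml_emb uz_act_def)

lemma norm_uz_mult_le: "norm (uz_mult x) \<le> norm x"
proof -
  have "norm (uz_mult x) \<le> onorm (uz_act x)"
    unfolding norm_multiplier_def
    by (rule norm_blinfun_bound)
       (use onorm[OF bounded_linear_uz_act, of x] onorm_pos_le[OF bounded_linear_uz_act, of x]
        in \<open>simp_all add: ml_uz_mult\<close>)
  then show ?thesis by (simp add: norm_unitization_def)
qed

lemma uz_mult_hom:
  "uz_mult (x * y) = uz_mult x * uz_mult y" "uz_mult 1 = 1" "uz_mult (x - y) = uz_mult x - uz_mult y"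
  "uz_mult (star x) = star (uz_mult x)"
proof -
  show "uz_mult (x * y) = uz_mult x * uz_mult y"
    by (rule multiplier_eq_if_ml) (simp add: ml_hom ml_uz_mult uz_act_mult)
  show "uz_mult 1 = 1"
    by (simp add: uz_mult_def unitization_defs emb_hom scaleC_one)
  show "uz_mult (x - y) = uz_mult x - uz_mult y"
    by (rule multiplier_eq_if_ml)
       (simp add: ml_hom ml_uz_mult uz_act_def unitization_defs algebra_simps scaleC_diff_left)
  show "uz_mult (star x) = star (uz_mult x)"
    by (simp add: uz_mult_def unitization_defs emb_hom star_add star_scaleC star_one)
qed

lemma uz_mult_invertible:
  assumes "x \<in> invertible_elements" shows "invertible_el (uz_mult x)"
proof -
  obtain y where "x * y = 1" "y * x = 1" using assms by (auto simp: invertible_elements_def)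
  then show ?thesis
    by (intro invertible_elI[of _ "uz_mult y"]) (simp_all add: uz_mult_hom(2) flip: uz_mult_hom(1))
qed

lemma real_rank_zero_approx:
  fixes a :: "'a::cstar_algebra"
  assumes "nonunital_real_rank_zero TYPE('a)" "self_adjoint a" "e > 0"
  shows "\<exists>b. self_adjoint b \<and> invertible_el b \<and> norm (emb a + t *\<^sub>R 1 - b) \<le> e"
proof -
  let ?x = "Unitization a (complex_of_real t)"
  have "?x \<in> self_adjoint_elements"
    using assms(2) by (simp add: self_adjoint_elements_def star_unitization_def self_adjoint_def)
  then have "?x \<in> closure (self_adjoint_elements \<inter> invertible_elements)"
    using assms(1) by (auto simp: nonunital_real_rank_zero_def real_rank_zero_def)
  then obtain y where y: "y \<in> self_adjoint_elements" "y \<in> invertible_elements" "dist y ?x < e"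
    using assms(3) unfolding closure_approachable by blast
  have "self_adjoint (uz_mult y)"
    using y(1) by (simp add: self_adjoint_def uz_mult_hom(4)[symmetric] self_adjoint_elements_def)
  moreover have "norm (uz_mult (?x - y)) \<le> e"
    using norm_uz_mult_le[of "?x - y"] y(3) by (simp add: dist_norm norm_minus_commute)
  then have "norm (emb a + t *\<^sub>R 1 - uz_mult y) \<le> e"
    by (simp add: uz_mult_hom) (simp add: uz_mult_def scaleC_of_real)
  ultimately show ?thesis using uz_mult_invertible[OF y(2)] by blast
qed

text \<open>This is the approximation hypothesis of \<open>corner_spectral_projection\<close> for h
  - tp: the term -(1 - p) is the scalar -1 modulo A, so the element comes from the
  unitization.\<close>

lemma corner_real_rank_zero_approx:
  fixes h p :: "'a::cstar_algebra"
  assumes rr0: "nonunital_real_rank_zero TYPE('a)" and p: "projection p" and h: "self_adjoint h"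
    and "\<eta> > 0"
  shows "\<exists>b. self_adjoint b \<and> invertible_el b \<and>
    norm (emb h - t *\<^sub>R emb p - (1 - emb p) - b) \<le> \<eta>"
proof -
  have eq: "emb h - t *\<^sub>R emb p - (1 - emb p) = emb (h - t *\<^sub>R p + p) + (- 1) *\<^sub>R 1"
    by (simp add: emb_hom algebra_simps)
  have "star p = p" using p by (simp add: projection_def)
  then have "self_adjoint (h - t *\<^sub>R p + p)" using h by (intro sa_intros) (simp_all add: self_adjoint_def)
  then show ?thesis unfolding eq by (rule real_rank_zero_approx[OF rr0 _ \<open>\<eta> > 0\<close>])
qed

lemma stable_rank_one_approx:
  fixes a :: "'a::cstar_algebra"
  assumes "nonunital_stable_rank_one TYPE('a)" "e > 0"
  shows "\<exists>b. invertible_el b \<and> norm (emb a + 1 - b) \<le> e"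
proof -
  let ?x = "Unitization a 1"
  have "?x \<in> closure invertible_elements"
    using assms(1) by (auto simp: nonunital_stable_rank_one_def stable_rank_one_def)
  then obtain y where y: "y \<in> invertible_elements" "dist y ?x < e"
    using assms(2) unfolding closure_approachable by blast
  have "norm (uz_mult (?x - y)) \<le> e"
    using norm_uz_mult_le[of "?x - y"] y(2) by (simp add: dist_norm norm_minus_commute)
  then have "norm (emb a + 1 - uz_mult y) \<le> e"
    by (simp add: uz_mult_hom) (simp add: uz_mult_def scaleC_one)
  then show ?thesis using uz_mult_invertible[OF y(1)] by blast
qed

section \<open>Projections\<close>

lemma norm_mono_pos:
  fixes a b :: "'b::unital_cstar_algebra"
  assumes "positive a" "positive (b - a)" shows "norm a \<le> norm b"
proof -
  have "positive (b - a + a)" by (rule pos_add[OF assms(2,1)])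
  then have "self_adjoint b" using pos_sa[of b] by simp
  from pos_add[OF pos_norm_minus[OF this order_refl] assms(2)]
  have "positive (norm b *\<^sub>R 1 - a)" by simp
  then show ?thesis using assms(1) by (intro norm_le_if_pos) auto
qed

text \<open>\<open>?A\<close> has the right inverse \<open>?B\<close>. By stable rank one
  \<open>?B\<close> is close to an invertible \<open>y\<close>, so \<open>?A * y\<close> is close to
  1 and hence invertible; then \<open>?A\<close> is invertible and \<open>?B\<close> is its
  two-sided inverse.\<close>

lemma finite_projection:
  fixes e u v :: "'a::cstar_algebra"
  assumes sr1: "nonunital_stable_rank_one TYPE('a)"
    and e: "projection e" and uv: "u * v = e" and u: "e * u = u" "u * e = u" and v: "e * v = v" "v * e = v"
  shows "v * u = e"
proof -
  let ?A = "emb u + (1 - emb e)" and ?B = "emb v + (1 - emb e)"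
  note h = emb_hom(7)[symmetric]
  have AB: "?A * ?B = 1"
    by (simp add: algebra_simps h uv u v projection_idem[OF e])
  define t where "t = 1 / (2 * (norm ?A + 1))"
  have n0: "norm ?A + 1 > 0" using norm_ge_zero[of ?A] by linarith
  have t: "t > 0" using n0 by (simp add: t_def)
  obtain y where y: "invertible_el y" "norm (emb (v - e) + 1 - y) \<le> t"
    using stable_rank_one_approx[OF sr1 t] by blast
  have "norm (?B - y) \<le> t" using y(2) by (simp add: emb_hom algebra_simps)
  have "1 - ?A * y = ?A * (?B - y)" by (simp only: right_diff_distrib AB)
  also have "norm \<dots> \<le> norm ?A * t" by (rule norm_mult_le[OF order_refl]) fact
  also have "\<dots> < 1"
  proof -
    have "norm ?A * t \<le> (norm ?A + 1) * t" using t by (intro mult_right_mono) auto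
    also have "\<dots> = 1/2" using n0 by (simp add: t_def)
    finally show ?thesis by simp
  qed
  finally have "invertible_el (?A * y)" by (rule invertible_near_one)
  then obtain w where w: "?A * y * w = 1" "w * (?A * y) = 1" by (auto simp: invertible_el_def)
  obtain y' where y': "y * y' = 1" "y' * y = 1" using y(1) by (auto simp: invertible_el_def)
  have "(y * w) * ?A = (y * w) * (?A * y) * y'" by (simp add: mult.assoc y'(1))
  also have "\<dots> = y * (w * (?A * y)) * y'" by (simp only: mult.assoc)
  also have "\<dots> = 1" by (simp add: w y')
  finally have "(y * w) * ?A = 1" .
  with AB have "y * w = ?B" by (rule inverse_unique_monoid[rotated])
  with \<open>(y * w) * ?A = 1\<close> have "?B * ?A = 1" by simp
  then have "emb (v * u) + (1 - emb e) = 1"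
    by (simp add: algebra_simps h u v projection_idem[OF e])
  then show ?thesis by (simp add: emb_inject)
qed

text \<open>The part of \<open>x\<close> that \<open>q\<close> misses is measured by
  \<open>y\<close>; to \<open>q\<close> one adjoins an approximate spectral projection
  \<open>r\<close> of \<open>y\<close> above the threshold \<delta>. Outside q + r the remainder has
  squared norm at most 3\<delta>/2, which is below \<epsilon>^2 for \<delta> =
  \<epsilon>^2/2.\<close>

lemma exists_projection_above:
  fixes q x :: "'a::cstar_algebra"
  assumes rr0: "nonunital_real_rank_zero TYPE('a)" and q: "projection q" and \<epsilon>: "\<epsilon> > 0"
  shows "\<exists>p. projection p \<and> p * q = q \<and> q * p = q \<and> norm (x - p * x) \<le> \<epsilon>"
proof -
  define P where "P = 1 - emb q"
  have P: "projection P" unfolding P_def by (intro projection_compl) (simp add: projection_emb q)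
  define y where "y = (x - q * x) * star (x - q * x)"
  define \<delta> where "\<delta> = \<epsilon>\<^sup>2 / 2"
  have \<delta>: "\<delta> > 0" using \<epsilon> by (simp add: \<delta>_def)
  have sy: "self_adjoint y" by (simp add: y_def sa_mult_star)
  have qq: "q * q = q" "star q = q" using q by (simp_all add: projection_def)
  have qq': "q * (q * x) = q * x" for x by (simp add: qq mult.assoc[symmetric])
  have qy: "q * y = 0" "y * q = 0"
    by (simp_all add: y_def star_diff star_mult algebra_simps qq qq')
  define z where "z = emb y - \<delta> *\<^sub>R P"
  have zz: "self_adjoint z"
    unfolding z_def by (intro sa_intros projection_sa[OF P]) (simp add: sa_emb sy)
  have PP: "P * P = P" by (rule projection_idem[OF P])
  have Py: "P * emb y = emb y" "emb y * P = emb y"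
    by (simp_all add: P_def algebra_simps emb_hom(7)[symmetric] qy emb_hom(1))
  have Pz: "P * z = z" "z * P = z" by (simp_all add: z_def algebra_simps PP Py)
  have approx: "\<exists>b. self_adjoint b \<and> invertible_el b \<and> norm (z - (1 - P) - b) \<le> \<eta>" if "\<eta> > 0" for \<eta>
  proof -
    have "z - (1 - P) = emb (y + \<delta> *\<^sub>R q - q) + (-\<delta>) *\<^sub>R 1"
      by (simp add: z_def P_def emb_hom algebra_simps)
    moreover have "self_adjoint (y + \<delta> *\<^sub>R q - q)"
      by (intro sa_intros sy projection_sa q)
    ultimately show ?thesis using real_rank_zero_approx[OF rr0 _ that, of "y + \<delta> *\<^sub>R q - q" "- \<delta>"]
      by simp
  qed
  have d2: "\<delta> / 2 > 0" using \<delta> by simp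
  obtain R where R: "projection R" "P * R = R" "R * P = R" "positive (R * z * R + (\<delta> / 2) *\<^sub>R R)"
    "positive ((\<delta> / 2) *\<^sub>R (P - R) - (P - R) * z * (P - R))"
    by (rule corner_spectral_projection[OF P zz Pz approx d2])
  have RR: "R * R = R" by (rule projection_idem[OF R(1)])
  have "R * z * R = R * emb y * R - \<delta> *\<^sub>R R"
    by (simp add: z_def algebra_simps RR R)
  moreover have "\<delta> *\<^sub>R R = (\<delta> / 2) *\<^sub>R R + (\<delta> / 2) *\<^sub>R R"
    by (simp flip: scaleR_left_distrib)
  ultimately have "R * z * R + (\<delta> / 2) *\<^sub>R R = R * emb y * R - (\<delta> / 2) *\<^sub>R R"
    by (simp only:) simp
  with R(4) have Ry: "positive (R * emb y * R - (\<delta> / 2) *\<^sub>R R)" by simp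
  have "self_adjoint (emb y)" by (simp add: sa_emb sy)
  from corner_inverse_sqrt[OF R(1) this Ry d2] obtain k
    where k: "self_adjoint k" "k * R = k" "R * k = k" "k * (R * emb y * R) * k = R" by blast
  \<comment> \<open>\<open>P\<close> does not come from A, so membership of \<open>R\<close> in A
    needs an argument: \<open>emb y\<close> is bounded below on \<open>R\<close>, which makes
    \<open>R\<close> a product with \<open>emb y\<close> as a factor.\<close>
  have "R = (k * R) * emb y * (R * k)" using k(4) by (simp add: mult.assoc)
  also have "\<dots> = emb (mr (R * k) (ml (k * R) y))" by (simp add: mult_emb emb_mult)
  finally obtain r where r: "R = emb r" by blast
  have pr: "projection r" using R(1) by (simp add: r projection_emb)
  have "emb (q * r) = 0" "emb (r * q) = 0"
    using R(2,3) by (simp_all add: P_def r algebra_simps emb_hom)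
  then have qr: "q * r = 0" "r * q = 0" by (simp_all add: emb_inject flip: emb_hom(1))
  define S where "S = P - R"
  have S: "projection S"
    using R P by (simp add: S_def algebra_simps PP RR star_diff projection_def)
  have SS: "S * S = S" by (rule projection_idem[OF S])
  have SP: "S * P = S" "P * S = S" by (simp_all add: S_def algebra_simps PP R)
  have Sz: "S * z * S = S * emb y * S - \<delta> *\<^sub>R S"
    by (simp add: z_def algebra_simps SP SS)
  have "(\<delta> / 2) *\<^sub>R S + \<delta> *\<^sub>R S - S * emb y * S = (\<delta> / 2) *\<^sub>R S - S * z * S"
    unfolding Sz by simp
  then have "positive ((\<delta> / 2) *\<^sub>R S + \<delta> *\<^sub>R S - S * emb y * S)"
    using R(5) by (simp only: S_def[symmetric])
  moreover have "positive ((\<delta> / 2 + \<delta>) *\<^sub>R (1 - S))"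
    by (intro pos_scaleR projection_pos projection_compl S) (use \<delta> in simp)
  ultimately have "positive ((\<delta> / 2) *\<^sub>R S + \<delta> *\<^sub>R S - S * emb y * S + (\<delta> / 2 + \<delta>) *\<^sub>R (1 - S))"
    by (rule pos_add)
  also have "(\<delta> / 2) *\<^sub>R S + \<delta> *\<^sub>R S - S * emb y * S + (\<delta> / 2 + \<delta>) *\<^sub>R (1 - S) =
     (\<delta> / 2 + \<delta>) *\<^sub>R 1 - S * emb y * S"
    by (simp add: scaleR_diff_right flip: scaleR_left_distrib)
  also have "S * emb y * S = star (star (emb (x - q * x)) * S) * (star (emb (x - q * x)) * S)"
    using S by (simp add: y_def emb_hom(7,8) star_mult star_star projection_def mult.assoc)
  finally have "(norm (star (emb (x - q * x)) * S))\<^sup>2 \<le> \<delta> / 2 + \<delta>"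
    using \<delta> by (intro norm_power2_le_if_pos) auto
  moreover have "norm (star (emb (x - q * x)) * S) = norm (S * emb (x - q * x))"
    using norm_star[of "S * emb (x - q * x)"] S by (simp add: star_mult projection_def)
  moreover have "S * emb (x - q * x) = emb (x - (q + r) * x)"
    by (simp add: S_def P_def r left_diff_distrib emb_hom(7)[symmetric] emb_hom(3)[symmetric] right_diff_distrib qq' mult.assoc[symmetric] qr distrib_right)
       (simp add: algebra_simps emb_hom qq')
  ultimately have "(norm (x - (q + r) * x))\<^sup>2 \<le> \<epsilon>\<^sup>2"
  proof -
    assume "(norm (star (emb (x - q * x)) * S))\<^sup>2 \<le> \<delta> / 2 + \<delta>"
      "norm (star (emb (x - q * x)) * S) = norm (S * emb (x - q * x))"
      "S * emb (x - q * x) = emb (x - (q + r) * x)"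
    then have "(norm (x - (q + r) * x))\<^sup>2 \<le> \<delta> / 2 + \<delta>"
      by (simp only: norm_emb)
    also have "\<delta> / 2 + \<delta> \<le> \<epsilon>\<^sup>2" by (simp add: \<delta>_def)
    finally show ?thesis .
  qed
  then have "norm (x - (q + r) * x) \<le> \<epsilon>"
    using \<epsilon> by (simp add: power2_le_iff_abs_le)
  moreover have "projection (q + r)"
    using pr q qr by (simp add: projection_def distrib_left distrib_right star_add)
  moreover have "(q + r) * q = q" "q * (q + r) = q"
    by (simp_all add: distrib_left distrib_right qq qr)
  ultimately show ?thesis by blast
qed

text \<open>\<open>r\<close> is an approximate spectral projection of \<open>star x * x\<close>
  above the level \<open>c\<close>, so \<open>x\<close> stretches its range by at least sqrt c. With
  \<open>k\<close> the inverse square root of \<open>star x * x\<close> compressed to that range,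
  \<open>x * k\<close> is a partial isometry with initial projection \<open>r\<close>.\<close>

lemma ex_spectral_projection_below:
  fixes x s :: "'a::cstar_algebra"
  assumes rr0: "nonunital_real_rank_zero TYPE('a)" and s: "projection s" and x: "x * s = x"
    and c: "0 < c" "c < (norm x)\<^sup>2"
  obtains r k where "projection r" "r \<noteq> 0" "s * r = r" "r * s = r"
    "\<forall>y. c * (norm (r * y))\<^sup>2 \<le> (norm (x * r * y))\<^sup>2"
    "star (x * k) * (x * k) = r" "k * r = k"
proof -
  define P where "P = emb s"
  have P: "projection P" by (simp add: P_def projection_emb s)
  have PP: "P * P = P" by (rule projection_idem[OF P])
  define h where "h = star x * x"
  have sh: "self_adjoint h" by (simp add: h_def sa_star_mult)
  have sx: "s * star x = star x"
    using arg_cong[OF x, of star] s by (simp add: star_mult projection_def)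
  have hs: "h * s = h" "s * h = h"
    by (simp_all add: h_def mult.assoc x) (simp add: mult.assoc[symmetric] sx)
  \<comment> \<open>The cut lies halfway between \<open>c\<close> and the squared norm of
    \<open>x\<close>, and the tolerance is a quarter of the gap: t - \<delta> is still at least
    \<open>c\<close>, and t + \<delta> is still below the squared norm, which forces
    \<open>r\<close> to be nonzero.\<close>
  define t where "t = (c + (norm x)\<^sup>2) / 2"
  define \<delta> where "\<delta> = ((norm x)\<^sup>2 - c) / 4"
  have \<delta>: "\<delta> > 0" "t - \<delta> \<ge> c" "t + \<delta> < (norm x)\<^sup>2" "t > 0"
    using c by (simp_all add: \<delta>_def t_def field_simps)
  define z where "z = emb h - t *\<^sub>R P"
  have zz: "self_adjoint z"
    unfolding z_def by (intro sa_intros projection_sa[OF P]) (simp add: sa_emb sh)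
  have hP: "P * emb h = emb h" "emb h * P = emb h" by (simp_all add: P_def hs flip: emb_hom(7))
  have Pz: "P * z = z" "z * P = z" by (simp_all add: z_def algebra_simps PP hP)
  note approx = corner_real_rank_zero_approx[OF rr0 s sh, of _ t, folded P_def, folded z_def]
  obtain R where R: "projection R" "P * R = R" "R * P = R" "positive (R * z * R + \<delta> *\<^sub>R R)"
    "positive (\<delta> *\<^sub>R (P - R) - (P - R) * z * (P - R))"
    by (rule corner_spectral_projection[OF P zz Pz approx \<delta>(1)])
  have RR: "R * R = R" by (rule projection_idem[OF R(1)])
  have "R = emb (ml R s)" using R(3) by (simp add: P_def mult_emb)
  then obtain r where r: "R = emb r" by blast
  have pr: "projection r" using R(1) by (simp add: r projection_emb)
  have sr: "s * r = r" "r * s = r" using R(2,3)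
    by (simp_all add: P_def r emb_inject flip: emb_hom(7))
  have "R * z * R = R * emb h * R - t *\<^sub>R R" by (simp add: z_def algebra_simps RR R)
  then have "R * z * R + \<delta> *\<^sub>R R + (t - \<delta> - c) *\<^sub>R R = R * emb h * R - c *\<^sub>R R"
    by (simp add: algebra_simps)
  moreover have "positive (R * z * R + \<delta> *\<^sub>R R + (t - \<delta> - c) *\<^sub>R R)"
    using \<delta>(2) by (intro pos_add pos_scaleR projection_pos R) auto
  ultimately have Rh: "positive (R * emb h * R - c *\<^sub>R R)" by simp
  have r0: "r \<noteq> 0"
  proof
    assume "r = 0"
    then have "R = 0" by (simp add: r emb_hom)
    with R(5) have "positive (\<delta> *\<^sub>R P - z)" by (simp add: Pz)
    moreover have "positive ((t + \<delta>) *\<^sub>R (1 - P))"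
      using \<delta> by (intro pos_scaleR projection_pos projection_compl P) simp
    ultimately have "positive (\<delta> *\<^sub>R P - z + (t + \<delta>) *\<^sub>R (1 - P))"
      by (rule pos_add)
    also have "\<delta> *\<^sub>R P - z + (t + \<delta>) *\<^sub>R (1 - P) = (t + \<delta>) *\<^sub>R 1 - star (emb x) * emb x"
      by (simp add: z_def algebra_simps h_def emb_hom)
    finally have "(norm (emb x))\<^sup>2 \<le> t + \<delta>"
      using \<delta> by (intro norm_power2_le_if_pos) auto
    with \<delta>(3) show False by (simp add: norm_emb)
  qed
  have "self_adjoint (emb h)" by (simp add: sa_emb sh)
  from corner_inverse_sqrt[OF R(1) this Rh c(1)] obtain K
    where K: "self_adjoint K" "K * R = K" "R * K = K" "K * (R * emb h * R) * K = R" by blast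
  define k where "k = ml K r"
  have k: "K = emb k" using K(2) by (simp add: k_def r mult_emb)
  have xr: "c * (norm (r * y))\<^sup>2 \<le> (norm (x * r * y))\<^sup>2" for y
  proof -
    have "positive (star (emb y) * (R * emb h * R - c *\<^sub>R R) * emb y)"
      by (rule pos_conj[OF Rh])
    also have "star (emb y) * (R * emb h * R - c *\<^sub>R R) * emb y =
      emb (star (x * r * y) * (x * r * y)) - emb (c *\<^sub>R (star (r * y) * (r * y)))"
    proof -
      have rr: "r * (r * y) = r * y" "star r = r"
        using pr by (simp_all add: projection_def flip: mult.assoc)
      have "star (x * r * y) * (x * r * y) = star y * (r * h * r) * y"
        by (simp add: h_def star_mult rr mult.assoc)
      moreover have "star (r * y) * (r * y) = star y * r * y" by (simp add: star_mult rr mult.assoc)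
      ultimately show ?thesis
        by (simp add: r left_diff_distrib right_diff_distrib emb_hom)
    qed
    finally have 1: "positive (emb (star (x * r * y) * (x * r * y)) - emb (c *\<^sub>R (star (r * y) * (r * y))))" .
    have "positive (c *\<^sub>R (star (emb (r * y)) * emb (r * y)))"
      using c by (intro pos_scaleR pos_star_mult) simp
    then have "positive (emb (c *\<^sub>R (star (r * y) * (r * y))))" by (simp add: emb_hom)
    from norm_mono_pos[OF this 1] have "norm (c *\<^sub>R (star (r * y) * (r * y))) \<le> norm (star (x * r * y) * (x * r * y))"
      by (simp only: norm_emb)
    then show ?thesis using c by (simp add: cstar_identity)
  qed
  have kr: "k * r = k" "r * k = k" using K(2,3) by (simp_all add: k r emb_inject flip: emb_hom(7))
  have "emb (star (x * k) * (x * k)) = K * (emb h) * K"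
    using K(1) by (simp add: emb_hom h_def star_mult self_adjoint_def k mult.assoc)
  also have "\<dots> = (K * R) * emb h * (R * K)" by (simp add: K)
  also have "\<dots> = emb r" using K(4) by (simp add: mult.assoc r)
  finally have v: "star (x * k) * (x * k) = r" by (simp add: emb_inject)
  show ?thesis by (rule that[OF pr r0 sr _ v kr(1)]) (intro allI xr)
qed

text \<open>The elements \<open>b\<close> with xAb = 0 form a closed two-sided ideal containing
  \<open>y\<close>, hence all of A; taking \<open>x\<close> for \<open>b\<close> makes
  \<open>x * star x * x\<close> vanish.\<close>

lemma simple_prime:
  fixes x y :: "'a::cstar_algebra"
  assumes simple: "simple TYPE('a)" and xy: "x \<noteq> 0" "y \<noteq> 0"
  shows "\<exists>a. x * a * y \<noteq> 0"
proof (rule ccontr)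
  assume "\<not> ?thesis"
  then have z: "x * a * y = 0" for a by blast
  let ?I = "{b. \<forall>a. x * a * b = 0}"
  have "two_sided_ideal ?I"
    unfolding two_sided_ideal_def
  proof (intro conjI ballI allI)
    fix b c assume b: "b \<in> ?I"
    have "x * a * (c * b) = x * (a * c) * b" for a by (simp only: mult.assoc)
    then show "c * b \<in> ?I" using b by simp
    have "x * a * (b * c) = x * a * b * c" for a by (simp only: mult.assoc)
    then show "b * c \<in> ?I" using b by simp
  qed (auto simp: distrib_left mult_scaleC_right scaleC_zero_right)
  moreover have "closed ?I"
  proof -
    have "?I = (\<Inter>a. {b. x * a * b = 0})" by auto
    moreover have "closed {b. x * a * b = 0}" for a
      by (intro closed_Collect_eq continuous_intros)
    ultimately show ?thesis by auto
  qed
  ultimately have "?I = {0} \<or> ?I = UNIV" using simple by (simp add: simple_def)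
  moreover have "y \<in> ?I" using z by simp
  ultimately have "?I = UNIV" using xy by auto
  then have "x \<in> ?I" by simp
  then have "x * star x * x = 0" by simp
  then have "(star x * x) * (star x * x) = 0" by (simp add: mult.assoc)
  then have "norm (star (star x * x) * (star x * x)) = 0" by (simp add: star_mult star_star)
  then show False using xy by (simp add: cstar_identity)
qed

section \<open>Corners of minimal projections\<close>

lemma norm_le_if_pos_bounds:
  fixes w :: "'b::unital_cstar_algebra"
  assumes "positive (s *\<^sub>R 1 - w)" "positive (s *\<^sub>R 1 + w)" "s \<ge> 0"
  shows "norm w \<le> 3 * s"
proof -
  have "(2 * s) *\<^sub>R 1 - (s *\<^sub>R 1 + w) = s *\<^sub>R 1 - w"
    by (simp only: mult_2 scaleR_left_distrib) simp
  then have "positive ((2 * s) *\<^sub>R 1 - (s *\<^sub>R 1 + w))" using assms(1) by (simp only:)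
  then have "norm (s *\<^sub>R 1 + w) \<le> 2 * s"
    by (rule norm_le_if_pos[OF assms(2)]) (use assms(3) in simp)
  moreover have "norm w \<le> norm (s *\<^sub>R 1 + w) + norm (s *\<^sub>R (1::'b))"
    using norm_triangle_ineq4[of "s *\<^sub>R 1 + w" "s *\<^sub>R 1"] by (simp only: add_diff_cancel_left')
  moreover have "norm (s *\<^sub>R (1::'b)) \<le> s" using norm_scaleR_one_le[of s] assms(3)
    by (metis abs_of_nonneg)
  ultimately show ?thesis by linarith
qed

text \<open>By minimality the approximate spectral projection of z - tp is 0 or p, so every real
  \<open>t\<close> is a lower or an upper bound of \<open>z\<close> up to \<epsilon>. The scalar is
  the supremum of the lower bounds.\<close>

lemma minimal_projection_sa_scalar:
  fixes z p :: "'a::cstar_algebra"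
  assumes rr0: "nonunital_real_rank_zero TYPE('a)" and p: "projection p"
    and min: "\<And>r. projection r \<Longrightarrow> p * r = r \<Longrightarrow> r * p = r \<Longrightarrow> r = 0 \<or> r = p"
    and z: "self_adjoint z" "p * z = z" "z * p = z"
  shows "\<exists>t. z = t *\<^sub>R p"
proof -
  define P where "P = emb p"
  define Z where "Z = emb z"
  have P: "projection P" by (simp add: P_def projection_emb p)
  have PP: "P * P = P" by (rule projection_idem[OF P])
  have ZP: "P * Z = Z" "Z * P = Z" by (simp_all add: P_def Z_def z flip: emb_hom(7))
  have sZ: "self_adjoint Z" by (simp add: Z_def sa_emb z)
  have dich: "positive (Z - t *\<^sub>R P + \<epsilon> *\<^sub>R P) \<or> positive (\<epsilon> *\<^sub>R P - (Z - t *\<^sub>R P))" if e: "\<epsilon> > 0" for t \<epsilon>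
  proof -
    define w where "w = Z - t *\<^sub>R P"
    have sw: "self_adjoint w" unfolding w_def by (intro sa_intros sZ projection_sa P)
    have Pw: "P * w = w" "w * P = w" by (simp_all add: w_def algebra_simps PP ZP)
    note approx = corner_real_rank_zero_approx[OF rr0 p z(1), of _ t, folded P_def Z_def, folded w_def]
    obtain R where R: "projection R" "P * R = R" "R * P = R" "positive (R * w * R + \<epsilon> *\<^sub>R R)"
      "positive (\<epsilon> *\<^sub>R (P - R) - (P - R) * w * (P - R))"
      by (rule corner_spectral_projection[OF P sw Pw approx e])
    have "R = emb (ml R p)" using R(3) by (simp add: P_def mult_emb)
    then obtain r where r: "R = emb r" by blast
    have "projection r" using R(1) by (simp add: r projection_emb)
    moreover have "p * r = r" "r * p = r" using R(2,3)
      by (simp_all add: P_def r emb_inject flip: emb_hom(7))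
    ultimately have "r = 0 \<or> r = p" by (rule min)
    then have "R = 0 \<or> R = P" by (auto simp: r P_def emb_hom)
    then show ?thesis using R(4,5) by (auto simp: Pw PP w_def[symmetric])
  qed
  define L where "L = {t. \<forall>\<epsilon>>0. positive (Z - t *\<^sub>R P + \<epsilon> *\<^sub>R P)}"
  show ?thesis
  proof (cases "p = 0")
    case True then show ?thesis using z by auto
  next
    case False
    then have P0: "P \<noteq> 0" by (simp add: P_def emb_inject flip: emb_hom(1))
    define N where "N = norm Z"
    have sP: "self_adjoint P" by (rule projection_sa[OF P])
    have ZN: "positive (N *\<^sub>R P - Z)" "positive (N *\<^sub>R P + Z)"
      using pos_conj_sa[OF pos_norm_minus[OF sZ order_refl] sP] pos_conj_sa[OF pos_norm_plus[OF sZ order_refl] sP]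
      by (simp_all add: N_def algebra_simps PP ZP)
    have "- N \<in> L"
      using pos_add[OF ZN(2) pos_scaleR[OF projection_pos[OF P]]]
      by (simp add: L_def algebra_simps less_imp_le)
    have posP: "s \<ge> 0" if "positive (s *\<^sub>R P)" for s
    proof (rule ccontr)
      assume "\<not> s \<ge> 0"
      then have "positive (- (s *\<^sub>R P))" using pos_scaleR[OF projection_pos[OF P], of "- s"]
        by simp
      with that have "s *\<^sub>R P = 0" by (rule pos_antisym)
      with P0 \<open>\<not> s \<ge> 0\<close> show False by simp
    qed
    have bdd: "t \<le> N" if "t \<in> L" for t
    proof (rule field_le_epsilon)
      fix e :: real assume "e > 0"
      then have "positive (Z - t *\<^sub>R P + e *\<^sub>R P)" using that by (simp add: L_def)
      from pos_add[OF this ZN(1)] have "positive ((N + e - t) *\<^sub>R P)"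
        by (simp add: algebra_simps)
      then show "t \<le> N + e" using posP by fastforce
    qed
    define t0 where "t0 = Sup L"
    have "bdd_above L" by (rule bdd_aboveI[of _ N]) (rule bdd)
    have w: "norm (Z - t0 *\<^sub>R P) \<le> 3 * (2 * e)" if e: "e > 0" for e
    proof (rule norm_le_if_pos_bounds)
      \<comment> \<open>Bounds relative to \<open>P\<close> become bounds relative to 1 once a
        nonnegative multiple of the complement is added.\<close>
      have Pc: "positive (s *\<^sub>R (1 - P))" if "s \<ge> 0" for s
        by (intro pos_scaleR projection_pos projection_compl P that)
      obtain t where t: "t \<in> L" "t > t0 - e"
        using less_cSupD[of L "t0 - e"] \<open>- N \<in> L\<close> e by (auto simp: t0_def)
      have a: "positive (Z - t *\<^sub>R P + e *\<^sub>R P)" using t e by (simp add: L_def)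
      have b: "positive ((t - t0 + e) *\<^sub>R P)"
        by (intro pos_scaleR projection_pos P) (use t in simp)
      have c: "positive ((2 * e) *\<^sub>R (1 - P))" by (rule Pc) (use e in simp)
      have "Z - t *\<^sub>R P + e *\<^sub>R P + (t - t0 + e) *\<^sub>R P + (2 * e) *\<^sub>R (1 - P) = (2 * e) *\<^sub>R 1 + (Z - t0 *\<^sub>R P)"
        by (simp only: mult_2 scaleR_left_distrib scaleR_left_diff_distrib scaleR_diff_right) (simp only: algebra_simps)
      then show "positive ((2 * e) *\<^sub>R 1 + (Z - t0 *\<^sub>R P))"
        using pos_add[OF pos_add[OF a b] c] by (simp only:)
      have "t0 + e \<notin> L"
        using cSup_upper[OF _ \<open>bdd_above L\<close>, of "t0 + e"] e by (auto simp: t0_def)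
      then obtain d where d: "d > 0" "\<not> positive (Z - (t0 + e) *\<^sub>R P + d *\<^sub>R P)"
        by (auto simp: L_def)
      \<comment> \<open>Shrinking the failing tolerance \<open>d\<close> keeps the failure, and at a
        tolerance of at most \<open>e\<close> the dichotomy returns an upper bound that is close
        enough to \<open>t0\<close>.\<close>
      define m where "m = min d e"
      have m: "m > 0" "m \<le> d" "m \<le> e" using d e by (auto simp: m_def)
      have "\<not> positive (Z - (t0 + e) *\<^sub>R P + m *\<^sub>R P)"
      proof
        assume "positive (Z - (t0 + e) *\<^sub>R P + m *\<^sub>R P)"
        from pos_add[OF this pos_scaleR[OF projection_pos[OF P], of "d - m"]] m d show False
          by (simp add: algebra_simps)
      qed
      then have a: "positive (m *\<^sub>R P - (Z - (t0 + e) *\<^sub>R P))"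
        using dich[OF m(1)] by blast
      have b: "positive ((e - m) *\<^sub>R P)"
        by (intro pos_scaleR projection_pos P) (use m in simp)
      have "m *\<^sub>R P - (Z - (t0 + e) *\<^sub>R P) + (e - m) *\<^sub>R P + (2 * e) *\<^sub>R (1 - P) = (2 * e) *\<^sub>R 1 - (Z - t0 *\<^sub>R P)"
        by (simp only: mult_2 scaleR_left_distrib scaleR_left_diff_distrib scaleR_diff_right) (simp only: algebra_simps)
      then show "positive ((2 * e) *\<^sub>R 1 - (Z - t0 *\<^sub>R P))"
        using pos_add[OF pos_add[OF a b] c] by (simp only:)
    qed (use e in simp)
    have "norm (Z - t0 *\<^sub>R P) \<le> 0"
    proof (rule field_le_epsilon)
      fix e :: real assume "e > 0"
      then show "norm (Z - t0 *\<^sub>R P) \<le> 0 + e" using w[of "e / 6"] by simp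
    qed
    then have "emb z = emb (t0 *\<^sub>R p)" by (simp add: Z_def P_def emb_hom)
    then show ?thesis by (auto simp: emb_inject)
  qed
qed

lemma minimal_projection_scalar:
  fixes z p :: "'a::cstar_algebra"
  assumes rr0: "nonunital_real_rank_zero TYPE('a)" and p: "projection p"
    and min: "\<And>r. projection r \<Longrightarrow> p * r = r \<Longrightarrow> r * p = r \<Longrightarrow> r = 0 \<or> r = p"
  shows "\<exists>l. p * z * p = l *\<^sub>C p"
proof -
  define w where "w = p * z * p"
  have pw: "p * w = w" "w * p = w"
    by (simp_all add: w_def mult.assoc projection_idem[OF p] projection_idem'[OF p])
  have sw: "star w * p = star w" "p * star w = star w"
    using arg_cong[OF pw(1), of star] arg_cong[OF pw(2), of star] p by (simp_all add: star_mult projection_def)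
  have 1: "self_adjoint (w + star w)" by (simp add: self_adjoint_def star_add star_star add.commute)
  have 2: "p * (w + star w) = w + star w" "(w + star w) * p = w + star w"
    by (simp_all add: distrib_left distrib_right pw sw)
  have "\<exists>s. w + star w = s *\<^sub>R p"
    by (rule minimal_projection_sa_scalar[OF rr0 p _ 1 2]) (rule min)
  then obtain s where s: "w + star w = s *\<^sub>R p" ..
  let ?d = "\<i> *\<^sub>C (w - star w)"
  have 3: "self_adjoint ?d"
    by (simp add: self_adjoint_def star_scaleC star_diff star_star scaleC_minus_left scaleC_diff_right)
  have 4: "p * ?d = ?d" "?d * p = ?d"
    by (simp_all add: mult_scaleC_left mult_scaleC_right left_diff_distrib right_diff_distrib pw sw)
  have "\<exists>t. ?d = t *\<^sub>R p"
    by (rule minimal_projection_sa_scalar[OF rr0 p _ 3 4]) (rule min)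
  then obtain t where t: "?d = t *\<^sub>R p" ..
  have "w - star w = (- \<i>) *\<^sub>C (\<i> *\<^sub>C (w - star w))"
    by (simp add: scaleC_scaleC scaleC_one)
  also have "\<dots> = (- \<i> * t) *\<^sub>C p" by (simp add: t scaleC_scaleC flip: scaleC_of_real)
  finally have "(w + star w) + (w - star w) = (of_real s - \<i> * t) *\<^sub>C p"
    by (simp add: s scaleC_diff_left scaleC_minus_left flip: scaleC_of_real)
  then have "2 *\<^sub>R w = (of_real s - \<i> * t) *\<^sub>C p" by (simp add: scaleR_2)
  then have "(1/2) *\<^sub>R 2 *\<^sub>R w = (1/2) *\<^sub>R (of_real s - \<i> * t) *\<^sub>C p"
    by simp
  then have "w = ((1/2) * (of_real s - \<i> * t)) *\<^sub>C p"
    by (simp add: scaleC_scaleC scaleC_one flip: scaleC_of_real)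
  then show ?thesis unfolding w_def by blast
qed

section \<open>A minimal projection makes the algebra elementary\<close>

text \<open>Elements are treated one at a time. Enlarging \<open>r\<close> to \<open>p\<close> does
  not spoil the earlier ones, since y - py is (1 - p) applied to y - ry.\<close>

lemma ex_projection_above_finite:
  fixes F :: "'a::cstar_algebra set"
  assumes rr0: "nonunital_real_rank_zero TYPE('a)" and "finite F" and \<epsilon>: "\<epsilon> > 0" and "projection q"
  shows "\<exists>p. projection p \<and> p * q = q \<and> q * p = q \<and> (\<forall>x\<in>F. norm (x - p * x) \<le> \<epsilon>)"
  using \<open>finite F\<close>
proof (induction F)
  case empty
  show ?case using \<open>projection q\<close> by (intro exI[of _ q]) (simp add: projection_idem)
next
  case (insert x F)
  then obtain r where r: "projection r" "r * q = q" "q * r = q" "\<forall>x\<in>F. norm (x - r * x) \<le> \<epsilon>" by blast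
  obtain p where p: "projection p" "p * r = r" "r * p = r" "norm (x - p * x) \<le> \<epsilon>"
    using exists_projection_above[OF rr0 r(1) \<epsilon>] by blast
  have "norm (y - p * y) \<le> \<epsilon>" if "y \<in> F" for y
  proof -
    have e: "y - p * y = (y - r * y) - p * (y - r * y)"
      by (simp add: right_diff_distrib p(2) flip: mult.assoc)
    have "emb (y - p * y) = (1 - emb p) * emb (y - r * y)"
      by (subst e) (simp add: emb_hom algebra_simps)
    then have "norm (emb (y - p * y)) \<le> norm (1 - emb p) * norm (emb (y - r * y))"
      by (simp only: norm_mult_ineq)
    also have "\<dots> \<le> 1 * norm (emb (y - r * y))"
      by (intro mult_right_mono norm_projection_le projection_compl) (simp_all add: projection_emb p)
    finally have "norm (y - p * y) \<le> norm (y - r * y)" by (simp add: norm_emb)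
    also have "\<dots> \<le> \<epsilon>" using r(4) that by blast
    finally show ?thesis .
  qed
  moreover have "p * q = (p * r) * q" by (simp only: mult.assoc r)
  then have "p * q = q" by (simp add: p r)
  moreover have "q * p = q * (r * p)" by (simp only: mult.assoc[symmetric] r)
  then have "q * p = q" by (simp add: p r)
  ultimately show ?case using p by blast
qed

lemma projection_zero: "projection (0::'a::cstar_algebra)"
  by (simp add: projection_def star_zero)

lemma ex_projection_finite:
  fixes F :: "'a::cstar_algebra set"
  assumes "nonunital_real_rank_zero TYPE('a)" "finite F" "\<epsilon> > 0"
  shows "\<exists>p. projection p \<and> (\<forall>x\<in>F. norm (x - p * x) \<le> \<epsilon>)"
  using ex_projection_above_finite[OF assms projection_zero] by blast

text \<open>\<open>scalar\<close> says that the corner of \<open>p\<close> is one-dimensional. The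
  left ideal Ap is then a Hilbert space whose inner product is the coefficient of
  \<open>star y * x\<close> at \<open>p\<close>; its norm is that of A, and left multiplication
  identifies A with the compact operators on it.\<close>

locale minimal_projection =
  fixes p :: "'a::cstar_algebra"
  assumes simple: "simple TYPE('a)"
    and rr0: "nonunital_real_rank_zero TYPE('a)"
    and proj: "projection p"
    and nonzero: "p \<noteq> 0"
    and scalar: "\<And>z. \<exists>l. p * z * p = l *\<^sub>C p"
begin

section \<open>The Hilbert space Ap\<close>

definition S where "S = {x. x * p = x}"

text \<open>For \<open>x\<close> and \<open>y\<close> in \<open>S\<close> the element
  \<open>star y * x\<close> lies in the corner of \<open>p\<close>, so a coefficient exists;
  \<open>scaleC_p_eq\<close> makes it unique.\<close>

definition ip :: "'a \<Rightarrow> 'a \<Rightarrow> complex" where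
  "ip x y = (THE l. star y * x = l *\<^sub>C p)"

definition H :: "'a hilbert" where
  "H = \<lparr>hcarrier = S, hzero = 0, hadd = (+), hscale = scaleC, hinner = ip\<rparr>"

lemma H_simps [simp]:
  "hcarrier H = S" "hzero H = 0" "hadd H = (+)" "hscale H = scaleC" "hinner H = ip"
  by (simp_all add: H_def)

lemma pp: "p * p = p" "star p = p" using proj by (simp_all add: projection_def)

lemma scaleC_p_eq: "l *\<^sub>C p = m *\<^sub>C p \<Longrightarrow> l = m"
proof -
  assume "l *\<^sub>C p = m *\<^sub>C p"
  then have "norm ((l - m) *\<^sub>C p) = 0" by (simp add: scaleC_diff_left)
  then show "l = m" using nonzero by (simp add: norm_scaleC)
qed

lemma S_closed:
  "0 \<in> S" "x \<in> S \<Longrightarrow> y \<in> S \<Longrightarrow> x + y \<in> S" "x \<in> S \<Longrightarrow> y \<in> S \<Longrightarrow> x - y \<in> S"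
  "x \<in> S \<Longrightarrow> c *\<^sub>C x \<in> S" "x \<in> S \<Longrightarrow> r *\<^sub>R x \<in> S" "x \<in> S \<Longrightarrow> a * x \<in> S" "a * p \<in> S" "p \<in> S"
  by (simp_all add: S_def distrib_right left_diff_distrib mult_scaleC_left mult.assoc pp)

lemma ip_eqI: "star y * x = l *\<^sub>C p \<Longrightarrow> ip x y = l"
  unfolding ip_def by (rule the_equality) (auto intro: scaleC_p_eq)

lemma p_star: "x \<in> S \<Longrightarrow> p * star x = star x"
  using pp by (metis (mono_tags, lifting) S_def mem_Collect_eq star_mult)

lemma ip: assumes "x \<in> S" "y \<in> S" shows "star y * x = ip x y *\<^sub>C p"
proof -
  obtain l where l: "p * (star y * x) * p = l *\<^sub>C p" using scalar by blast
  have "p * (star y * x) * p = (p * star y) * (x * p)" by (simp only: mult.assoc)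
  also have "\<dots> = star y * x" using assms by (simp add: p_star) (simp add: S_def)
  finally have "star y * x = l *\<^sub>C p" using l by simp
  then show ?thesis using ip_eqI by blast
qed

lemma ip_add: "x \<in> S \<Longrightarrow> y \<in> S \<Longrightarrow> z \<in> S \<Longrightarrow> ip (x + y) z = ip x z + ip y z"
  by (rule ip_eqI) (simp add: distrib_left ip scaleC_add_left)

lemma ip_scale: "x \<in> S \<Longrightarrow> y \<in> S \<Longrightarrow> ip (c *\<^sub>C x) y = c * ip x y"
  by (rule ip_eqI) (simp add: mult_scaleC_right ip scaleC_scaleC)

lemma ip_commute: "x \<in> S \<Longrightarrow> y \<in> S \<Longrightarrow> ip x y = cnj (ip y x)"
  using arg_cong[OF ip[of y x], of star] by (intro ip_eqI) (simp add: star_mult star_star star_scaleC pp)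

lemma ip_self: assumes x: "x \<in> S" shows "ip x x = of_real ((norm x)\<^sup>2)"
proof -
  define l where "l = Re (ip x x)"
  have l: "ip x x = of_real l"
    using arg_cong[OF ip_commute[OF x x], of Im] by (simp add: l_def complex_eq_iff)
  have n: "norm p = 1" by (rule norm_projection[OF proj nonzero])
  have xx: "star x * x = l *\<^sub>R p" using ip[OF x x] by (simp add: l scaleC_of_real)
  have "(norm x)\<^sup>2 = \<bar>l\<bar>" using cstar_identity[of x] by (simp add: xx n)
  moreover have "l \<ge> 0"
  proof (rule ccontr)
    assume neg: "\<not> l \<ge> 0"
    \<comment> \<open>A negative \<open>l\<close> would make \<open>star x * x\<close> minus the
      square of a self-adjoint element.\<close>
    have "star (emb x) * emb x = - ((sqrt (- l) *\<^sub>R emb p) * (sqrt (- l) *\<^sub>R emb p))"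
      using neg by (simp add: xx pp flip: emb_hom)
    then have "emb x = 0"
      by (rule negative_star_square_zero[rotated]) (intro sa_intros, simp add: sa_emb projection_sa proj)
    then have "x = 0" by (simp add: emb_inject flip: emb_hom(1))
    then have "l *\<^sub>R p = 0" using xx by simp
    then show False using nonzero neg by simp
  qed
  ultimately show ?thesis using l by simp
qed

lemma pre_hilbert: "pre_hilbert_space H"
  by standard (auto simp: S_closed scaleC_add_right scaleC_add_left scaleC_scaleC scaleC_one ip_add
      ip_scale ip_self scaleC_minus_left intro: ip_commute)

interpretation pre_hilbert_space H by (rule pre_hilbert)

lemma hnorm_H: "x \<in> S \<Longrightarrow> hnorm H x = norm x"
  by (simp add: hnorm_def ip_self)

lemma hdist_H: "x \<in> S \<Longrightarrow> y \<in> S \<Longrightarrow> hdist H x y = dist x y"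
  by (simp add: hdist_def hnorm_H S_closed scaleC_minus_left scaleC_one dist_norm flip: diff_conv_add_uminus)

lemma closed_S: "closed S"
  unfolding S_def by (intro closed_Collect_eq continuous_intros)

interpretation HM: Metric_space S "hdist H" using Metric_space_hdist by simp

lemma mtopology_H: "HM.mtopology = top_of_set S"
  unfolding topology_eq HM.openin_mtopology openin_euclidean_subtopology_iff
  by (intro allI conj_cong refl)
     (auto simp: HM.mball_def hdist_H dist_commute subset_iff Ball_def cong: conj_cong; blast)

lemma hilbert: "hilbert_space H"
proof
  show "Metric_space.mcomplete (hcarrier H) (hdist H)"
    unfolding H_simps HM.mcomplete_def
  proof (intro allI impI)
    fix \<sigma> assume \<sigma>: "HM.MCauchy \<sigma>"
    then have S: "\<sigma> n \<in> S" for n by (auto simp: HM.MCauchy_def)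
    have "Cauchy \<sigma>" using \<sigma> by (auto simp: HM.MCauchy_def Cauchy_def hdist_H S)
    then obtain x where x: "\<sigma> \<longlonglongrightarrow> x"
      using Cauchy_convergent_iff convergent_def by blast
    have "x \<in> S" using closed_sequentially[OF closed_S _ x] S by blast
    then show "\<exists>x. limitin HM.mtopology \<sigma> x sequentially"
      using x by (intro exI[of _ x]) (simp add: mtopology_H limitin_subtopology S)
  qed
qed

section \<open>Left multiplications are compact operators\<close>

definition B where "B = {x \<in> S. norm x \<le> 1}"

lemma compact_operators_H:
  "compact_operators H = {T \<in> S \<rightarrow>\<^sub>E S. (\<forall>x\<in>S. \<forall>y\<in>S. T (x + y) = T x + T y) \<and>
    (\<forall>c. \<forall>x\<in>S. T (c *\<^sub>C x) = c *\<^sub>C T x) \<and> compact (closure (T ` B))}"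
proof -
  have B: "{x \<in> S. hnorm H x \<le> 1} = B" by (auto simp: B_def hnorm_H)
  have "compactin (top_of_set S) (top_of_set S closure_of (T ` B)) \<longleftrightarrow> compact (closure (T ` B))"
    if "T \<in> S \<rightarrow>\<^sub>E S" for T
  proof -
    have "T ` B \<subseteq> S" using that by (auto simp: B_def)
    moreover from this have "closure (T ` B) \<subseteq> S" by (rule closure_minimal[OF _ closed_S])
    ultimately show ?thesis
      by (simp add: closure_of_subtopology compactin_subtopology Int_absorb1)
  qed
  then show ?thesis
    unfolding compact_operators_def H_simps Let_def mtopology_H B by auto
qed

lemma S_mult_zero: assumes "\<And>x. x \<in> S \<Longrightarrow> a * x = 0" shows "a = 0"
proof (rule ccontr)
  assume "a \<noteq> 0"
  then obtain y where "a * y * p \<noteq> 0" using simple_prime[OF simple _ nonzero] by blast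
  then show False using assms[of "y * p"] by (simp add: S_closed mult.assoc)
qed

text \<open>Left multiplication on Ap is isometric. If the norm of \<open>b\<close> exceeded
  \<open>M\<close>, there would be a nonzero approximate spectral projection \<open>r\<close> of
  \<open>star b * b\<close> above a level c > M^2, and by primeness rAp contains a nonzero vector,
  which \<open>b\<close> stretches by more than \<open>M\<close>. The right unit \<open>s\<close>
  required for this comes from replacing \<open>a\<close> by \<open>a * s\<close>.\<close>

lemma norm_le_if_S_bounded:
  assumes M: "M \<ge> 0" "\<And>x. x \<in> S \<Longrightarrow> norm (a * x) \<le> M * norm x"
  shows "norm a \<le> M"
proof -
  have 1: "norm b \<le> M" if s: "projection s" "b * s = b" and b: "\<And>x. x \<in> S \<Longrightarrow> norm (b * x) \<le> M * norm x" for b s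
  proof (rule ccontr)
    assume "\<not> norm b \<le> M"
    then have "M\<^sup>2 < (norm b)\<^sup>2" using M by (intro power_strict_mono) auto
    then obtain c where c: "M\<^sup>2 < c" "c < (norm b)\<^sup>2" using dense by blast
    then have "0 < c" using zero_le_power2[of M] by linarith
    obtain r k where r: "projection r" "r \<noteq> 0" "s * r = r" "r * s = r"
      "\<forall>y. c * (norm (r * y))\<^sup>2 \<le> (norm (b * r * y))\<^sup>2" "star (b * k) * (b * k) = r" "k * r = k"
      by (rule ex_spectral_projection_below[OF rr0 s \<open>0 < c\<close> c(2)])
    obtain y where y: "r * y * p \<noteq> 0" using simple_prime[OF simple r(2) nonzero] by blast
    let ?x = "r * (y * p)"
    have x0: "?x \<noteq> 0" using y by (simp add: mult.assoc)
    have "c * (norm ?x)\<^sup>2 \<le> (norm (b * ?x))\<^sup>2" using r(5)[rule_format, of "y * p"]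
      by (simp add: mult.assoc)
    also have "\<dots> \<le> (M * norm ?x)\<^sup>2"
      by (rule power_mono[OF b[OF S_closed(6)[OF S_closed(7)]] norm_ge_zero])
    finally have "c * (norm ?x)\<^sup>2 \<le> M\<^sup>2 * (norm ?x)\<^sup>2"
      by (simp add: power_mult_distrib)
    then show False using c(1) x0 by simp
  qed
  show ?thesis
  proof (rule field_le_epsilon)
    fix e :: real assume e: "e > 0"
    have "finite {star a}" by simp
    from ex_projection_finite[OF rr0 this e] obtain s
      where s: "projection s" "norm (star a - s * star a) \<le> e" by auto
    have "norm (a - a * s) \<le> e"
      using s norm_star[of "a - a * s"] by (simp add: star_diff star_mult projection_def)
    moreover have "norm (a * s) \<le> M"
    proof (rule 1[OF s(1)])
      show "a * s * s = a * s" by (simp add: mult.assoc projection_idem[OF s(1)])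
      fix x assume "x \<in> S"
      have "norm (a * s * x) \<le> M * norm (s * x)"
        using M(2)[of "s * x"] \<open>x \<in> S\<close> by (simp add: S_closed mult.assoc)
      also have "\<dots> \<le> M * (1 * norm x)"
        by (rule mult_left_mono[OF norm_mult_le[OF norm_projection_le[OF s(1)] order_refl] M(1)])
      finally show "norm (a * s * x) \<le> M * norm x" by simp
    qed
    moreover have "norm a \<le> norm (a - a * s) + norm (a * s)"
      using norm_triangle_ineq[of "a - a * s" "a * s"] by simp
    ultimately show "norm a \<le> M + e" by linarith
  qed
qed

lemma ideal_UNIV:
  assumes "two_sided_ideal I" "closed I" "p \<in> I" shows "I = UNIV"
  using simple assms nonzero by (auto simp: simple_def)

text \<open>The elements that act compactly form a closed ideal, and \<open>p\<close> belongs to it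
  because its range on Ap is one-dimensional. Simplicity does the rest.\<close>

lemma compact_left_mult: "compact (closure ((\<lambda>x. a * x) ` B))"
proof -
  define C where "C = {a. \<exists>K. compact K \<and> (\<forall>x\<in>B. a * x \<in> K)}"
  have CI: "a \<in> C" if "compact K" "\<And>x. x \<in> B \<Longrightarrow> a * x \<in> K" for K a
    using that unfolding C_def by blast
  have CE: "\<exists>K. compact K \<and> (\<forall>x\<in>B. a * x \<in> K)" if "a \<in> C" for a
    using that unfolding C_def by blast
  have "two_sided_ideal C"
    unfolding two_sided_ideal_def
  proof (intro conjI ballI allI)
    show "0 \<in> C" by (rule CI[of "{0}"]) auto
    fix x y assume "x \<in> C" "y \<in> C"
    then obtain K L where "compact K" "\<forall>z\<in>B. x * z \<in> K" "compact L" "\<forall>z\<in>B. y * z \<in> L"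
      using CE by meson
    then show "x + y \<in> C"
      by (intro CI[of "{u + v |u v. u \<in> K \<and> v \<in> L}"] compact_sums) (auto simp: distrib_right)
  next
    fix c x assume "x \<in> C"
    then obtain K where "compact K" "\<forall>z\<in>B. x * z \<in> K" using CE by blast
    then show "c *\<^sub>C x \<in> C"
      by (intro CI[of "(\<lambda>u. c *\<^sub>C u) ` K"] compact_continuous_image
          linear_continuous_on bounded_linear_scaleC) (auto simp: mult_scaleC_left)
  next
    fix b x assume "x \<in> C"
    then obtain K where K: "compact K" "\<forall>z\<in>B. x * z \<in> K" using CE by blast
    then show "b * x \<in> C"
      by (intro CI[of "(\<lambda>u. b * u) ` K"] compact_continuous_image continuous_intros) (auto simp: mult.assoc)
    \<comment> \<open>\<open>b\<close> need not map \<open>B\<close> into itself; dividing by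
      \<open>n\<close> brings \<open>b * z\<close> back into the ball. The summand 1 keeps
      \<open>n\<close> positive.\<close>
    define n where "n = norm b + 1"
    have n: "n > 0" unfolding n_def using norm_ge_zero[of b] by linarith
    have "x * b * z \<in> (\<lambda>u. n *\<^sub>R u) ` K" if "z \<in> B" for z
    proof (rule image_eqI[of _ _ "x * (inverse n *\<^sub>R (b * z))"])
      show "x * b * z = n *\<^sub>R (x * inverse n *\<^sub>R (b * z))"
        using n by (simp add: mult.assoc)
      have "norm (b * z) \<le> norm b * 1" using that by (intro norm_mult_le) (auto simp: B_def)
      then have "norm (b * z) \<le> n" by (simp add: n_def)
      then have "inverse n * norm (b * z) \<le> inverse n * n"
        using n by (intro mult_left_mono) auto
      then have "norm (inverse n *\<^sub>R (b * z)) \<le> 1" using n by simp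
      then have "inverse n *\<^sub>R (b * z) \<in> B"
        using that unfolding B_def by (auto intro!: S_closed(5) S_closed(6))
      then show "x * (inverse n *\<^sub>R (b * z)) \<in> K" using K(2) by blast
    qed
    then show "x * b \<in> C" using K(1)
      by (intro CI[of "(\<lambda>u. n *\<^sub>R u) ` K"] compact_scaling)
  qed
  moreover have "closed C"
    unfolding closed_sequential_limits
  proof (intro allI impI, elim conjE)
    fix s a assume s: "\<forall>n. s n \<in> C" "s \<longlonglongrightarrow> a"
    have "compact (closure ((\<lambda>x. a * x) ` B))"
      unfolding compact_eq_totally_bounded
    proof (intro conjI allI impI)
      show "complete (closure ((\<lambda>x. a * x) ` B))" by (simp add: complete_eq_closed)
      fix e :: real assume e: "e > 0"
      then have e3: "e / 3 > 0" by simp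
      from LIMSEQ_D[OF s(2) this] obtain n where n: "norm (s n - a) < e / 3" by blast
      obtain K where K: "compact K" "\<forall>x\<in>B. s n * x \<in> K" using s(1) CE by blast
      obtain k where k: "finite k" "K \<subseteq> (\<Union>x\<in>k. ball x (e/3))"
        using K(1)[unfolded compact_eq_totally_bounded] e3 by blast
      have "(\<lambda>x. a * x) ` B \<subseteq> (\<Union>x\<in>k. cball x (2 * e / 3))"
      proof (rule image_subsetI)
        fix x assume x: "x \<in> B"
        then have "s n * x \<in> (\<Union>x\<in>k. ball x (e/3))" using K(2) k(2) by blast
        then obtain y where y: "y \<in> k" "dist y (s n * x) < e / 3" by auto
        have "norm (s n * x - a * x) \<le> (e / 3) * 1"
          unfolding left_diff_distrib[symmetric] using n x by (intro norm_mult_le) (auto simp: B_def)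
        then have "dist (s n * x) (a * x) \<le> e / 3" by (simp add: dist_norm)
        then have "dist y (a * x) \<le> 2 * e / 3"
          using y(2) dist_triangle[of y "a * x" "s n * x"] by linarith
        then show "a * x \<in> (\<Union>x\<in>k. cball x (2 * e / 3))" using y(1) by auto
      qed
      then have "closure ((\<lambda>x. a * x) ` B) \<subseteq> (\<Union>x\<in>k. cball x (2 * e / 3))"
        by (rule closure_minimal) (intro closed_UN k(1) closed_cball ballI)
      also have "\<dots> \<subseteq> (\<Union>x\<in>k. ball x e)"
        by (rule UN_mono[OF order_refl]) (use e in auto)
      finally show "\<exists>k. finite k \<and> closure ((\<lambda>x. a * x) ` B) \<subseteq> (\<Union>x\<in>k. ball x e)"
        using k(1) by blast
    qed
    then show "a \<in> C" by (rule CI) (intro closure_subset[THEN subsetD] imageI)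
  qed
  moreover have "p \<in> C"
  proof -
    have "p * x \<in> (\<lambda>l. l *\<^sub>C p) ` cball 0 1" if x: "x \<in> B" for x
    proof -
      obtain l where l: "p * x * p = l *\<^sub>C p" using scalar by blast
      have "norm (p * x * p) \<le> norm x" by (rule norm_compress_le[OF proj proj])
      then have "cmod l \<le> 1"
        using x norm_projection[OF proj nonzero] by (simp add: l norm_scaleC B_def)
      moreover have "p * x = l *\<^sub>C p" using x l by (simp add: B_def S_def mult.assoc)
      ultimately show ?thesis by auto
    qed
    moreover have "bounded_linear (\<lambda>l. l *\<^sub>C p)"
    proof (rule bounded_linear_intro[of _ "norm p"])
      show "(r *\<^sub>R l) *\<^sub>C p = r *\<^sub>R l *\<^sub>C p" for r l
        by (simp only: scaleC_of_real[symmetric] scaleC_scaleC scaleR_conv_of_real)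
    qed (simp_all add: scaleC_add_left norm_scaleC)
    then have "compact ((\<lambda>l. l *\<^sub>C p) ` cball 0 1)"
      by (intro compact_continuous_image linear_continuous_on) auto
    ultimately show ?thesis by (intro CI)
  qed
  ultimately have "C = UNIV" by (rule ideal_UNIV)
  then obtain K where K: "compact K" "\<forall>x\<in>B. a * x \<in> K" using CE by blast
  have "closure ((\<lambda>x. a * x) ` B) \<subseteq> K"
    by (rule closure_minimal) (use K compact_imp_closed in auto)
  then have "closure ((\<lambda>x. a * x) ` B) = K \<inter> closure ((\<lambda>x. a * x) ` B)" by blast
  then show ?thesis using compact_Int_closed[OF K(1) closed_closure[of "(\<lambda>x. a * x) ` B"]]
    by simp
qed

section \<open>Functionals on Ap, and compact operators as left multiplications\<close>

lemma norm_add_square: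
  assumes "x \<in> S" "y \<in> S"
  shows "(norm (x + y))\<^sup>2 = (norm x)\<^sup>2 + (norm y)\<^sup>2 + 2 * Re (ip x y)"
proof -
  have yx: "ip y (x + y) = cnj (ip x y) + ip y y" "ip x (x + y) = ip x x + ip x y"
    using ip_commute[of "x + y"] ip_commute[of _ "x + y"] assms
    by (simp_all add: ip_add S_closed ip_commute[of y x] ip_self)
  have "complex_of_real ((norm (x + y))\<^sup>2) = ip (x + y) (x + y)"
    by (simp only: ip_self S_closed assms)
  also have "\<dots> = ip x x + ip x y + (cnj (ip x y) + ip y y)"
    using assms by (simp add: ip_add S_closed yx)
  finally show ?thesis by (simp add: ip_self assms complex_eq_iff)
qed

text \<open>The representing vector minimizes |x|^2 - 2 Re f(x) on Ap. The parallelogram law makes a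
  minimizing sequence Cauchy, the first variation at its limit gives the real part of the identity,
  and complex linearity gives the imaginary part.\<close>

lemma riesz:
  assumes add: "\<And>x y. x \<in> S \<Longrightarrow> y \<in> S \<Longrightarrow> f (x + y) = f x + f y"
    and scale: "\<And>c x. x \<in> S \<Longrightarrow> f (c *\<^sub>C x) = c * f x"
    and bound: "\<And>x. x \<in> S \<Longrightarrow> cmod (f x) \<le> K * norm x"
  shows "\<exists>t\<in>S. \<forall>x\<in>S. f x = ip x t"
proof -
  define F where "F x = (norm x)\<^sup>2 - 2 * Re (f x)" for x
  have fr: "f (r *\<^sub>R x) = of_real r * f x" if "x \<in> S" for r x
    using scale[OF that, of "of_real r"] by (simp add: scaleC_of_real)
  have fd: "f (x - y) = f x - f y" if "x \<in> S" "y \<in> S" for x y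
    using add[OF that(1) S_closed(5)[OF that(2)], of "-1"] fr[OF that(2), of "-1"] by simp
  have Fb: "- K\<^sup>2 \<le> F x" if x: "x \<in> S" for x
  proof -
    have "Re (f x) \<le> K * norm x" using bound[OF x] complex_Re_le_cmod[of "f x"] by linarith
    moreover have "0 \<le> (norm x - K)\<^sup>2" by simp
    ultimately show ?thesis unfolding F_def power2_diff by (simp add: mult.commute)
  qed
  define m where "m = Inf (F ` S)"
  have bdd: "bdd_below (F ` S)" using Fb by (auto intro!: bdd_belowI[of _ "- K\<^sup>2"])
  have mle: "m \<le> F x" if "x \<in> S" for x unfolding m_def by (rule cInf_lower[OF _ bdd]) (use that in simp)
  have "\<exists>x\<in>S. F x < m + 1 / Suc n" for n
  proof -
    have "Inf (F ` S) < m + 1 / Suc n" by (simp add: m_def)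
    then show ?thesis using cInf_lessD[of "F ` S"] S_closed(1) by blast
  qed
  then obtain u where u: "\<And>n. u n \<in> S" "\<And>n. F (u n) < m + 1 / Suc n" by metis
  have par: "(norm (x - y))\<^sup>2 \<le> 2 * (F x - m) + 2 * (F y - m)" if xy: "x \<in> S" "y \<in> S" for x y
  proof -
    let ?z = "(1/2) *\<^sub>R (x + y)"
    have "(norm (x - y))\<^sup>2 = (norm x)\<^sup>2 + (norm y)\<^sup>2 - 2 * Re (ip x y)"
    proof -
      have "ip x (- y) = - ip x y"
        using ip[OF xy] by (intro ip_eqI) (simp add: star_minus scaleC_minus_left)
      moreover have "- y \<in> S" using S_closed(5)[OF xy(2), of "-1"] by simp
      ultimately show ?thesis using norm_add_square[OF xy(1), of "- y"] by simp
    qed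
    then have "(norm (x - y))\<^sup>2 = 2 * (norm x)\<^sup>2 + 2 * (norm y)\<^sup>2 - (norm (x + y))\<^sup>2"
      using norm_add_square[OF xy] by simp
    moreover have "F ?z = (norm (x + y))\<^sup>2 / 4 - Re (f x) - Re (f y)"
      using xy by (simp add: F_def fr S_closed add power_divide) (simp add: add_divide_distrib)
    moreover have "m \<le> F ?z" by (intro mle S_closed xy)
    ultimately have "4 * m \<le> (norm (x + y))\<^sup>2 - 4 * Re (f x) - 4 * Re (f y)"
      "(norm (x - y))\<^sup>2 = 2 * (norm x)\<^sup>2 + 2 * (norm y)\<^sup>2 - (norm (x + y))\<^sup>2"
      by simp_all
    then show ?thesis unfolding F_def[of x] F_def[of y] by (simp add: algebra_simps)
  qed
  have "Cauchy u"
  proof (rule metric_CauchyI)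
    fix e :: real assume e: "e > 0"
    obtain N where N: "1 / real (Suc N) < e\<^sup>2 / 4"
      using reals_Archimedean[of "e\<^sup>2/4"] e by (auto simp: inverse_eq_divide)
    have "dist (u i) (u j) < e" if "i \<ge> N" "j \<ge> N" for i j
    proof -
      have s: "1 / real (Suc k) \<le> 1 / real (Suc N)" if "k \<ge> N" for k
        using that by (intro divide_left_mono) auto
      have "(norm (u i - u j))\<^sup>2 \<le> 2 * (F (u i) - m) + 2 * (F (u j) - m)"
        by (rule par[OF u(1) u(1)])
      also have "F (u k) - m < e\<^sup>2 / 4" if "k \<ge> N" for k
        using u(2)[of k] s[OF that] N by simp
      from this[OF that(1)] this[OF that(2)]
      have "2 * (F (u i) - m) + 2 * (F (u j) - m) < e\<^sup>2" by simp
      finally show ?thesis using e by (simp add: dist_norm power_less_imp_less_base)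
    qed
    then show "\<exists>M. \<forall>i\<ge>M. \<forall>j\<ge>M. dist (u i) (u j) < e" by blast
  qed
  then obtain t where t: "u \<longlonglongrightarrow> t"
    using Cauchy_convergent_iff convergent_def by blast
  have tS: "t \<in> S" using closed_sequentially[OF closed_S _ t] u(1) by blast
  have "(\<lambda>n. f (u n) - f t) \<longlonglongrightarrow> 0"
  proof (rule Lim_null_comparison)
    show "\<forall>\<^sub>F n in sequentially. norm (f (u n) - f t) \<le> K * norm (u n - t)"
      using bound[OF S_closed(3)[OF u(1) tS]] by (simp add: fd u(1) tS)
    show "(\<lambda>n. K * norm (u n - t)) \<longlonglongrightarrow> 0"
      using tendsto_mult_right_zero[OF tendsto_norm_zero[OF LIM_zero[OF t]]] by blast
  qed
  then have "(\<lambda>n. f (u n)) \<longlonglongrightarrow> f t" by (rule LIM_zero_cancel)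
  then have "(\<lambda>n. F (u n)) \<longlonglongrightarrow> F t"
    unfolding F_def by (intro tendsto_intros t)
  moreover have "(\<lambda>n. m + 1 / Suc n) \<longlonglongrightarrow> m + 0"
    by (intro tendsto_add tendsto_const LIMSEQ_Suc[OF lim_1_over_n])
  ultimately have "F t \<le> m + 0"
    by (rule LIMSEQ_le) (use u(2) less_imp_le in blast)
  then have min: "F t \<le> F (t + x)" if "x \<in> S" for x
    using mle[OF S_closed(2)[OF tS that]] by linarith
  have Re_eq: "Re (f x) = Re (ip x t)" if x: "x \<in> S" for x
  proof (rule ccontr)
    define d where "d = Re (ip x t) - Re (f x)"
    assume "Re (f x) \<noteq> Re (ip x t)"
    then have d: "d \<noteq> 0" by (simp add: d_def)
    have q: "0 \<le> s\<^sup>2 * (norm x)\<^sup>2 + 2 * s * d" for s :: real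
    proof -
      have sx: "s *\<^sub>R x \<in> S" by (intro S_closed x)
      have "ip (s *\<^sub>R x) t = of_real s * ip x t"
        using ip_scale[OF x tS, of "of_real s"] by (simp add: scaleC_of_real)
      then have "Re (ip t (s *\<^sub>R x)) = s * Re (ip x t)" using ip_commute[OF tS sx] by simp
      then have "F (t + s *\<^sub>R x) = F t + s\<^sup>2 * (norm x)\<^sup>2 + 2 * s * d"
        using norm_add_square[OF tS sx] by (simp add: F_def add tS sx fr x d_def power_mult_distrib algebra_simps)
      then show ?thesis using min[OF sx] by simp
    qed
    \<comment> \<open>The quadratic in \<open>s\<close> is smallest at -d / |x|^2; adding 1 to the
      denominator avoids division by zero and still gives a negative value.\<close>
    define n where "n = (norm x)\<^sup>2 + 1"
    have n: "n > 0" "(norm x)\<^sup>2 \<le> n" by (simp_all add: n_def add_nonneg_pos)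
    have "0 \<le> (d / n)\<^sup>2 * (norm x)\<^sup>2 + 2 * (- d / n) * d" using q[of "- d / n"]
      by simp
    also have "\<dots> \<le> (d / n)\<^sup>2 * n + 2 * (- d / n) * d"
      using n by (intro add_right_mono mult_left_mono) auto
    also have "\<dots> = - (d\<^sup>2 / n)" using n by (simp add: power2_eq_square field_simps)
    finally show False using d n by (simp add: field_simps)
  qed
  have "f x = ip x t" if x: "x \<in> S" for x
  proof (rule complex_eqI)
    show "Re (f x) = Re (ip x t)" by (rule Re_eq[OF x])
    show "Im (f x) = Im (ip x t)"
      using Re_eq[OF S_closed(4)[OF x], of "\<i>"] by (simp add: scale x ip_scale tS)
  qed
  with tS show ?thesis by blast
qed

text \<open>By \<open>norm_le_if_S_bounded\<close>, being Cauchy uniformly on the unit ball of Ap is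
  being Cauchy in the norm of A.\<close>

lemma Cauchy_left_mult:
  assumes Cauchy: "\<And>e. e > 0 \<Longrightarrow> \<exists>N. \<forall>i\<ge>N. \<forall>j\<ge>N. \<forall>x\<in>S. norm (a i * x - a j * x) \<le> e * norm x"
  obtains b where "a \<longlonglongrightarrow> b"
proof -
  have "Cauchy a"
  proof (rule metric_CauchyI)
    fix e :: real assume "e > 0"
    then have e2: "e / 2 > 0" by simp
    obtain N where N: "\<forall>i\<ge>N. \<forall>j\<ge>N. \<forall>x\<in>S. norm (a i * x - a j * x) \<le> (e / 2) * norm x"
      using Cauchy[OF e2] by blast
    have "dist (a i) (a j) < e" if "i \<ge> N" "j \<ge> N" for i j
    proof -
      have "norm (a i - a j) \<le> e / 2"
      proof (rule norm_le_if_S_bounded)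
        show "norm ((a i - a j) * x) \<le> (e / 2) * norm x" if "x \<in> S" for x
          using N \<open>i \<ge> N\<close> \<open>j \<ge> N\<close> that unfolding left_diff_distrib by blast
      qed (use e2 in linarith)
      then show ?thesis using \<open>e > 0\<close> by (simp add: dist_norm)
    qed
    then show "\<exists>M. \<forall>i\<ge>M. \<forall>j\<ge>M. dist (a i) (a j) < e" by blast
  qed
  then show ?thesis using that Cauchy_convergent_iff convergent_def by blast
qed

text \<open>A projection \<open>q\<close> of A that almost fixes the compact set \<open>C\<close>
  makes qT uniformly close to \<open>T\<close>, so it suffices that qT is a left multiplication. The
  admissible \<open>q\<close> form a closed ideal \<open>D\<close>, which contains \<open>p\<close>
  because pcT is a functional times \<open>p\<close>, and \<open>riesz\<close> represents the
  functional.\<close>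

lemma compact_operator_left_mult:
  assumes T: "T \<in> compact_operators H"
  shows "\<exists>a. \<forall>x\<in>S. T x = a * x"
proof -
  have TS: "T x \<in> S" if "x \<in> S" for x using T that by (auto simp: compact_operators_H)
  have Tadd: "T (x + y) = T x + T y" if "x \<in> S" "y \<in> S" for x y
    using T that by (auto simp: compact_operators_H)
  have Tscale: "T (c *\<^sub>C x) = c *\<^sub>C T x" if "x \<in> S" for c x
    using T that by (auto simp: compact_operators_H)
  have TR: "T (r *\<^sub>R x) = r *\<^sub>R T x" if "x \<in> S" for r x
    using Tscale[OF that, of "of_real r"] by (simp add: scaleC_of_real)
  define C where "C = closure (T ` B)"
  have C: "compact C" using T by (simp add: compact_operators_H C_def)
  have TB: "T x \<in> C" if "x \<in> B" for x
    unfolding C_def by (intro closure_subset[THEN subsetD] imageI that)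
  have extend: "norm (g x) \<le> e * norm x"
    if g: "\<And>x. x \<in> B \<Longrightarrow> norm (g x) \<le> e" "\<And>r x. x \<in> S \<Longrightarrow> g (r *\<^sub>R x) = r *\<^sub>R g x" and x: "x \<in> S"
    for g :: "'a \<Rightarrow> 'a" and e x
  proof (cases "x = 0")
    case True
    then show ?thesis using g(2)[OF x, of 0] by simp
  next
    case False
    have "norm (g (inverse (norm x) *\<^sub>R x)) \<le> e"
      by (rule g(1)) (use False x in \<open>simp add: B_def S_closed(5)\<close>)
    then show ?thesis using False by (simp add: g(2)[OF x] field_simps)
  qed
  obtain K where K: "\<And>y. y \<in> C \<Longrightarrow> norm y \<le> K"
    using compact_imp_bounded[OF C] unfolding bounded_iff by blast
  have TK: "norm (T x) \<le> K * norm x" if "x \<in> S" for x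
    by (rule extend[OF K[OF TB] TR that])
  \<comment> \<open>The inserted factor \<open>c\<close> makes \<open>D\<close> stable under
    multiplication from the right as well.\<close>
  define D where "D = {q. \<forall>c. \<exists>a. \<forall>x\<in>S. q * (c * T x) = a * x}"
  have DI: "q \<in> D" if "\<And>c. \<exists>a. \<forall>x\<in>S. q * (c * T x) = a * x" for q
    using that unfolding D_def by blast
  have DE: "\<exists>a. \<forall>x\<in>S. q * (c * T x) = a * x" if "q \<in> D" for q c
    using that unfolding D_def by blast
  have "two_sided_ideal D"
    unfolding two_sided_ideal_def
  proof (intro conjI ballI allI)
    show "0 \<in> D" by (rule DI, rule exI[of _ 0]) simp
    fix u v assume uv: "u \<in> D" "v \<in> D"
    show "u + v \<in> D"
    proof (rule DI)
      fix c
      obtain a b where "\<forall>x\<in>S. u * (c * T x) = a * x" "\<forall>x\<in>S. v * (c * T x) = b * x"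
        using DE[OF uv(1), of c] DE[OF uv(2), of c] by blast
      then show "\<exists>a. \<forall>x\<in>S. (u + v) * (c * T x) = a * x"
        by (intro exI[of _ "a + b"]) (simp add: distrib_right)
    qed
  next
    fix k u assume u: "u \<in> D"
    show "k *\<^sub>C u \<in> D"
    proof (rule DI)
      fix c
      obtain a where "\<forall>x\<in>S. u * (c * T x) = a * x" using DE[OF u, of c] by blast
      then show "\<exists>a. \<forall>x\<in>S. (k *\<^sub>C u) * (c * T x) = a * x"
        by (intro exI[of _ "k *\<^sub>C a"]) (simp add: mult_scaleC_left)
    qed
  next
    fix b u assume u: "u \<in> D"
    show "b * u \<in> D"
    proof (rule DI)
      fix c
      obtain a where "\<forall>x\<in>S. u * (c * T x) = a * x" using DE[OF u, of c] by blast
      then show "\<exists>a. \<forall>x\<in>S. (b * u) * (c * T x) = a * x"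
        by (intro exI[of _ "b * a"]) (simp add: mult.assoc)
    qed
    show "u * b \<in> D"
    proof (rule DI)
      fix c
      obtain a where "\<forall>x\<in>S. u * ((b * c) * T x) = a * x"
        using DE[OF u, of "b * c"] by blast
      then show "\<exists>a. \<forall>x\<in>S. (u * b) * (c * T x) = a * x"
        by (intro exI[of _ a]) (simp add: mult.assoc)
    qed
  qed
  moreover have "closed D"
    unfolding closed_sequential_limits
  proof (intro allI impI, elim conjE)
    fix s q assume s: "\<forall>n. s n \<in> D" "s \<longlonglongrightarrow> q"
    show "q \<in> D"
    proof (rule DI)
      fix c
      have "\<forall>n. \<exists>a. \<forall>x\<in>S. s n * (c * T x) = a * x"
        using s(1) DE by blast
      then obtain a where a: "\<And>n. \<forall>x\<in>S. s n * (c * T x) = a n * x" by metis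
      define M where "M = norm c * \<bar>K\<bar> + 1"
      have M: "M > 0" unfolding M_def by (simp add: add_nonneg_pos)
      have cT: "norm (c * T x) \<le> M * norm x" if "x \<in> S" for x
      proof -
        have "K * norm x \<le> \<bar>K\<bar> * norm x" by (intro mult_right_mono) auto
        then have "norm (T x) \<le> \<bar>K\<bar> * norm x" using TK[OF that] by linarith
        then have "norm (c * T x) \<le> norm c * (\<bar>K\<bar> * norm x)"
          by (rule norm_mult_le[OF order_refl])
        also have "\<dots> \<le> M * norm x" by (simp add: M_def distrib_right mult.assoc)
        finally show ?thesis .
      qed
      obtain b where b: "a \<longlonglongrightarrow> b"
      proof (rule Cauchy_left_mult)
        fix e :: real assume "e > 0"
        then have eM: "e / M > 0" using M by simp
        have "Cauchy s" using s(2) by (rule LIMSEQ_imp_Cauchy)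
        from metric_CauchyD[OF this eM] obtain N where N: "\<forall>i\<ge>N. \<forall>j\<ge>N. dist (s i) (s j) < e / M" by blast
        have "norm (a i * x - a j * x) \<le> e * norm x" if "i \<ge> N" "j \<ge> N" "x \<in> S" for i j x
        proof -
          have "a i * x - a j * x = (s i - s j) * (c * T x)"
            using a[of i] a[of j] that(3) by (simp add: left_diff_distrib)
          also have "norm \<dots> \<le> (e / M) * (M * norm x)"
          proof (rule norm_mult_le[OF _ cT[OF that(3)]])
            show "norm (s i - s j) \<le> e / M" using N that by (simp add: dist_norm less_imp_le)
          qed
          finally show ?thesis using M by simp
        qed
        then show "\<exists>N. \<forall>i\<ge>N. \<forall>j\<ge>N. \<forall>x\<in>S. norm (a i * x - a j * x) \<le> e * norm x" by blast
      qed
      have "q * (c * T x) = b * x" if x: "x \<in> S" for x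
      proof (rule LIMSEQ_unique)
        show "(\<lambda>n. s n * (c * T x)) \<longlonglongrightarrow> q * (c * T x)"
          by (intro tendsto_intros s)
        show "(\<lambda>n. s n * (c * T x)) \<longlonglongrightarrow> b * x"
          using tendsto_mult[OF b tendsto_const[of x]] a x by simp
      qed
      then show "\<exists>a. \<forall>x\<in>S. q * (c * T x) = a * x" by blast
    qed
  qed
  moreover have "p \<in> D"
  proof (rule DI)
    fix c
    define f where "f x = ip (c * T x) p" for x
    have f: "p * (c * T x) = f x *\<^sub>C p" if "x \<in> S" for x
      using ip[of "c * T x" p] that by (simp add: f_def S_closed TS pp)
    have "\<exists>t\<in>S. \<forall>x\<in>S. f x = ip x t"
    proof (rule riesz)
      fix x y assume xy: "x \<in> S" "y \<in> S"
      show "f (x + y) = f x + f y"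
        using xy by (simp add: f_def Tadd distrib_left ip_add S_closed TS)
    next
      fix k x assume "x \<in> S"
      then show "f (k *\<^sub>C x) = k * f x"
        by (simp add: f_def Tscale mult_scaleC_right ip_scale S_closed TS)
    next
      fix x assume x: "x \<in> S"
      have "cmod (f x) = norm (p * (c * T x))"
        by (simp add: f[OF x] norm_scaleC norm_projection[OF proj nonzero])
      also have "\<dots> \<le> 1 * (norm c * (K * norm x))"
        by (intro norm_mult_le norm_projection_le proj order_refl TK x)
      finally show "cmod (f x) \<le> (norm c * K) * norm x" by (simp add: mult.assoc)
    qed
    then obtain t where t: "t \<in> S" "\<forall>x\<in>S. f x = ip x t" by blast
    have "p * (c * T x) = star t * x" if "x \<in> S" for x
      using f[OF that] t ip[OF that t(1)] that by simp
    then show "\<exists>a. \<forall>x\<in>S. p * (c * T x) = a * x" by blast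
  qed
  ultimately have DU: "D = UNIV" by (rule ideal_UNIV)
  have approx: "\<exists>a. \<forall>x\<in>S. norm (T x - a * x) \<le> e * norm x" if e: "e > 0" for e
  proof -
    have e3: "e / 3 > 0" using e by simp
    obtain k where k: "finite k" "C \<subseteq> (\<Union>x\<in>k. ball x (e/3))"
      using C[unfolded compact_eq_totally_bounded] e3 by blast
    obtain q where q: "projection q" "\<forall>x\<in>k. norm (x - q * x) \<le> e / 3"
      using ex_projection_finite[OF rr0 k(1) e3] by blast
    have qC: "norm (y - q * y) \<le> e" if "y \<in> C" for y
    proof -
      have "y \<in> (\<Union>x\<in>k. ball x (e/3))" using k(2) that by blast
      then obtain z where z: "z \<in> k" "norm (z - y) < e / 3" by (auto simp: dist_norm)
      have "norm (q * (z - y)) \<le> 1 * norm (z - y)"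
        by (intro norm_mult_le norm_projection_le q order_refl)
      moreover have "y - q * y = (z - q * z) - (z - y) + q * (z - y)"
        by (simp add: right_diff_distrib)
      then have e: "y - q * y = (z - q * z) - (z - y) + q * (z - y)" .
      have "norm (y - q * y) \<le> norm (z - q * z) + norm (z - y) + norm (q * (z - y))"
        unfolding e using norm_triangle_ineq[of "(z - q * z) - (z - y)" "q * (z - y)"]
          norm_triangle_ineq4[of "z - q * z" "z - y"] by linarith
      ultimately show ?thesis using z q(2) by fastforce
    qed
    have "q \<in> D" by (simp add: DU)
    \<comment> \<open>In place of a unit, \<open>q\<close> itself is inserted; it is absorbed by
      idempotence.\<close>
    from DE[OF this, of q] obtain a where "\<forall>x\<in>S. q * (q * T x) = a * x" by blast
    then have a: "q * T x = a * x" if "x \<in> S" for x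
      using that by (simp add: projection_idem'[OF q(1)])
    have "norm (T x - a * x) \<le> e * norm x" if "x \<in> S" for x
    proof (rule extend[of "\<lambda>x. T x - a * x", OF _ _ that])
      show "norm (T x - a * x) \<le> e" if "x \<in> B" for x
        using qC[OF TB[OF that]] a[of x] that by (simp add: B_def)
      show "T (r *\<^sub>R x) - a * r *\<^sub>R x = r *\<^sub>R (T x - a * x)" if "x \<in> S" for r x
        using TR[OF that] by (simp add: scaleR_diff_right)
    qed
    then show ?thesis by blast
  qed
  have "\<forall>n. \<exists>a. \<forall>x\<in>S. norm (T x - a * x) \<le> (1 / Suc n) * norm x"
    by (intro allI approx) simp
  then obtain a where a: "\<And>n. \<forall>x\<in>S. norm (T x - a n * x) \<le> (1 / Suc n) * norm x" by metis
  obtain b where b: "a \<longlonglongrightarrow> b"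
  proof (rule Cauchy_left_mult)
    fix e :: real assume e: "e > 0"
    obtain N where N: "1 / real (Suc N) < e / 2"
      using reals_Archimedean[of "e/2"] e by (auto simp: inverse_eq_divide)
    have "norm (a i * x - a j * x) \<le> e * norm x" if ij: "i \<ge> N" "j \<ge> N" and x: "x \<in> S" for i j x
    proof -
      have s: "norm (T x - a k * x) \<le> (e / 2) * norm x" if "k \<ge> N" for k
      proof -
        have "1 / real (Suc k) \<le> 1 / real (Suc N)" using that by (intro divide_left_mono) auto
        then have "(1 / Suc k) * norm x \<le> (e / 2) * norm x"
          using N by (intro mult_right_mono) auto
        moreover have "norm (T x - a k * x) \<le> (1 / Suc k) * norm x" using a x by blast
        ultimately show ?thesis by (rule order_trans[rotated])
      qed
      have "a i * x - a j * x = (T x - a j * x) - (T x - a i * x)" by simp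
      then have "norm (a i * x - a j * x) \<le> norm (T x - a j * x) + norm (T x - a i * x)"
        using norm_triangle_ineq4[of "T x - a j * x" "T x - a i * x"] by simp
      then show ?thesis using s[OF ij(1)] s[OF ij(2)] by (simp add: field_simps)
    qed
    then show "\<exists>N. \<forall>i\<ge>N. \<forall>j\<ge>N. \<forall>x\<in>S. norm (a i * x - a j * x) \<le> e * norm x" by blast
  qed
  have "T x = b * x" if x: "x \<in> S" for x
  proof -
    have "(\<lambda>n. T x - a n * x) \<longlonglongrightarrow> 0"
    proof (rule Lim_null_comparison)
      show "\<forall>\<^sub>F n in sequentially. norm (T x - a n * x) \<le> (1 / Suc n) * norm x"
        using a x by (intro always_eventually allI) blast
      show "(\<lambda>n. (1 / Suc n) * norm x) \<longlonglongrightarrow> 0"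
        by (rule tendsto_mult_left_zero[OF LIMSEQ_Suc[OF lim_1_over_n]])
    qed
    moreover have "(\<lambda>n. T x - a n * x) \<longlonglongrightarrow> T x - b * x"
      by (intro tendsto_intros b)
    ultimately have "T x - b * x = 0" using LIMSEQ_unique by blast
    then show ?thesis by simp
  qed
  then show ?thesis by blast
qed

lemma elementary: "elementary TYPE('a)"
proof -
  define \<phi> where "\<phi> a = (\<lambda>x\<in>S. a * x)" for a
  have \<phi>: "\<phi> a x = a * x" if "x \<in> S" for a x using that by (simp add: \<phi>_def)
  have range: "\<phi> a \<in> compact_operators H" for a
  proof -
    have "\<phi> a ` B = (\<lambda>x. a * x) ` B" by (rule image_cong) (auto simp: B_def \<phi>)
    then show ?thesis using compact_left_mult[of a]
      by (auto simp: compact_operators_H \<phi> S_closed distrib_left mult_scaleC_right \<phi>_def)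
  qed
  have "bij_betw \<phi> UNIV (compact_operators H)"
    unfolding bij_betw_def
  proof
    show "inj \<phi>"
    proof (rule injI)
      fix a b assume eq: "\<phi> a = \<phi> b"
      have "(a - b) * x = 0" if "x \<in> S" for x
        using fun_cong[OF eq, of x] that by (simp add: \<phi> left_diff_distrib)
      then have "a - b = 0" by (rule S_mult_zero)
      then show "a = b" by simp
    qed
    show "range \<phi> = compact_operators H"
    proof
      show "range \<phi> \<subseteq> compact_operators H" using range by blast
      show "compact_operators H \<subseteq> range \<phi>"
      proof
        fix T assume T: "T \<in> compact_operators H"
        obtain a where a: "\<forall>x\<in>S. T x = a * x"
          using compact_operator_left_mult[OF T] by blast
        have "T \<in> extensional S" using T by (auto simp: compact_operators_H PiE_def)
        then have "T = \<phi> a"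
          by (rule extensionalityI[of _ S]) (use a in \<open>auto simp: \<phi>_def\<close>)
        then show "T \<in> range \<phi>" by blast
      qed
    qed
  qed
  moreover have "ip (\<phi> a x) y = ip x (\<phi> (star a) y)" if "x \<in> S" "y \<in> S" for a x y
    using that ip[of x "star a * y"]
    by (intro ip_eqI) (simp add: \<phi> S_closed star_mult star_star mult.assoc)
  ultimately have "iso_compact_operators \<phi> H"
    unfolding iso_compact_operators_def
    by (simp add: \<phi> S_closed distrib_right mult_scaleC_left mult.assoc)
  with hilbert show ?thesis unfolding elementary_def by blast
qed

end

section \<open>Extreme points and one-sided invertibility\<close>

lemma norm_le_one: "(norm x)\<^sup>2 \<le> 1 \<Longrightarrow> norm x \<le> 1"
  using power2_le_imp_le[of "norm x" 1] by simp

text \<open>For small \<open>y\<close> the perturbation x = DyT keeps both v + x and v - x in the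
  unit ball, so extremality forces x = 0. Indeed \<open>star (v + x) * (v + x)\<close> differs from
  \<open>star v * v\<close> by ThT with \<open>h\<close> self-adjoint of norm at most 1, and ThT is
  below \<open>T\<close>, the room left under 1.\<close>

lemma extreme_point_defect:
  fixes v :: "'b::unital_cstar_algebra"
  assumes v: "v extreme_point_of cball 0 1"
  shows "(1 - v * star v) * y * (1 - star v * v) = 0"
proof -
  have nv: "norm v \<le> 1" using v by (simp add: extreme_point_of_def)
  define D where "D = 1 - v * star v"
  define T where "T = 1 - star v * v"
  \<comment> \<open>With norm 1/8 the three terms of \<open>h\<close> below add up to at most 1/8 +
    1/8 + 1/64.\<close>
  have small: "D * y * T = 0" if y: "norm y \<le> 1/8" for y
  proof -
    define x where "x = D * y * T"
    have sT: "star T = T" "star D = D"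
      by (simp_all add: T_def D_def star_diff star_one star_mult star_star)
    have vD: "star v * D = T * star v" "D * v = v * T" by (simp_all add: D_def T_def algebra_simps)
    have T1: "norm T \<le> 1" unfolding T_def
      using norm_diff_pos_le[OF pos_star_mult, of v 1] nv power_le_one[of "norm v" 2] by (simp add: cstar_identity)
    have D1: "norm D \<le> 1" unfolding D_def
      using norm_diff_pos_le[OF pos_mult_star, of v 1] nv power_le_one[of "norm v" 2] cstar_identity[of "star v"]
      by (simp add: star_star norm_star)
    have "positive T" unfolding T_def
      using pos_norm_star_mult[of v 1] nv by (simp add: power_le_one)
    then obtain R where R: "self_adjoint R" "R * R = T" "bicommutes T R" "positive R"
      by (rule pos_sqrtE)
    have R1: "norm R \<le> 1" using norm_sa_square[OF R(1)] T1 R(2) by (intro norm_le_one) simp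
    have key: "norm (v + s *\<^sub>R x) \<le> 1" if s: "\<bar>s\<bar> = 1" for s
    proof -
      define z where "z = s *\<^sub>R y"
      have nz: "norm z \<le> 1/8" using y s by (simp add: z_def)
      define h where "h = star v * z + star z * v + star z * D * D * z"
      have sh: "self_adjoint h"
        by (simp add: h_def self_adjoint_def star_add star_mult star_star sT algebra_simps)
      have "norm h \<le> norm (star v * z) + norm (star z * v) + norm (star z * D * D * z)"
        unfolding h_def using norm_triangle_ineq[of "star v * z" "star z * v"]
          norm_triangle_ineq[of "star v * z + star z * v" "star z * D * D * z"] by linarith
      also have "\<dots> \<le> 1 * (1/8) + (1/8) * 1 + ((1/8) * 1 * 1) * (1/8)"
        by (intro add_mono norm_mult_le nv nz D1) (simp_all only: norm_star nv nz)
      finally have nh: "norm h \<le> 1" by simp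
      have "norm (R * h * R) \<le> 1 * 1 * 1" by (intro norm_mult_le R1 nh)
      then have "positive (1 *\<^sub>R 1 - R * h * R)" by (intro pos_norm_minus sa_conj sh R) simp
      then have "positive (R * (1 *\<^sub>R 1 - R * h * R) * R)" by (rule pos_conj_sa) (rule R)
      also have "R * (1 *\<^sub>R 1 - R * h * R) * R = T - T * h * T"
        by (simp add: right_diff_distrib left_diff_distrib R(2)[symmetric] mult.assoc)
      also have "\<dots> = 1 *\<^sub>R 1 - star (v + s *\<^sub>R x) * (v + s *\<^sub>R x)"
      proof -
        have x: "s *\<^sub>R x = D * z * T" by (simp add: x_def z_def)
        have a: "star v * (D * z * T) = T * (star v * z) * T" by (simp add: vD flip: mult.assoc)
        have b: "star (D * z * T) * v = T * (star z * v) * T"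
          by (simp add: star_mult sT mult.assoc vD)
        have c: "star (D * z * T) * (D * z * T) = T * (star z * D * D * z) * T"
          by (simp add: star_mult sT mult.assoc)
        have "star (v + D * z * T) * (v + D * z * T) = star v * v + T * h * T"
          by (simp only: star_add distrib_left distrib_right a b c h_def) simp
        then show ?thesis unfolding x by (simp add: T_def)
      qed
      finally have "(norm (v + s *\<^sub>R x))\<^sup>2 \<le> 1" by (rule norm_power2_le_if_pos) simp
      then show ?thesis by (rule norm_le_one)
    qed
    show ?thesis
    proof (rule ccontr)
      assume "D * y * T \<noteq> 0"
      then have x0: "x \<noteq> 0" by (simp add: x_def)
      have "v \<in> open_segment (v + x) (v - x)"
      proof -
        have "v + x \<noteq> v - x"
        proof
          assume "v + x = v - x"
          then have "2 *\<^sub>R x = 0" by (simp add: scaleR_2 eq_diff_eq add.assoc)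
          with x0 show False by simp
        qed
        moreover have "v = (1 - 1/2) *\<^sub>R (v + x) + (1/2) *\<^sub>R (v - x)"
          by (simp add: algebra_simps flip: scaleR_left_distrib)
        ultimately show ?thesis unfolding in_segment by (intro conjI exI[of _ "1/2::real"]) auto
      qed
      moreover have "v + x \<in> cball 0 1" "v - x \<in> cball 0 1" using key[of 1] key[of "-1"]
        by simp_all
      ultimately show False using v unfolding extreme_point_of_def by blast
    qed
  qed
  define t where "t = 1 / (8 * (norm y + 1))"
  have n: "norm y + 1 > 0" by (simp add: add_nonneg_pos)
  have t: "t > 0" using n by (simp add: t_def)
  have "t * norm y \<le> t * (norm y + 1)" using t by (intro mult_left_mono) auto
  also have "\<dots> = 1/8" using n by (simp add: t_def)
  finally have "norm (t *\<^sub>R y) \<le> 1/8" using t by simp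
  from small[OF this] have "t *\<^sub>R (D * y * T) = 0" by simp
  then show ?thesis using t by (simp add: D_def T_def)
qed

text \<open>Multiplying on the outside by elements of A moves the question to
  \<open>simple_prime\<close>.\<close>

lemma multiplier_prime:
  fixes m n :: "'a::cstar_algebra multiplier"
  assumes simple: "simple TYPE('a)" and z: "\<And>a. m * emb a * n = 0"
  shows "m = 0 \<or> n = 0"
proof (rule ccontr)
  assume "\<not> (m = 0 \<or> n = 0)"
  then obtain b where b: "ml m b \<noteq> 0" using multiplier_eq_if_ml[of m 0]
    by (auto simp: ml_hom)
  have "\<exists>c. mr n c \<noteq> 0"
  proof (rule ccontr)
    assume "\<not> ?thesis"
    then have "c * ml n a = 0" for c a using multiplier_centralizer[of n c a] by simp
    then have "ml n a = 0" for a using eq_zero_if_right_annihilates by blast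
    then have "n = 0" using multiplier_eq_if_ml[of n 0] by (simp add: ml_hom)
    then show False using \<open>\<not> (m = 0 \<or> n = 0)\<close> by simp
  qed
  then obtain c where c: "mr n c \<noteq> 0" ..
  obtain a where a: "ml m b * a * mr n c \<noteq> 0" using simple_prime[OF simple b c] by blast
  have "emb (ml m b * a * mr n c) = (m * emb b) * emb a * (emb c * n)"
    by (simp add: emb_hom mult_emb emb_mult)
  also have "\<dots> = m * emb (b * a * c) * n" by (simp add: emb_hom mult.assoc)
  also have "\<dots> = 0" by (rule z)
  finally show False using a by (simp add: emb_inject flip: emb_hom(1))
qed

lemma extreme_point_one_sided:
  fixes v :: "'a::cstar_algebra multiplier"
  assumes "simple TYPE('a)" "v \<in> extreme_points"
  shows "star v * v = 1 \<or> v * star v = 1"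
proof -
  have "1 - v * star v = 0 \<or> 1 - star v * v = 0"
    using assms by (intro multiplier_prime extreme_point_defect) (auto simp: extreme_points_def)
  then show ?thesis by auto
qed

text \<open>Extreme points are isometries or coisometries here, and invertible factors keep them
  one-sided invertible. So extremal richness becomes density of the one-sided invertible
  elements.\<close>

lemma extremally_rich_approx:
  fixes w :: "'a::cstar_algebra multiplier"
  assumes "simple TYPE('a)" "extremally_rich TYPE('a multiplier)" "e > 0"
  shows "\<exists>y l. norm (w - y) < e \<and> (l * y = 1 \<or> y * l = 1)"
proof -
  have "w \<in> closure {a * v * b | a v b :: 'a multiplier.
      a \<in> invertible_elements \<and> v \<in> extreme_points \<and> b \<in> invertible_elements}"
    using assms(2) by (simp add: extremally_rich_def)
  then obtain a v b where avb: "a \<in> invertible_elements" "v \<in> extreme_points" "b \<in> invertible_elements"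
    and d: "dist (a * v * b) w < e"
    using assms(3) unfolding closure_approachable by blast
  obtain a' b' where a': "a * a' = 1" "a' * a = 1" and b': "b * b' = 1" "b' * b = 1"
    using avb(1,3) by (auto simp: invertible_elements_def)
  have n: "norm (w - a * v * b) < e" using d by (simp add: dist_norm norm_minus_commute)
  from extreme_point_one_sided[OF assms(1) avb(2)] show ?thesis
  proof
    assume v: "star v * v = 1"
    have "(b' * star v * a') * (a * v * b) = b' * (star v * ((a' * a) * v)) * b"
      by (simp only: mult.assoc)
    also have "\<dots> = 1" by (simp add: a' b' v)
    finally show ?thesis using n by blast
  next
    assume v: "v * star v = 1"
    have "(a * v * b) * (b' * star v * a') = a * (v * ((b * b') * star v)) * a'"
      by (simp only: mult.assoc)
    also have "\<dots> = 1" by (simp add: a' b' v)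
    finally show ?thesis using n by blast
  qed
qed

section \<open>Partial isometries close to one-sided invertible elements\<close>

lemma star_mult_eq_zero: "star x * x = 0 \<Longrightarrow> x = (0::'a::cstar_algebra)"
  using cstar_identity[of x] by simp

lemma partial_isometry:
  fixes v :: "'a::cstar_algebra"
  assumes "projection (star v * v)"
  shows "v * (star v * v) = v" "star v * (v * star v) = star v" "projection (v * star v)"
proof -
  let ?r = "star v * v" and ?w = "v * (star v * v) - v"
  have rr: "star v * (v * (star v * v)) = star v * v"
    using assms by (simp add: projection_def mult.assoc)
  have "star ?w * ?w = 0"
    by (simp add: star_diff star_mult star_star algebra_simps rr)
  then show 1: "v * (star v * v) = v" using star_mult_eq_zero[of ?w] by simp
  show "star v * (v * star v) = star v"
    using arg_cong[OF 1, of star] by (simp add: star_mult star_star mult.assoc)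
  then show "projection (v * star v)" by (simp add: projection_def star_mult star_star mult.assoc)
qed

text \<open>In Murray-von Neumann terms: \<open>1 - w\<^sup>*w\<close> is subequivalent to \<open>1 - ww\<^sup>*\<close> if \<open>w\<close> is close to a
  left invertible element, because the latter is injective on the kernel of \<open>w\<^sup>*y\<close>.\<close>

lemma left_invertible_near_partial_isometry:
  fixes w y l e f :: "'b::unital_cstar_algebra"
  assumes e: "projection e" and f: "star w * w = 1 - e" "w * star w = 1 - f"
    and y: "l * y = 1" "norm (w - y) < 1"
  shows "\<exists>m c. m * c = e \<and> e * m = m \<and> f * c = c \<and> c * e = c"
proof -
  define q where "q = 1 - e"
  have q: "projection q" unfolding q_def by (rule projection_compl[OF e])
  note ee = projection_idem[OF e] projection_idem'[OF e]
  note qq = projection_idem[OF q] projection_idem'[OF q]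
  have eq: "e * q = 0" "q * e = 0" by (simp_all add: q_def algebra_simps ee)
  have eq': "e * (q * x) = 0" "q * (e * x) = 0" for x by (simp_all add: eq flip: mult.assoc)
  have wq: "w * q = w" "q * star w = star w"
    using partial_isometry(1,2)[of w] q f(1) by (simp_all add: q_def flip: mult.assoc)
  have nw: "norm (star w) \<le> 1"
    using norm_projection_le[OF q] f(1) cstar_identity[of w]
    by (intro norm_le_one) (simp add: q_def norm_star)
  define s where "s = star w * y"
  have qs: "q * s = s" by (simp add: s_def wq flip: mult.assoc)
  \<comment> \<open>As \<open>star w * w = q\<close> and \<open>y\<close> is close to
    \<open>w\<close>, the element \<open>s * q\<close> is close to \<open>q\<close>, and
    \<open>X\<close> is close to 1; then \<open>q * Y\<close> is a right inverse of \<open>s\<close>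
    relative to \<open>q\<close>.\<close>
  define X where "X = e + s * q"
  have "1 - X = star w * (w - y) * q"
    by (simp add: X_def s_def algebra_simps wq) (simp add: f q_def flip: mult.assoc)
  also have "norm \<dots> \<le> (1 * norm (w - y)) * 1"
    by (intro norm_mult_le nw norm_projection_le q order_refl)
  finally have "norm (1 - X) < 1" using y(2) by simp
  then have "invertible_el X" by (rule invertible_near_one)
  then obtain Y where Y: "X * Y = 1" "Y * X = 1" by (auto simp: invertible_el_def)
  have "X * q = q * X"
    by (simp add: X_def algebra_simps eq qq flip: mult.assoc) (simp add: qs mult.assoc qq)
  then have Yq: "Y * q = q * Y" by (rule inverse_commutes[OF Y])
  have st: "s * (q * Y) = q"
  proof -
    have "q = (X * q) * Y" using Y Yq by (simp add: mult.assoc) (simp add: Y flip: mult.assoc Yq)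
    also have "X * q = s * q" by (simp add: X_def algebra_simps eq qq)
    finally show ?thesis by (simp add: mult.assoc)
  qed
  \<comment> \<open>The correction term makes \<open>s * x\<close> vanish, so \<open>y * x\<close>
    is annihilated by \<open>star w\<close> and therefore lies under \<open>f\<close>.\<close>
  define x where "x = e - q * Y * s * e"
  define c where "c = y * x"
  have "star w * c = s * e - (s * (q * Y)) * s * e" by (simp add: c_def x_def s_def algebra_simps)
  also have "\<dots> = 0" unfolding st by (simp add: qs)
  finally have "star w * c = 0" .
  then have "(1 - f) * c = 0" by (simp add: mult.assoc flip: f)
  then have fc: "f * c = c" by (simp add: left_diff_distrib)
  have lc: "l * c = x" by (simp add: c_def y flip: mult.assoc)
  have "(e * l) * c = e" by (simp add: mult.assoc lc x_def right_diff_distrib ee eq')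
  moreover have "c * e = c" by (simp add: c_def x_def left_diff_distrib mult.assoc ee)
  moreover have "e * (e * l) = e * l" by (simp add: ee)
  ultimately show ?thesis using fc by blast
qed

section \<open>Approximate units and small projections\<close>

text \<open>Otherwise \<open>p\<close> is minimal, its corner is scalar, and A is
  elementary.\<close>

lemma ex_proper_subprojection:
  fixes p :: "'a::cstar_algebra"
  assumes "simple TYPE('a)" "nonunital_real_rank_zero TYPE('a)" "\<not> elementary TYPE('a)"
    and p: "projection p" "p \<noteq> 0"
  shows "\<exists>r. projection r \<and> r \<noteq> 0 \<and> r \<noteq> p \<and> p * r = r"
proof (rule ccontr)
  assume "\<not> ?thesis"
  then have min: "r = 0 \<or> r = p" if "projection r" "p * r = r" "r * p = r" for r
    using that by blast
  have "\<exists>l. p * z * p = l *\<^sub>C p" for z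
    by (rule minimal_projection_scalar[OF assms(2) p(1)]) (rule min)
  then have "minimal_projection p" using assms p by unfold_locales
  then show False using assms(3) minimal_projection.elementary by blast
qed

text \<open>Primeness gives a nonzero x = d'ys, where d' is a proper subprojection of
  \<open>d\<close>. Normalizing \<open>x\<close> on an approximate spectral projection yields
  \<open>v\<close>, whose range lies under d' and so cannot be all of \<open>d\<close>.\<close>

lemma ex_small_partial_isometry:
  fixes d s :: "'a::cstar_algebra"
  assumes simple: "simple TYPE('a)" and rr0: "nonunital_real_rank_zero TYPE('a)" and ne: "\<not> elementary TYPE('a)"
    and d: "projection d" "d \<noteq> 0" and s: "projection s" "s \<noteq> 0"
  shows "\<exists>v. projection (star v * v) \<and> star v * v \<noteq> 0 \<and> v * s = v \<and> d * v = v \<and> v * star v \<noteq> d"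
proof -
  obtain d' where d': "projection d'" "d' \<noteq> 0" "d' \<noteq> d" "d * d' = d'"
    using ex_proper_subprojection[OF simple rr0 ne d] by blast
  obtain y where y: "d' * y * s \<noteq> 0" using simple_prime[OF simple d'(2) s(2)] by blast
  define x where "x = d' * y * s"
  have x0: "(norm x)\<^sup>2 > 0" using y by (simp add: x_def)
  have xs: "x * s = x" by (simp add: x_def mult.assoc projection_idem[OF s(1)])
  have c: "0 < (norm x)\<^sup>2 / 2" "(norm x)\<^sup>2 / 2 < (norm x)\<^sup>2" using x0 by simp_all
  obtain r k where r: "projection r" "r \<noteq> 0" "s * r = r" "r * s = r"
    "\<forall>y. (norm x)\<^sup>2 / 2 * (norm (r * y))\<^sup>2 \<le> (norm (x * r * y))\<^sup>2"
    "star (x * k) * (x * k) = r" "k * r = k"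
    by (rule ex_spectral_projection_below[OF rr0 s(1) xs c])
  define v where "v = x * k"
  have vr: "star v * v = r" using r(6) by (simp add: v_def)
  have "v * s = x * (k * r) * s" by (simp add: v_def r(7))
  also have "\<dots> = x * (k * (r * s))" by (simp only: mult.assoc)
  also have "\<dots> = v" by (simp add: r v_def)
  finally have vs: "v * s = v" .
  have d'v: "d' * v = v" by (simp add: v_def x_def mult.assoc projection_idem'[OF d'(1)])
  have dv: "d * v = v"
  proof -
    have "d * v = d * (d' * v)" by (simp add: d'v)
    also have "\<dots> = (d * d') * v" by (simp only: mult.assoc)
    also have "\<dots> = v" by (simp add: d' d'v)
    finally show ?thesis .
  qed
  have "v * star v \<noteq> d"
  proof
    assume eq: "v * star v = d"
    have "d' * d = (d' * v) * star v" by (simp only: mult.assoc eq[symmetric])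
    then have "d' * d = d" by (simp add: d'v eq)
    moreover have "star (d * d') = star d'" by (simp add: d')
    then have "d' * d = d'" using d(1) d'(1) by (simp add: star_mult projection_def)
    ultimately show False using d'(3) by simp
  qed
  with vr r vs dv show ?thesis by (intro exI[of _ v]) simp
qed

lemma ex_approximate_unit:
  assumes nonunital: "nonunital TYPE('a::cstar_algebra)" and sep: "separable_space (euclidean :: 'a topology)"
    and rr0: "nonunital_real_rank_zero TYPE('a)"
  shows "\<exists>e :: nat \<Rightarrow> 'a. (\<forall>n. projection (e n) \<and> e n \<noteq> 0 \<and> e (Suc n) * e n = e n \<and> e n \<noteq> e (Suc n)) \<and>
    (\<forall>a. (\<lambda>n. e n * a) \<longlonglongrightarrow> a)"
proof -
  obtain C :: "'a set" where C: "countable C" "closure C = UNIV"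
    using sep by (auto simp: separable_space_def)
  have "C \<noteq> {}" using C(2) by auto
  define a where "a = from_nat_into C"
  have aC: "range a = C" using C(1) \<open>C \<noteq> {}\<close> by (simp add: a_def)
  have step: "\<exists>p. projection p \<and> p * q = q \<and> p \<noteq> q \<and> (\<forall>k\<le>n. norm (a k - p * a k) \<le> 1 / Suc n)"
    if q: "projection q" for q and n :: nat
  proof -
    obtain x where x: "q * x \<noteq> x"
    proof (rule ccontr)
      assume "\<not> thesis"
      then have 1: "q * x = x" for x using that by blast
      have "x * q = x" for x
        using arg_cong[OF 1[of "star x"], of star] q by (simp add: star_mult star_star projection_def)
      with 1 show False using nonunital unfolding nonunital_def by blast
    qed
    \<comment> \<open>\<open>x\<close> is an element that \<open>q\<close> does not fix; it exists
      because A has no unit. Demanding at most half of its defect forces \<open>p\<close> to differ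
      from \<open>q\<close>.\<close>
    define \<epsilon> where "\<epsilon> = min (1 / Suc n) (norm (x - q * x) / 2)"
    have \<epsilon>: "\<epsilon> > 0" using x by (simp add: \<epsilon>_def)
    have "finite (insert x (a ` {..n}))" by simp
    from ex_projection_above_finite[OF rr0 this \<epsilon> q] obtain p
      where p: "projection p" "p * q = q" "\<forall>y\<in>insert x (a ` {..n}). norm (y - p * y) \<le> \<epsilon>" by blast
    have "p \<noteq> q"
    proof
      assume "p = q"
      then have "norm (x - q * x) \<le> norm (x - q * x) / 2" using p(3)
        by (simp add: \<epsilon>_def)
      then show False using x by simp
    qed
    moreover have "\<forall>k\<le>n. norm (a k - p * a k) \<le> 1 / Suc n"
      using p(3) by (auto simp: \<epsilon>_def)
    ultimately show ?thesis using p by blast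
  qed
  have "\<exists>e. \<forall>n. (projection (e n) \<and> e n \<noteq> 0) \<and>
    (e (Suc n) * e n = e n \<and> e (Suc n) \<noteq> e n \<and> (\<forall>k\<le>n. norm (a k - e (Suc n) * a k) \<le> 1 / Suc n))"
  proof (rule dependent_nat_choice)
    show "\<exists>x::'a. projection x \<and> x \<noteq> 0"
      using step[OF projection_zero, of 0] by blast
    fix x :: 'a and n assume x: "projection x \<and> x \<noteq> 0"
    obtain p where p: "projection p" "p * x = x" "p \<noteq> x" "\<forall>k\<le>n. norm (a k - p * a k) \<le> 1 / Suc n"
      using step[of x n] x by blast
    then have "p \<noteq> 0" using x by auto
    then show "\<exists>y. (projection y \<and> y \<noteq> 0) \<and> y * x = x \<and> y \<noteq> x \<and> (\<forall>k\<le>n. norm (a k - y * a k) \<le> 1 / Suc n)"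
      using p by blast
  qed
  then obtain e where e: "\<And>n. projection (e n)" "\<And>n. e n \<noteq> 0" "\<And>n. e (Suc n) * e n = e n"
    "\<And>n. e (Suc n) \<noteq> e n" "\<And>n k. k \<le> n \<Longrightarrow> norm (a k - e (Suc n) * a k) \<le> 1 / Suc n" by metis
  have "(\<lambda>n. e n * b) \<longlonglongrightarrow> b" for b
  proof (rule metric_LIMSEQ_I)
    fix \<epsilon> :: real assume \<epsilon>: "\<epsilon> > 0"
    have "b \<in> closure C" using C(2) by simp
    then obtain k where k: "norm (b - a k) < \<epsilon> / 4"
      using \<epsilon> aC unfolding closure_approachable
      by (metis dist_norm norm_minus_commute rangeE zero_less_divide_iff zero_less_numeral)
    obtain N where N: "1 / real (Suc N) < \<epsilon> / 4"
      using reals_Archimedean[of "\<epsilon>/4"] \<epsilon> by (auto simp: inverse_eq_divide)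
    have "dist (e n * b) b < \<epsilon>" if n: "n \<ge> Suc (max k N)" for n
    proof -
      obtain m where m: "n = Suc m" "m \<ge> k" "m \<ge> N" using n by (cases n) auto
      have "1 / real (Suc m) \<le> 1 / real (Suc N)" using m by (intro divide_left_mono) auto
      then have 1: "norm (a k - e n * a k) < \<epsilon> / 4" using e(5)[OF m(2)] N m(1) by simp
      have 2: "norm (e n * (b - a k)) \<le> 1 * norm (b - a k)"
        by (intro norm_mult_le norm_projection_le e order_refl)
      have eq: "e n * b - b = e n * (b - a k) - (a k - e n * a k) - (b - a k)"
        by (simp add: right_diff_distrib)
      have "norm (e n * b - b) \<le> norm (e n * (b - a k)) + norm (a k - e n * a k) + norm (b - a k)"
        unfolding eq using norm_triangle_ineq4[of "e n * (b - a k) - (a k - e n * a k)" "b - a k"]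
          norm_triangle_ineq4[of "e n * (b - a k)" "a k - e n * a k"] by linarith
      then show ?thesis using 1 2 k \<epsilon> by (simp add: dist_norm)
    qed
    then show "\<exists>N. \<forall>n\<ge>N. dist (e n * b) b < \<epsilon>" by blast
  qed
  then show ?thesis using e by (intro exI[of _ e]) (metis (no_types))
qed

text \<open>The two pointwise limits are the components of a double centralizer, because the
  relation between them passes to the limit.\<close>

lemma multiplier_strict_limit:
  fixes T :: "nat \<Rightarrow> 'a::cstar_algebra"
  assumes bound: "\<And>n. norm (T n) \<le> K"
    and left: "\<And>a. convergent (\<lambda>n. T n * a)" and right: "\<And>a. convergent (\<lambda>n. a * T n)"
  shows "\<exists>w :: 'a multiplier. \<forall>a. (\<lambda>n. T n * a) \<longlonglongrightarrow> ml w a \<and> (\<lambda>n. a * T n) \<longlonglongrightarrow> mr w a"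
proof -
  define L where "L a = lim (\<lambda>n. T n * a)" for a
  define R where "R a = lim (\<lambda>n. a * T n)" for a
  have L: "(\<lambda>n. T n * a) \<longlonglongrightarrow> L a" for a unfolding L_def using left convergent_LIMSEQ_iff by blast
  have R: "(\<lambda>n. a * T n) \<longlonglongrightarrow> R a" for a unfolding R_def using right convergent_LIMSEQ_iff by blast
  have "bounded_linear L"
  proof (rule bounded_linear_intro[of _ K])
    show "L (x + y) = L x + L y" for x y
      using tendsto_add[OF L[of x] L[of y]] by (intro LIMSEQ_unique[OF L]) (simp add: distrib_left)
    show "L (r *\<^sub>R x) = r *\<^sub>R L x" for r x
      using tendsto_scaleR[OF tendsto_const[of r] L[of x]] by (intro LIMSEQ_unique[OF L]) simp
    show "norm (L x) \<le> norm x * K" for x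
    proof (rule LIMSEQ_le_const2[OF tendsto_norm[OF L]], intro exI allI impI)
      show "norm (T n * x) \<le> norm x * K" for n
        using norm_mult_le[OF bound[of n] order_refl[of "norm x"]] by (simp add: mult.commute)
    qed
  qed
  moreover have "bounded_linear R"
  proof (rule bounded_linear_intro[of _ K])
    show "R (x + y) = R x + R y" for x y
      using tendsto_add[OF R[of x] R[of y]] by (intro LIMSEQ_unique[OF R]) (simp add: distrib_right)
    show "R (r *\<^sub>R x) = r *\<^sub>R R x" for r x
      using tendsto_scaleR[OF tendsto_const[of r] R[of x]] by (intro LIMSEQ_unique[OF R]) simp
    show "norm (R x) \<le> norm x * K" for x
    proof (rule LIMSEQ_le_const2[OF tendsto_norm[OF R]], intro exI allI impI)
      show "norm (x * T n) \<le> norm x * K" for n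
        by (rule norm_mult_le[OF order_refl bound])
    qed
  qed
  ultimately have app: "blinfun_apply (Blinfun L) = L" "blinfun_apply (Blinfun R) = R"
    by (simp_all add: bounded_linear_Blinfun_apply)
  have c: "blinfun_apply (Blinfun R) a * b = a * blinfun_apply (Blinfun L) b" for a b
    unfolding app
  proof (rule LIMSEQ_unique)
    show "(\<lambda>n. a * T n * b) \<longlonglongrightarrow> R a * b" by (intro tendsto_intros R)
    show "(\<lambda>n. a * T n * b) \<longlonglongrightarrow> a * L b"
      unfolding mult.assoc by (intro tendsto_intros L)
  qed
  show ?thesis
    by (rule exI[of _ "mk_multiplier (Blinfun L) (Blinfun R)"])
       (simp add: ml_mk[OF c] mr_mk[OF c] app L R)
qed

section \<open>The partial isometry\<close>

text \<open>The \<open>d n\<close> are shrinking projections under the increments of the approximate unit, and \<open>v n\<close>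
  identifies \<open>d (Suc n)\<close> with a proper subprojection of \<open>d n\<close>. Swapping these pieces gives a partial
  isometry with initial projection \<open>1 - e 0\<close> and final projection \<open>1 - (\<Sum>n. f n)\<close>.\<close>

locale ladder =
  fixes e d v :: "nat \<Rightarrow> 'a::cstar_algebra"
  assumes e_proj: "projection (e n)"
    and e_Suc: "e (Suc n) * e n = e n"
    and e_lim: "(\<lambda>n. e n * a) \<longlonglongrightarrow> a"
    and d_0: "d 0 = e 0"
    and d_proj: "projection (d n)"
    and d_nonzero: "d n \<noteq> 0"
    and d_v: "d n * v n = v n"
    and v_init: "star (v n) * v n = d (Suc n)"
    and v_proper: "v n * star (v n) \<noteq> d n"
    and v_r: "v n * (e (Suc n) - e n) = v n"
begin

definition r where "r n = e (Suc n) - e n"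
definition f where "f n = d n - v n * star (v n)"
text \<open>\<open>w n\<close> moves \<open>d (Suc n)\<close> into \<open>d n\<close> by
  \<open>v n\<close> and fixes the rest of \<open>r n\<close>. The vacated \<open>d (Suc n)\<close>
  is refilled by \<open>v (Suc n)\<close>, except for \<open>f (Suc n)\<close>.\<close>

definition w where "w n = v n + (r n - d (Suc n))"
definition T where "T n = (\<Sum>i<n. w i)"
definition g where "g n = (\<Sum>i<n. f i)"

section \<open>Relations among the pieces of the ladder\<close>

lemma e_idem: "e n * e n = e n" "star (e n) = e n" using e_proj by (simp_all add: projection_def)
lemma d_idem: "d n * d n = d n" "star (d n) = d n" using d_proj by (simp_all add: projection_def)

lemma e_mono: "m \<le> n \<Longrightarrow> e n * e m = e m" "m \<le> n \<Longrightarrow> e m * e n = e m"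
proof -
  show 1: "e n * e m = e m" if "m \<le> n" for m n
    using that
  proof (induction n rule: dec_induct)
    case (step n)
    have "e (Suc n) * e m = e (Suc n) * (e n * e m)" by (simp add: step.IH)
    also have "\<dots> = (e (Suc n) * e n) * e m" by (simp only: mult.assoc)
    also have "\<dots> = e m" by (simp only: e_Suc step.IH)
    finally show ?case .
  qed (simp add: e_idem)
  show "e m * e n = e m" if "m \<le> n"
    using arg_cong[OF 1[OF that], of star] by (simp add: star_mult e_idem)
qed

lemma e_r: "k \<le> n \<Longrightarrow> e k * r n = 0" "k \<le> n \<Longrightarrow> r n * e k = 0"
  by (simp_all add: r_def right_diff_distrib left_diff_distrib e_mono)

lemma r_idem: "r n * r n = r n" "star (r n) = r n"
  by (simp_all add: r_def algebra_simps e_idem e_mono star_diff)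

lemma v_r': "v n * r n = v n" by (simp add: r_def v_r)

lemma v_d: "v n * d (Suc n) = v n"
  using partial_isometry(1)[of "v n"] by (simp add: v_init d_proj)

lemma star_v: "r n * star (v n) = star (v n)" "star (v n) * d n = star (v n)"
  using arg_cong[OF v_r'[of n], of star] arg_cong[OF d_v[of n], of star]
  by (simp_all add: star_mult r_idem d_idem)

lemma d_r: "d (Suc n) * r n = d (Suc n)" "r n * d (Suc n) = d (Suc n)"
proof -
  show 1: "d (Suc n) * r n = d (Suc n)" unfolding v_init[symmetric] mult.assoc v_r' ..
  show "r n * d (Suc n) = d (Suc n)" using arg_cong[OF 1, of star]
    by (simp add: star_mult r_idem d_idem)
qed

lemma e_d: "n \<le> k \<Longrightarrow> e k * d n = d n" "n \<le> k \<Longrightarrow> d n * e k = d n"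
  "k < n \<Longrightarrow> e k * d n = 0" "k < n \<Longrightarrow> d n * e k = 0"
proof -
  have er: "e k * r n = r n" if "n < k" for n k using that by (simp add: r_def right_diff_distrib e_mono)
  show 1: "e k * d n = d n" if "n \<le> k" for n k
  proof (cases n)
    case 0 then show ?thesis by (simp add: d_0 e_mono)
  next
    case (Suc m)
    then have "e k * d n = (e k * r m) * d n" by (simp add: d_r mult.assoc)
    then show ?thesis using that Suc by (simp add: er d_r)
  qed
  show "d n * e k = d n" if "n \<le> k"
    using arg_cong[OF 1[OF that], of star] by (simp add: star_mult e_idem d_idem)
  show 2: "e k * d n = 0" if kn: "k < n" for n k
  proof -
    obtain m where m: "n = Suc m" "k \<le> m" using kn by (cases n) auto
    then have "e k * d n = (e k * r m) * d n" by (simp add: d_r mult.assoc)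
    then show ?thesis using m by (simp add: e_r)
  qed
  show "d n * e k = 0" if "k < n"
    using arg_cong[OF 2[OF that], of star] by (simp add: star_mult e_idem d_idem star_zero)
qed

lemma d_d: "m < n \<Longrightarrow> d m * d n = 0"
proof -
  assume "m < n"
  have "d m * d n = (d m * e m) * d n" by (simp add: e_d)
  also have "\<dots> = d m * (e m * d n)" by (simp only: mult.assoc)
  finally show "d m * d n = 0" using \<open>m < n\<close> by (simp add: e_d)
qed

lemma d_r0: "d n * r n = 0" "r n * d n = 0"
  by (simp_all add: r_def left_diff_distrib right_diff_distrib e_d)

lemma f_d: "f n * d n = f n" "d n * f n = f n"
  by (simp_all add: f_def left_diff_distrib right_diff_distrib d_idem mult.assoc star_v)
     (simp add: d_v flip: mult.assoc)

lemma f_idem: "f n * f n = f n" "star (f n) = f n" and f_nonzero: "f n \<noteq> 0"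
proof -
  have "f n * (v n * star (v n)) = 0"
    using partial_isometry(1)[of "v n"]
    by (simp add: f_def left_diff_distrib d_v v_init d_proj mult.assoc flip: mult.assoc[of "d n"])
       (metis d_proj mult.assoc v_init v_d)
  then show "f n * f n = f n" by (subst (2) f_def) (simp add: right_diff_distrib f_d)
  show "star (f n) = f n" by (simp add: f_def star_diff d_idem star_mult star_star)
  show "f n \<noteq> 0" using v_proper[of n] by (auto simp: f_def)
qed

lemma f_proj: "projection (f n)" by (simp add: projection_def f_idem)

lemma f_e: "n < k \<Longrightarrow> f k * e n = 0" "k \<le> n \<Longrightarrow> e n * f k = f k" "k \<le> n \<Longrightarrow> f k * e n = f k"
proof -
  show "f k * e n = 0" if "n < k"
    using that e_d(4)[OF that] by (metis f_d(1) mult.assoc mult_zero_right)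
  show "e n * f k = f k" if "k \<le> n"
    using e_d(1)[OF that] by (metis f_d(2) mult.assoc)
  show "f k * e n = f k" if "k \<le> n"
    using e_d(2)[OF that] by (metis f_d(1) mult.assoc)
qed

lemma g_f: "k \<le> n \<Longrightarrow> g k * f n = 0"
proof -
  assume "k \<le> n"
  have "f i * f n = 0" if "i < k" for i
  proof -
    have "f i * f n = f i * (d i * d n) * f n"
      by (simp add: mult.assoc f_d) (simp add: f_d flip: mult.assoc)
    then show ?thesis using that \<open>k \<le> n\<close> by (simp add: d_d)
  qed
  then show ?thesis by (simp add: g_def sum_distrib_right)
qed

lemma g_Suc: "g (Suc n) = g n + f n" by (simp add: g_def)

lemma g_e: "Suc k \<le> n \<Longrightarrow> g n * e k = g (Suc k) * e k"
proof (induction n rule: dec_induct)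
  case (step n)
  then show ?case using f_e(1)[of k n] by (simp add: g_Suc[of n] distrib_right)
qed simp

lemma w_init: "star (w n) * w n = r n" and w_final: "w n * star (w n) = v n * star (v n) + r n - d (Suc n)"
  and w_r: "w n * r n = w n" and dr_w: "(d n + r n) * w n = w n"
proof -
  let ?s = "r n - d (Suc n)"
  have ss: "star ?s = ?s" "?s * ?s = ?s"
    by (simp_all add: star_diff r_idem d_idem algebra_simps d_r)
  have vs: "v n * ?s = 0" by (simp add: right_diff_distrib v_r' v_d)
  have sv: "?s * star (v n) = 0" using arg_cong[OF vs, of star]
    by (simp only: star_mult ss star_zero)
  have dd: "d n * d (Suc n) = 0" by (simp add: d_d)
  have "star (v n) * ?s = (star (v n) * d n) * ?s" by (simp add: star_v)
  also have "\<dots> = 0" unfolding mult.assoc by (simp add: right_diff_distrib d_r0 dd)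
  finally have 1: "star (v n) * ?s = 0" .
  have 2: "?s * v n = 0" using arg_cong[OF 1, of star]
    by (simp only: star_mult ss star_zero star_star)
  have sw: "star (w n) = star (v n) + ?s" by (simp only: w_def star_add ss)
  show "star (w n) * w n = r n"
    unfolding sw unfolding w_def distrib_left distrib_right by (simp only: 1 2 ss v_init) simp
  show "w n * star (w n) = v n * star (v n) + r n - d (Suc n)"
    unfolding sw unfolding w_def distrib_left distrib_right by (simp only: vs sv ss) simp
  show "w n * r n = w n" by (simp add: w_def distrib_right left_diff_distrib v_r' r_idem d_r)
  have rv: "r n * v n = 0" by (subst d_v[symmetric]) (simp add: d_r0 flip: mult.assoc)
  show "(d n + r n) * w n = w n"
    by (simp add: w_def distrib_left distrib_right right_diff_distrib d_v rv d_r0 dd r_idem d_r)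
qed

section \<open>The partial sums and their strict limit\<close>

lemma T_Suc: "T (Suc n) = T n + w n" by (simp add: T_def)

lemma w_e: "k \<le> n \<Longrightarrow> w n * e k = 0"
proof -
  assume k: "k \<le> n"
  have "w n * e k = w n * (r n * e k)" by (simp add: w_r flip: mult.assoc)
  then show "w n * e k = 0" using k by (simp add: e_r)
qed

lemma e_w: "k < n \<Longrightarrow> e k * w n = 0"
proof -
  assume k: "k < n"
  have "e k * w n = (e k * (d n + r n)) * w n" by (simp add: dr_w mult.assoc)
  also have "e k * (d n + r n) = 0" using k by (simp add: distrib_left e_d e_r)
  finally show "e k * w n = 0" by simp
qed

lemma T_e: "k \<le> n \<Longrightarrow> T n * e k = T k * e k"
  by (induction n rule: dec_induct) (simp_all add: T_Suc distrib_right w_e)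

text \<open>One index later than in \<open>T_e\<close>: the range of \<open>w k\<close> still meets
  \<open>e k\<close> through \<open>d k\<close>, so the left product is constant only from
  \<open>Suc k\<close> on.\<close>

lemma e_T: "Suc k \<le> n \<Longrightarrow> e k * T n = e k * T (Suc k)"
  by (induction n rule: dec_induct) (simp_all add: T_Suc distrib_left e_w)

lemma w_e_left: "e (Suc n) * w n = w n"
proof -
  have "e (Suc n) * r n = r n" by (simp add: r_def right_diff_distrib e_mono)
  then have "e (Suc n) * (d n + r n) = d n + r n" by (simp add: distrib_left e_d)
  then have "e (Suc n) * ((d n + r n) * w n) = (d n + r n) * w n"
    by (simp only: mult.assoc[symmetric])
  then show ?thesis by (simp only: dr_w)
qed

lemma d_w: "d (Suc n) * w n = 0"
proof -
  have "d (Suc n) * v n = d (Suc n) * (d n * v n)" by (simp add: d_v)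
  also have "\<dots> = star (d n * d (Suc n)) * v n" by (simp add: star_mult d_idem mult.assoc)
  finally show ?thesis by (simp add: d_d star_zero w_def distrib_left right_diff_distrib d_idem d_r)
qed

lemma T_range: "e n * T n = T n \<and> d n * T n = 0"
proof (induction n)
  case 0 then show ?case by (simp add: T_def)
next
  case (Suc n)
  have "e (Suc n) * T n = e (Suc n) * (e n * T n)" using Suc by simp
  also have "\<dots> = (e (Suc n) * e n) * T n" by (simp only: mult.assoc)
  also have "\<dots> = T n" using Suc by (simp add: e_Suc)
  finally have 1: "e (Suc n) * T n = T n" .
  have "d (Suc n) * T n = d (Suc n) * (e n * T n)" using Suc by simp
  also have "\<dots> = 0" by (simp add: e_d flip: mult.assoc)
  finally have 2: "d (Suc n) * T n = 0" .
  show ?case by (simp add: T_Suc distrib_left 1 2 w_e_left d_w)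
qed

text \<open>The \<open>w n\<close> have orthogonal initial projections and orthogonal ranges, so
  both products telescope. In the final projection \<open>d n\<close> is the gap still open at stage
  \<open>n\<close>; it is orthogonal to \<open>e k\<close> for k < n and so disappears in the strict
  limit.\<close>

lemma T_init: "star (T n) * T n = e n - e 0"
  and T_final: "T n * star (T n) = e n - d n - g n"
proof -
  have 1: "star (T n) * w n = 0" for n
  proof -
    have X: "(e n - d n) * T n = T n" using T_range[of n] by (simp add: left_diff_distrib)
    have "star (T n) = star (T n) * (e n - d n)"
      using arg_cong[OF X, of star] by (simp add: star_mult star_diff e_idem d_idem)
    then have "star (T n) * w n = star (T n) * ((e n - d n) * (d n + r n)) * w n"
      by (metis dr_w mult.assoc)
    also have "(e n - d n) * (d n + r n) = 0"
      by (simp add: algebra_simps e_d e_r d_idem d_r0)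
    finally show ?thesis by simp
  qed
  have 2: "T n * star (w n) = 0" for n
  proof -
    have "T n = T n * e n" for n
    proof (induction n)
      case (Suc n)
      have "w n * e (Suc n) = w n * (r n * e (Suc n))" by (simp add: w_r flip: mult.assoc)
      also have "r n * e (Suc n) = r n" by (simp add: r_def left_diff_distrib e_mono e_idem)
      finally have a: "w n * e (Suc n) = w n" by (simp add: w_r)
      have "T n * e (Suc n) = T n * (e n * e (Suc n))" using Suc by (simp flip: mult.assoc)
      then have "T n * e (Suc n) = T n" using Suc by (simp add: e_mono)
      then show ?case by (simp add: T_Suc distrib_right a)
    qed (simp add: T_def)
    moreover have "star (w n) = r n * star (w n)"
      using arg_cong[OF w_r[of n], of star] by (simp add: star_mult r_idem)
    ultimately have "T n * star (w n) = T n * (e n * r n) * star (w n)" by (metis mult.assoc)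
    then show ?thesis by (simp add: e_r)
  qed
  have 3: "star (w n) * T n = 0" "w n * star (T n) = 0" for n
    using arg_cong[OF 1[of n], of star] arg_cong[OF 2[of n], of star]
    by (simp_all add: star_mult star_star star_zero)
  show "star (T n) * T n = e n - e 0"
  proof (induction n)
    case 0 then show ?case by (simp add: T_def)
  next
    case (Suc n)
    have "star (T (Suc n)) * T (Suc n) = star (T n) * T n + star (w n) * w n"
      by (simp add: T_Suc star_add distrib_left distrib_right 1 3)
    then show ?case by (simp add: Suc w_init r_def)
  qed
  show "T n * star (T n) = e n - d n - g n"
  proof (induction n)
    case 0 then show ?case by (simp add: T_def g_def d_0)
  next
    case (Suc n)
    have "T (Suc n) * star (T (Suc n)) = T n * star (T n) + w n * star (w n)"
      by (simp add: T_Suc star_add distrib_left distrib_right 2 3)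
    then show ?case by (simp add: Suc w_final r_def g_Suc f_def)
  qed
qed

lemma e_lim_right: "(\<lambda>n. a * e n) \<longlonglongrightarrow> a"
  using bounded_linear.tendsto[OF bounded_linear_star e_lim[of "star a"]]
  by (simp add: star_mult star_star e_idem)

lemma norm_T: "norm (T n) \<le> 1"
proof (rule norm_le_one)
  have "projection (e n - e 0)" by (simp add: projection_def algebra_simps e_idem e_mono star_diff)
  then have "norm (star (T n) * T n) \<le> 1" unfolding T_init by (rule norm_projection_le)
  then show "(norm (T n))\<^sup>2 \<le> 1" by (simp add: cstar_identity)
qed

text \<open>On \<open>e k\<close> the sequence is eventually constant, so its oscillation at
  \<open>a\<close> is controlled by how well \<open>e k\<close> fixes \<open>a\<close>.\<close>

lemma convergent_T: "convergent (\<lambda>n. T n * a)" "convergent (\<lambda>n. a * T n)"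
proof -
  have gen: "convergent X"
    if X: "\<And>k m n. m \<ge> Suc k \<Longrightarrow> n \<ge> Suc k \<Longrightarrow> norm (X m - X n) \<le> 2 * norm (b k)"
      and b: "b \<longlonglongrightarrow> 0" for X b :: "nat \<Rightarrow> 'a"
  proof -
    have "Cauchy X"
    proof (rule metric_CauchyI)
      fix \<epsilon> :: real assume "\<epsilon> > 0"
      then have "\<epsilon> / 2 > 0" by simp
      from LIMSEQ_D[OF b this] obtain k where k: "norm (b k) < \<epsilon> / 2" by auto
      have "dist (X m) (X n) < \<epsilon>" if "m \<ge> Suc k" "n \<ge> Suc k" for m n
        using X[OF that] k by (simp add: dist_norm)
      then show "\<exists>M. \<forall>m\<ge>M. \<forall>n\<ge>M. dist (X m) (X n) < \<epsilon>" by blast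
    qed
    then show ?thesis by (simp add: Cauchy_convergent_iff)
  qed
  have nT: "norm (T m - T n) \<le> 2" for m n
    using norm_triangle_ineq4[of "T m" "T n"] norm_T[of m] norm_T[of n] by linarith
  have b1: "(\<lambda>k. a - e k * a) \<longlonglongrightarrow> 0" and b2: "(\<lambda>k. a - a * e k) \<longlonglongrightarrow> 0"
    using tendsto_diff[OF tendsto_const[of a] e_lim[of a]] tendsto_diff[OF tendsto_const[of a] e_lim_right[of a]]
    by simp_all
  show "convergent (\<lambda>n. T n * a)"
  proof (rule gen[OF _ b1])
    fix k m n assume "m \<ge> Suc k" "n \<ge> Suc k"
    then have "T m * e k = T k * e k" "T n * e k = T k * e k" using T_e[of k m] T_e[of k n]
      by simp_all
    then have "(T m - T n) * e k = 0" by (simp only: left_diff_distrib) simp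
    then have "(T m - T n) * (e k * a) = 0" by (simp flip: mult.assoc)
    then have "T m * a - T n * a = (T m - T n) * (a - e k * a)"
      by (simp add: right_diff_distrib left_diff_distrib)
    also have "norm \<dots> \<le> 2 * norm (a - e k * a)" by (rule norm_mult_le[OF nT order_refl])
    finally show "norm (T m * a - T n * a) \<le> 2 * norm (a - e k * a)" .
  qed
  show "convergent (\<lambda>n. a * T n)"
  proof (rule gen[OF _ b2])
    fix k m n assume "m \<ge> Suc k" "n \<ge> Suc k"
    then have "e k * (T m - T n) = 0" using e_T[of k m] e_T[of k n]
      by (simp add: right_diff_distrib)
    then have "a * e k * (T m - T n) = 0" by (simp add: mult.assoc)
    then have "a * T m - a * T n = (a - a * e k) * (T m - T n)"
      by (simp add: right_diff_distrib left_diff_distrib)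
    also have "norm \<dots> \<le> norm (a - a * e k) * 2" by (rule norm_mult_le[OF order_refl nT])
    finally show "norm (a * T m - a * T n) \<le> 2 * norm (a - a * e k)" by simp
  qed
qed

lemma multiplier_eq_if_e:
  assumes "\<And>k. ml m (e k) = ml n (e k)" shows "m = n"
proof (rule multiplier_eq_if_ml)
  fix a
  have mul: "ml m (b * c) = ml m b * c" for m :: "'a multiplier" and b c
    by (rule eq_if_mult_eq) (simp add: multiplier_centralizer[symmetric] mult.assoc[symmetric])
  have lim: "(\<lambda>k. ml m (e k) * a) \<longlonglongrightarrow> ml m a" for m :: "'a multiplier"
    unfolding mul[symmetric] by (intro tendsto_intros e_lim)
  show "ml m a = ml n a" using LIMSEQ_unique[OF lim[of m]] lim[of n] by (simp add: assms)
qed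

text \<open>The final defect is recorded only through its action on the \<open>e k\<close>, where
  the infinite sum of the \<open>f n\<close> breaks off after \<open>f k\<close>; both comparisons
  can be refuted from this.\<close>

lemma ex_partial_isometry:
  "\<exists>W. star W * W = 1 - emb (e 0) \<and> (\<forall>k. ml (1 - W * star W) (e k) = g (Suc k) * e k)"
proof -
  obtain W :: "'a multiplier" where W: "\<And>a. (\<lambda>n. T n * a) \<longlonglongrightarrow> ml W a" "\<And>a. (\<lambda>n. a * T n) \<longlonglongrightarrow> mr W a"
    using multiplier_strict_limit[of T 1] norm_T convergent_T by blast
  have sW: "(\<lambda>n. star (T n) * a) \<longlonglongrightarrow> ml (star W) a" for a
    using bounded_linear.tendsto[OF bounded_linear_star W(2)[of "star a"]]
    by (simp add: star_mult star_star ml_hom)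
  have We: "ml W (e k) = T k * e k" for k
  proof (rule LIMSEQ_unique[OF W(1)])
    have "\<forall>\<^sub>F n in sequentially. T n * e k = T k * e k"
      unfolding eventually_sequentially using T_e by blast
    then show "(\<lambda>n. T n * e k) \<longlonglongrightarrow> T k * e k"
      by (rule tendsto_eventually)
  qed
  have sTe: "star (T n) * e k = star (T (Suc k)) * e k" if "Suc k \<le> n" for n k
    using arg_cong[OF e_T[OF that], of star] by (simp add: star_mult e_idem)
  have sWe: "ml (star W) (e k) = star (T (Suc k)) * e k" for k
  proof (rule LIMSEQ_unique[OF sW])
    have "\<forall>\<^sub>F n in sequentially. star (T n) * e k = star (T (Suc k)) * e k"
      unfolding eventually_sequentially using sTe by blast
    then show "(\<lambda>n. star (T n) * e k) \<longlonglongrightarrow> star (T (Suc k)) * e k"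
      by (rule tendsto_eventually)
  qed
  have "star W * W = 1 - emb (e 0)"
  proof (rule multiplier_eq_if_e)
    fix k
    have "star (T n) * (T k * e k) = e k - e 0 * e k" if n: "k \<le> n" for n
    proof -
      have "star (T n) * (T k * e k) = (star (T n) * T n) * e k"
        using T_e[OF n] by (simp add: mult.assoc)
      then show ?thesis unfolding T_init by (simp add: left_diff_distrib e_mono n)
    qed
    then have "\<forall>\<^sub>F n in sequentially. star (T n) * (T k * e k) = e k - e 0 * e k"
      unfolding eventually_sequentially by blast
    then have "(\<lambda>n. star (T n) * (T k * e k)) \<longlonglongrightarrow> e k - e 0 * e k"
      by (rule tendsto_eventually)
    from LIMSEQ_unique[OF sW this] show "ml (star W * W) (e k) = ml (1 - emb (e 0)) (e k)"
      by (simp add: ml_hom(2,4,8) We ml_emb)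
  qed
  moreover have "ml (1 - W * star W) (e k) = g (Suc k) * e k" for k
  proof -
    have "T n * (star (T (Suc k)) * e k) = e k - g (Suc k) * e k" if n: "Suc k \<le> n" for n
    proof -
      have "T n * (star (T (Suc k)) * e k) = (T n * star (T n)) * e k"
        unfolding mult.assoc sTe[OF n] ..
      then show ?thesis unfolding T_final using n
        by (simp add: left_diff_distrib e_mono e_d g_e[OF n])
    qed
    then have "\<forall>\<^sub>F n in sequentially. T n * (star (T (Suc k)) * e k) = e k - g (Suc k) * e k"
      unfolding eventually_sequentially by blast
    then have "(\<lambda>n. T n * (star (T (Suc k)) * e k)) \<longlonglongrightarrow> e k - g (Suc k) * e k"
      by (rule tendsto_eventually)
    from LIMSEQ_unique[OF W(1) this] show ?thesis by (simp add: ml_hom(2,4,8) sWe)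
  qed
  ultimately show ?thesis by blast
qed

section \<open>Carrying the remainders back into \<open>e 0\<close>\<close>

primrec u where
  "u 0 = e 0"
| "u (Suc n) = u n * v n"

text \<open>\<open>u n\<close> composes the moves that take \<open>d n\<close> into
  \<open>e 0\<close>, and \<open>U n\<close> applies them to the pieces \<open>f i\<close>. The
  image of \<open>f n\<close> is the difference of the range projections of \<open>u n\<close> and
  \<open>u (Suc n)\<close>, so the images telescope.\<close>

definition U where "U n = (\<Sum>i<n. u i * f i)"

lemma u_init: "star (u n) * u n = d n"
proof (induction n)
  case 0 then show ?case by (simp add: e_idem d_0)
next
  case (Suc n)
  have "star (u (Suc n)) * u (Suc n) = star (v n) * (star (u n) * u n) * v n"
    by (simp add: star_mult mult.assoc)
  then show ?case by (simp add: Suc v_init mult.assoc d_v)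
qed

lemma u_d: "u n * d n = u n"
  using partial_isometry(1)[of "u n"] by (simp add: u_init d_proj)

lemma e_u: "e 0 * u n = u n"
  by (induction n) (simp_all add: e_idem flip: mult.assoc)

lemma U_Suc: "U (Suc n) = U n + u n * f n" by (simp add: U_def)

text \<open>The \<open>U n\<close> show that every \<open>g n\<close> is equivalent to a proper subprojection of \<open>e 0\<close>.\<close>

lemma U_init: "star (U n) * U n = g n"
  and U_final: "U n * star (U n) = e 0 - u n * star (u n)"
  and U_u: "star (U n) * u n = 0"
proof -
  have fin: "U n * star (U n) = e 0 - u n * star (u n) \<Longrightarrow> star (U n) * u n = 0" for n
  proof -
    assume a: "U n * star (U n) = e 0 - u n * star (u n)"
    have "star (star (U n) * u n) * (star (U n) * u n) = star (u n) * (U n * star (U n)) * u n"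
      by (simp add: star_mult star_star mult.assoc)
    also have "\<dots> = 0"
      unfolding a by (simp add: left_diff_distrib right_diff_distrib mult.assoc e_u u_init u_d)
    finally show "star (U n) * u n = 0" by (rule star_mult_eq_zero)
  qed
  have main: "star (U n) * U n = g n \<and> U n * star (U n) = e 0 - u n * star (u n)" for n
  proof (induction n)
    case 0
    then show ?case by (simp add: U_def g_def e_idem star_zero)
  next
    case (Suc n)
    then have Uu: "star (U n) * u n = 0" using fin by blast
    have uU: "star (u n) * U n = 0" using arg_cong[OF Uu, of star]
      by (simp add: star_mult star_star star_zero)
    have "star (U n * f n) * (U n * f n) = f n * (star (U n) * U n) * f n"
      by (simp add: star_mult f_idem mult.assoc)
    also have "\<dots> = 0" using Suc by (simp add: mult.assoc g_f)
    finally have Uf: "U n * f n = 0" by (rule star_mult_eq_zero)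
    have fU: "f n * star (U n) = 0" using arg_cong[OF Uf, of star]
      by (simp add: star_mult f_idem star_zero)
    have "star (U (Suc n)) * U (Suc n) = star (U n) * U n + (star (U n) * u n) * f n + f n * (star (u n) * U n) + f n * (star (u n) * u n) * f n"
      by (simp add: U_Suc star_add star_mult f_idem distrib_left distrib_right mult.assoc)
    also have "\<dots> = g (Suc n)" using Suc by (simp add: Uu uU u_init f_d f_idem g_Suc)
    finally have 1: "star (U (Suc n)) * U (Suc n) = g (Suc n)" .
    have "U (Suc n) * star (U (Suc n)) = U n * star (U n) + (U n * f n) * star (u n) + u n * (f n * star (U n)) + u n * (f n * f n) * star (u n)"
      by (simp add: U_Suc star_add star_mult f_idem(2) distrib_left distrib_right mult.assoc)
    also have "\<dots> = e 0 - u n * star (u n) + u n * f n * star (u n)"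
      unfolding Uf fU f_idem(1) using Suc by simp
    also have "\<dots> = e 0 - u (Suc n) * star (u (Suc n))"
    proof -
      have "u n * f n * star (u n) = u n * star (u n) - u (Suc n) * star (u (Suc n))"
        by (simp add: f_def left_diff_distrib right_diff_distrib u_d star_mult flip: mult.assoc)
      then show ?thesis by simp
    qed
    finally show ?case using 1 by blast
  qed
  show "star (U n) * U n = g n" "U n * star (U n) = e 0 - u n * star (u n)" using main by blast+
  then show "star (U n) * u n = 0" using fin by blast
qed

lemma e_U: "e 0 * U n = U n"
  by (simp add: U_def sum_distrib_left e_u flip: mult.assoc)

section \<open>Incomparability of the two defects\<close>

lemma norm_g: "norm (g n) \<le> 1"
proof -
  have "projection (u n * star (u n))" using partial_isometry(3)[of "u n"]
    by (simp add: u_init d_proj)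
  moreover have "e 0 * (u n * star (u n)) = u n * star (u n)" by (simp add: e_u flip: mult.assoc)
  moreover have "u n * star (u n) * e 0 = u n * star (u n)"
    using arg_cong[OF e_u[of n], of star] by (simp add: star_mult e_idem mult.assoc)
  ultimately have "projection (U n * star (U n))"
    unfolding U_final by (simp add: projection_def algebra_simps star_diff e_idem)
  then have "norm (star (U n)) \<le> 1"
    using norm_projection_le[of "U n * star (U n)"] cstar_identity[of "star (U n)"]
    by (intro norm_le_one) (simp add: star_star)
  then have "norm (star (U n) * U n) \<le> 1 * 1" by (intro norm_mult_le) (simp_all add: norm_star)
  then show ?thesis by (simp add: U_init)
qed

text \<open>The equation \<open>c * emb (e 0) = c\<close> puts \<open>c\<close> into A, so replacing
  \<open>F\<close> by \<open>g n\<close> changes \<open>F * c\<close> little, and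
  \<open>m * emb (g n) * c\<close> is invertible in the corner of \<open>e 0\<close>. Then
  \<open>e 0\<close> factors through \<open>U n\<close>, and by \<open>finite_projection\<close> the
  factors multiply to \<open>e 0\<close> in the other order too; but the range of \<open>U n\<close>
  is orthogonal to that of \<open>u n\<close>, a nonzero piece of \<open>e 0\<close>.\<close>

lemma no_left_factorization:
  assumes sr1: "nonunital_stable_rank_one TYPE('a)"
    and F: "\<And>k. ml F (e k) = g (Suc k) * e k" "norm F \<le> K"
    and mc: "m * c = emb (e 0)" "emb (e 0) * m = m" "F * c = c" "c * emb (e 0) = c"
  shows False
proof -
  let ?E = "emb (e 0)"
  have EE: "?E * ?E = ?E" by (simp add: e_idem flip: emb_hom)
  obtain c0 where c0: "c = emb c0" using mc(4) mult_emb by metis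
  define b where "b k = c0 - e k * c0" for k
  have b0: "b \<longlonglongrightarrow> 0"
    unfolding b_def using tendsto_diff[OF tendsto_const[of c0] e_lim[of c0]] by simp
  have K0: "K \<ge> 0" using F(2) norm_ge_zero[of F] by linarith
  have close: "norm (c0 - g (Suc k) * c0) \<le> (K + 1) * norm (b k)" for k
  proof -
    have "F * emb (e k) = emb (g (Suc k)) * emb (e k)" by (simp add: mult_emb F emb_hom)
    then have "F * emb (e k * c0) = emb (g (Suc k)) * emb (e k * c0)"
      by (simp add: emb_hom flip: mult.assoc)
    then have "F * emb (b k) - emb (g (Suc k)) * emb (b k) = emb c0 - emb (g (Suc k)) * emb c0"
      using mc(3) by (simp add: b_def emb_hom right_diff_distrib c0)
    then have "norm (c0 - g (Suc k) * c0) = norm (F * emb (b k) - emb (g (Suc k)) * emb (b k))"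
      by (simp add: norm_emb flip: emb_hom)
    also have "\<dots> \<le> norm (F * emb (b k)) + norm (emb (g (Suc k)) * emb (b k))"
      by (rule norm_triangle_ineq4)
    also have "\<dots> \<le> K * norm (b k) + 1 * norm (b k)"
      by (intro add_mono norm_mult_le F) (simp_all add: norm_emb norm_g)
    finally show ?thesis by (simp add: distrib_right)
  qed
  \<comment> \<open>Chosen so that the error |m| (K + 1) \<epsilon> equals |m| / (|m| + 1), which is
    below 1.\<close>
  define \<epsilon> where "\<epsilon> = 1 / ((norm m + 1) * (K + 1))"
  have positive: "norm m + 1 > 0" "K + 1 > 0" using K0 by (simp_all add: add_nonneg_pos)
  have "\<epsilon> > 0" unfolding \<epsilon>_def using positive by simp
  from LIMSEQ_D[OF b0 this] obtain k where k: "norm (b k) < \<epsilon>" by auto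
  define n where "n = Suc k"
  define z where "z = m * emb (g n) * c"
  have "?E - z = m * emb (c0 - g n * c0)"
    by (simp add: z_def emb_hom right_diff_distrib mc c0[symmetric] mult.assoc)
  also have "norm \<dots> \<le> norm m * ((K + 1) * norm (b k))"
    using close[of k] by (intro norm_mult_le) (simp_all add: norm_emb n_def)
  also have "\<dots> \<le> norm m * ((K + 1) * \<epsilon>)"
    using k positive by (intro mult_left_mono) auto
  also have "(K + 1) * \<epsilon> = 1 / (norm m + 1)" using positive by (simp add: \<epsilon>_def)
  also have "norm m * \<dots> = norm m / (norm m + 1)" by simp
  also have "\<dots> < 1" using positive by simp
  finally have nz: "norm (?E - z) < 1" .
  define X where "X = 1 - ?E + z"
  have zE: "?E * z = z" "z * ?E = z"
    by (simp_all add: z_def mult.assoc mc) (simp add: mc flip: mult.assoc)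
  have "norm (1 - X) < 1" using nz by (simp add: X_def)
  then obtain Y where Y: "X * Y = 1" "Y * X = 1"
    using invertible_near_one invertible_el_def by blast
  have "X * ?E = ?E * X" by (simp add: X_def algebra_simps EE zE)
  then have YE: "Y * ?E = ?E * Y" by (rule inverse_commutes[OF Y])
  have zY: "z * (Y * ?E) = ?E"
  proof -
    have "z = X * ?E" by (simp add: X_def algebra_simps EE zE)
    then have "z * (Y * ?E) = X * (?E * Y) * ?E" by (simp add: mult.assoc)
    also have "\<dots> = (X * Y) * (?E * ?E)" by (simp only: YE[symmetric] mult.assoc)
    finally show ?thesis by (simp add: Y EE)
  qed
  \<comment> \<open>Writing \<open>g n\<close> as \<open>star (U n) * U n\<close> splits
    \<open>z * (Y * ?E)\<close> into a product of two elements of A.\<close>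
  define \<alpha> where "\<alpha> = ml m (star (U n))"
  define \<beta> where "\<beta> = U n * mr (Y * ?E) c0"
  have a: "emb \<alpha> = m * emb (star (U n))" by (simp add: \<alpha>_def mult_emb)
  have b: "emb \<beta> = emb (U n) * (c * (Y * ?E))" by (simp add: \<beta>_def emb_hom c0 emb_mult)
  have "emb (\<alpha> * \<beta>) = m * (emb (star (U n) * U n) * (c * (Y * ?E)))"
    by (simp only: emb_hom(7) a b mult.assoc)
  also have "\<dots> = z * (Y * ?E)" by (simp only: U_init z_def mult.assoc)
  finally have ab: "\<alpha> * \<beta> = e 0" by (simp add: zY emb_inject)
  have a1: "e 0 * \<alpha> = \<alpha>"
  proof -
    have "emb (e 0 * \<alpha>) = emb \<alpha>" by (simp add: emb_hom(7) a mc(2) flip: mult.assoc)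
    then show ?thesis by (simp add: emb_inject)
  qed
  have a2: "\<alpha> * e 0 = \<alpha>"
  proof -
    have "star (U n) * e 0 = star (U n)" using arg_cong[OF e_U[of n], of star]
      by (simp add: star_mult e_idem)
    then have "emb (\<alpha> * e 0) = emb \<alpha>"
      by (simp add: emb_hom(7) a mult.assoc flip: emb_hom(7)[of "star (U n)"])
    then show ?thesis by (simp add: emb_inject)
  qed
  have b1: "e 0 * \<beta> = \<beta>" by (simp add: \<beta>_def e_U flip: mult.assoc)
  have b2: "\<beta> * e 0 = \<beta>"
  proof -
    have "emb (\<beta> * e 0) = emb \<beta>" by (simp add: emb_hom(7) b mult.assoc EE)
    then show ?thesis by (simp add: emb_inject)
  qed
  have ba: "\<beta> * \<alpha> = e 0" by (rule finite_projection[OF sr1 e_proj ab a1 a2 b1 b2])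
  have "star (u n) * U n = 0" using arg_cong[OF U_u[of n], of star]
    by (simp add: star_mult star_star star_zero)
  then have "star (u n) * \<beta> = 0" by (simp add: \<beta>_def flip: mult.assoc)
  then have "star (u n) * e 0 = 0" by (simp add: ba[symmetric] flip: mult.assoc)
  moreover have "star (u n) * e 0 = star (u n)"
    using arg_cong[OF e_u[of n], of star] by (simp add: star_mult e_idem)
  ultimately have "d n = 0" by (simp flip: u_init)
  then show False using d_nonzero by blast
qed

text \<open>Factoring through \<open>e 0\<close> would put \<open>F\<close> into A, as
  \<open>f0\<close>. Right multiplication by some \<open>e k\<close> would then almost fix
  \<open>f0\<close>, but \<open>f (Suc k)\<close> is fixed by \<open>f0\<close>, is orthogonal to
  \<open>e k\<close> and has norm 1.\<close>

lemma no_right_factorization: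
  assumes F: "\<And>k. ml F (e k) = g (Suc k) * e k" and mc: "m * c = F" "emb (e 0) * c = c"
  shows False
proof -
  obtain c0 where c0: "c = emb c0" using mc(2) emb_mult by metis
  define f0 where "f0 = ml m c0"
  have Ff: "F = emb f0" using mc(1) by (simp add: c0 f0_def mult_emb)
  have fe: "f0 * e k = g (Suc k) * e k" for k using F[of k] by (simp add: Ff ml_emb)
  have ff: "f0 * f n = f n" for n
  proof -
    have "f0 * f n = (f0 * e n) * f n" by (simp add: mult.assoc f_e)
    also have "\<dots> = g (Suc n) * f n" by (simp add: fe mult.assoc f_e)
    also have "\<dots> = f n" by (simp add: g_Suc distrib_right g_f f_idem)
    finally show ?thesis .
  qed
  have "(\<lambda>k. f0 - f0 * e k) \<longlonglongrightarrow> 0"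
    using tendsto_diff[OF tendsto_const[of f0] e_lim_right[of f0]] by simp
  from LIMSEQ_D[OF this zero_less_one] obtain k where k: "norm (f0 - f0 * e k) < 1" by auto
  have "star (f (Suc k) * e k) = 0" by (simp add: f_e star_zero)
  then have "e k * f (Suc k) = 0" by (simp add: star_mult e_idem f_idem)
  then have "f (Suc k) = (f0 - f0 * e k) * f (Suc k)" by (simp add: left_diff_distrib ff mult.assoc)
  then have "norm (f (Suc k)) \<le> norm (f0 - f0 * e k) * norm (f (Suc k))"
    by (metis norm_mult_ineq)
  then show False using k by (simp add: norm_projection[OF f_proj f_nonzero])
qed

lemma not_extremally_rich:
  assumes "simple TYPE('a)" "nonunital_stable_rank_one TYPE('a)"
  shows "\<not> extremally_rich TYPE('a multiplier)"
proof
  assume rich: "extremally_rich TYPE('a multiplier)"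
  obtain W where W: "star W * W = 1 - emb (e 0)" "\<And>k. ml (1 - W * star W) (e k) = g (Suc k) * e k"
    using ex_partial_isometry by blast
  define F where "F = 1 - W * star W"
  have E: "projection (emb (e 0))" by (simp add: projection_emb e_proj)
  have "projection (star W * W)" unfolding W(1) by (rule projection_compl[OF E])
  then have Fp: "projection F" unfolding F_def by (intro projection_compl partial_isometry(3))
  have WF: "W * star W = 1 - F" by (simp add: F_def)
  obtain y l where y: "norm (W - y) < 1" "l * y = 1 \<or> y * l = 1"
    using extremally_rich_approx[OF assms(1) rich zero_less_one] by blast
  from y(2) show False
  proof
    assume "l * y = 1"
    from left_invertible_near_partial_isometry[OF E W(1) WF this y(1)] obtain m c
      where mc: "m * c = emb (e 0)" "emb (e 0) * m = m" "F * c = c" "c * emb (e 0) = c" by blast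
    show False
      by (rule no_left_factorization[OF assms(2) _ norm_projection_le[OF Fp] mc]) (simp only: F_def W(2))
  next
    assume "y * l = 1"
    \<comment> \<open>Taking adjoints exchanges the two defects, so this case leads to a
      factorization of \<open>F\<close> through \<open>e 0\<close>.\<close>
    then have "star l * star y = 1" by (simp add: star_one flip: star_mult)
    moreover have "norm (star W - star y) < 1" using y(1) by (simp add: norm_star flip: star_diff)
    moreover have "star (star W) * star W = 1 - F" "star W * star (star W) = 1 - emb (e 0)"
      by (simp_all add: star_star WF W(1))
    ultimately obtain m c where mc: "m * c = F" "F * m = m" "emb (e 0) * c = c" "c * F = c"
      using left_invertible_near_partial_isometry[OF Fp] by blast
    show False by (rule no_right_factorization[OF _ mc(1,3)]) (simp only: F_def W(2))
  qed
qed

end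

theorem proposition3p14:
  assumes "nonunital TYPE('a::cstar_algebra)"
    and "simple TYPE('a)"
    and "separable_space (euclidean :: 'a topology)"
    and "nonunital_real_rank_zero TYPE('a)"
    and "nonunital_stable_rank_one TYPE('a)"
    and "strictly_unperforated TYPE('a V)"
    and "\<not> elementary TYPE('a)"
    and "real_rank_zero TYPE('a multiplier)"
  shows "\<not> extremally_rich TYPE('a multiplier)"
proof -
  obtain e :: "nat \<Rightarrow> 'a" where e: "\<And>n. projection (e n)" "\<And>n. e n \<noteq> 0" "\<And>n. e (Suc n) * e n = e n"
    "\<And>n. e n \<noteq> e (Suc n)" and lim: "\<And>a. (\<lambda>n. e n * a) \<longlonglongrightarrow> a"
    using ex_approximate_unit[OF assms(1,3,4)] by blast
  have r: "projection (e (Suc n) - e n)" for n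
  proof -
    have "e n * e (Suc n) = e n"
      using arg_cong[OF e(3)[of n], of star] e(1) by (simp add: star_mult projection_def)
    then show ?thesis using e(1)[of n] e(1)[of "Suc n"] e(3)[of n]
      by (simp add: projection_def algebra_simps star_diff)
  qed
  let ?P = "\<lambda>(n::nat) x. projection x \<and> x \<noteq> 0 \<and> (n = 0 \<longrightarrow> x = e 0)"
  let ?R = "\<lambda>(n::nat) v x. v * (e (Suc n) - e n) = v \<and> x * v = v \<and> v * star v \<noteq> x"
  \<comment> \<open>\<open>d\<close> and \<open>v\<close> are chosen together:
    \<open>d (Suc n)\<close> is the initial projection of the exchange \<open>v n\<close>, which
    leads from the n-th increment properly into \<open>d n\<close>.\<close>
  have "\<exists>d. \<forall>n. ?P n (d n) \<and> (\<exists>v. star v * v = d (Suc n) \<and> ?R n v (d n))"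
  proof (rule dependent_nat_choice)
    show "\<exists>x. ?P 0 x" using e by blast
    fix x n assume x: "?P n x"
    have "e (Suc n) - e n \<noteq> 0" using e(4)[of n] by simp
    then obtain v where "projection (star v * v)" "star v * v \<noteq> 0" "?R n v x"
      using ex_small_partial_isometry[OF assms(2,4,7) _ _ r[of n], of x] x by blast
    then show "\<exists>y. ?P (Suc n) y \<and> (\<exists>v. star v * v = y \<and> ?R n v x)" by blast
  qed
  then obtain d where d: "\<And>n. ?P n (d n)" "\<forall>n. \<exists>v. star v * v = d (Suc n) \<and> ?R n v (d n)" by blast
  from d(2) obtain v where v: "\<And>n. star (v n) * v n = d (Suc n)" "\<And>n. ?R n (v n) (d n)" by metis
  interpret ladder e d v
    using e lim d(1) v by unfold_locales blast+
  show ?thesis by (rule not_extremally_rich[OF assms(2,5)])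
qed

end
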